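(* Let $\alpha\in\mathbb{C}$, $\theta\in\mathbb{R}$, let $p$ be a positive integer, and consider a shifted convolution quadrature (SCQ) for $I^{\alpha}$ with shift $\theta$ whose convolution weights $\{\omega_j\}_{j\ge 0}$ are the coefficients of a generating function $\omega(\xi)=\sum_{j\ge0}\omega_j\xi^j$ satisfying Condition-$\omega$. Then the SCQ is convergent of order $p$ to $I^{\alpha}$ if and only if it is stable for $I^{\alpha}$ and consistent of order $p$ for $I^{\alpha}$.
   Context: Riemann-Liouville operators: for $\Re\alpha>0$, $I^{\alpha}f(x)=\frac{1}{\Gamma(\alpha)}\int_0^x (x-s)^{\alpha-1}f(s)\,ds$; $I^{-\alpha}f(x)=\frac{d^n}{dx^n}I^{n-\alpha}f(x)$ with $n=\lceil\Re\alpha\rceil$; $I^0$ is the identity. On powers, for $\beta\in\mathbb{C}$, $\beta\neq 0,-1,-2,\dots$, $(I^{\alpha}t^{\beta-1})(x)=\frac{\Gamma(\beta)}{\Gamma(\alpha+\beta)}x^{\alpha+\beta-1}$ (understood by analytic continuation in $\beta$ where the integral diverges, with $1/\Gamma=0$ at the poles of $\Gamma$). SCQ: for a step size $h>0$, weights $\omega_j\in\mathbb{C}$ and shift $\theta$, the convolution part of the SCQ is $$\Omega_h^{\alpha}f(x)=h^{\alpha}\sum_{0\le jh\le x+\theta h}\omega_j f\big(x+(\theta-j)h\big),$$ and the convolution error is $E_h^{\alpha}=\Omega_h^{\alpha}-I^{\alpha}$; $(E_h^{\alpha}t^{\beta-1})(x)$ denotes $E_h^\alpha$ applied to $t\mapsto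 t^{\beta-1}$ evaluated at $x$. If $\Re\beta<1$, a term in which $t^{\beta-1}$ would be evaluated at $t=0$ is read as $0$. Stable for $I^{\alpha}$: $\omega_n=O(n^{\alpha-1})$ as $n\to\infty$ (i.e. $|\omega_n|\le C n^{\Re\alpha-1}$). Consistent of order $p$ for $I^{\alpha}$: $h^{\alpha}e^{\theta h}\omega(e^{-h})=1+O(h^p)$ as $h\to0^+$. Convergent of order $p$ to $I^{\alpha}$: $(E_h^{\alpha}t^{\beta-1})(1)=O(h^{\beta})+O(h^p)$ as $h\to 0^+$, for all $\beta\in\mathbb{C}$ with $\beta\ne0,-1,-2,\dots$ (the implied constants may depend on $\beta$). Form of the generating function: $\omega(\xi)=\big[\frac{p_1(\xi)}{p_2(\xi)}\big]^{\alpha}\frac{p_3(\xi)}{p_4(\xi)}$ with polynomials $p_i$ and $p_2(1)=0$, and it is written as $$\omega(\xi)=\nu(\xi)\prod_{j=0}^{\ell}(\xi-\xi_j)^{-\alpha_j},\qquad \xi_0=1,\ \alpha_0=\alpha,$$ where the $\xi_j$ are distinct with $|\xi_j|=1$, $\nu$ is analytic on the closed unit disc, $\nu(\xi_j)\neq0$, and $\alpha_j\ne0,-1,-2,\dots$ for $j\ge1$. Condition-$\omega$: $\omega(\xi)$ is analytic and without zeros in the open unit disc $|\xi|<1$, and $\Re\alpha_j\le\Re\alpha$ for all $j$.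
   Formalization: In "convergent of order p", h→0+ is taken only through step sizes h=1/n; over all real h the claim fails (α=1, ω=1/(1-ξ), θ=0, Re β<1: a node can be arbitrarily near 0). If Re α is an integer ≤0 and α is not real, I^α takes one more derivative than the ceiling gives. *)

theory Defs
  imports "HOL-Analysis.Analysis" "HOL-Library.Landau_Symbols"
begin

section \<open>Riemann--Liouville operators\<close>

definition RL_integral :: "complex \<Rightarrow> (real \<Rightarrow> complex) \<Rightarrow> real \<Rightarrow> complex" where
  "RL_integral \<alpha> f x =
     (if \<alpha> = 0 then f x
      else 1 / Gamma \<alpha> * integral {0..x} (\<lambda>s. complex_of_real (x - s) powr (\<alpha> - 1) * f s))"

text \<open>
  The number of derivatives taken in front of the integral. It is 0 if \<open>\<alpha> = 0\<close> or \<open>Re \<alpha> > 0\<close>, and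
  \<open>\<lceil>Re (-\<alpha>)\<rceil>\<close> if \<open>Re \<alpha> < 0\<close>, except that one more derivative is taken when \<open>Re \<alpha>\<close> is a
  nonpositive integer and \<open>\<alpha>\<close> is not real, because with \<open>\<lceil>Re (-\<alpha>)\<rceil>\<close> derivatives the remaining
  integral would have nonzero purely imaginary order and diverge (see lemma \<open>RL_derivs_eq\<close>).
\<close>
definition RL_derivs :: "complex \<Rightarrow> nat" where
  "RL_derivs \<alpha> = (LEAST n. \<alpha> + of_nat n = 0 \<or> Re (\<alpha> + of_nat n) > 0)"

definition RL :: "complex \<Rightarrow> (real \<Rightarrow> complex) \<Rightarrow> real \<Rightarrow> complex" where
  "RL \<alpha> f = ((\<lambda>g x. vector_derivative g (at x)) ^^ RL_derivs \<alpha>) (RL_integral (\<alpha> + of_nat (RL_derivs \<alpha>)) f)"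

text \<open>
  The function \<open>t \<mapsto> t^(\<beta>-1)\<close> on \<open>t \<ge> 0\<close>. Since \<open>0 powr z = 0\<close> for all \<open>z\<close>, only \<open>0^0 = 1\<close> has to
  be treated separately; for \<open>Re \<beta> < 1\<close> the value at 0 is 0, as in the convention for quadratures.
\<close>
definition pow_fun :: "complex \<Rightarrow> real \<Rightarrow> complex" where
  "pow_fun \<beta> t = (if t = 0 \<and> \<beta> = 1 then 1 else complex_of_real t powr (\<beta> - 1))"

text \<open>
  \<open>I^\<alpha> t^(\<beta>-1)\<close>, extended by analytic continuation in \<open>\<beta>\<close> to those \<open>\<beta>\<close> for which the integral
  diverges. \<open>rGamma\<close> is the entire function \<open>1 / \<Gamma>\<close>, which vanishes at the poles of \<open>\<Gamma>\<close>.
  Lemma \<open>RL_pow_eq\<close> below shows that the two branches are given by the same formula.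
\<close>
definition RL_pow :: "complex \<Rightarrow> complex \<Rightarrow> real \<Rightarrow> complex" where
  "RL_pow \<alpha> \<beta> x =
     (if Re \<beta> > 0 then RL \<alpha> (pow_fun \<beta>) x
      else Gamma \<beta> * rGamma (\<alpha> + \<beta>) * complex_of_real x powr (\<alpha> + \<beta> - 1))"


subsection \<open>The operators on powers\<close>

definition tpow :: "complex \<Rightarrow> real \<Rightarrow> complex" where
  "tpow c t = (if t > 0 then exp (c * complex_of_real (ln t)) else 0)"

lemma tpow_measurable [measurable]: "tpow c \<in> borel_measurable borel"
  unfolding tpow_def by measurable

lemma tpow_powr: "t > 0 \<Longrightarrow> tpow c t = complex_of_real t powr c"
  by (simp add: tpow_def powr_def Ln_of_real)

lemma norm_tpow: "norm (tpow c t) = (if t > 0 then t powr Re c else 0)"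
  by (simp add: tpow_def powr_def)

lemma tpow_mult: "u > 0 \<Longrightarrow> tpow c (u * t) = tpow c u * tpow c t"
  by (auto simp: tpow_def ln_mult ring_distribs exp_add zero_less_mult_iff)

lemma tpow_add: "tpow (c + d) t = tpow c t * tpow d t"
  by (simp add: tpow_def ring_distribs exp_add)

lemma tpow_Gamma:
  assumes "Re z > 0"
  shows "integrable lborel (\<lambda>t. tpow (z - 1) t * complex_of_real (exp (- t)))" (is ?A)
    and "(LINT t|lborel. tpow (z - 1) t * complex_of_real (exp (- t))) = Gamma z" (is ?B)
proof -
  let ?f = "\<lambda>t. complex_of_real t powr (z - 1) / complex_of_real (exp t)"
  have eq: "indicator {0<..} t *\<^sub>R ?f t = tpow (z - 1) t * complex_of_real (exp (- t))" for t
    by (auto simp: tpow_powr indicator_def exp_minus field_simps) (simp add: tpow_def)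
  have abs: "?f absolutely_integrable_on {0<..}"
    using absolutely_integrable_Gamma_integral'[OF assms] .
  hence "integrable lebesgue (\<lambda>t. tpow (z - 1) t * complex_of_real (exp (- t)))"
    by (simp add: set_integrable_def eq)
  thus ?A by (subst (asm) integrable_completion) auto
  have "(LINT t:{0<..}|lebesgue. ?f t) = Gamma z"
    using set_lebesgue_integral_eq_integral(2)[OF abs] integral_unique[OF Gamma_integral_complex'[OF assms]]
    by simp
  thus ?B by (simp add: set_lebesgue_integral_def eq integral_completion)
qed

lemma complex_Re_pos_nonpos_Ints: "Re z > 0 \<Longrightarrow> z \<notin> \<int>\<^sub>\<le>\<^sub>0"
  by (auto elim!: nonpos_Ints_cases)

lemma tpow_convolution:
  assumes a: "Re a > 0" and b: "Re b > 0" and u: "u > 0"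
  shows "integrable lborel (\<lambda>t. tpow (a - 1) t * tpow (b - 1) (u - t))"
    and "(LINT t|lborel. tpow (a - 1) t * tpow (b - 1) (u - t)) = tpow (a + b - 1) u * Beta a b"
proof -
  define H where "H = (\<lambda>u t. tpow (a - 1) t * tpow (b - 1) (u - t))"
  have H_meas [measurable]: "(\<lambda>x. H (fst x) (snd x)) \<in> borel_measurable (lborel \<Otimes>\<^sub>M lborel)"
    "H u \<in> borel_measurable borel" for u
    unfolding H_def by measurable
  have int1: "integrable lborel (H 1)"
  proof (rule Bochner_Integration.integrable_bound)
    show "integrable lborel (\<lambda>t. indicator {0..1} t *\<^sub>R (t powr (Re a - 1) * (1 - t) powr (Re b - 1)))"
      using integrable_Beta[OF a b] by (simp add: set_integrable_def)
    show "AE t in lborel. norm (H 1 t) \<le> norm (indicator {0..1} t *\<^sub>R (t powr (Re a - 1) * (1 - t) powr (Re b - 1)))"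
      by (auto simp: H_def norm_mult norm_tpow indicator_def)
  qed auto
  have scale: "H u (u * t) = tpow (a + b - 2) u * H 1 t" if "u > 0" for u t
  proof -
    have "tpow (a + b - 2) u = tpow (a - 1) u * tpow (b - 1) u"
      by (simp add: tpow_add [symmetric] algebra_simps)
    moreover have "u - u * t = u * (1 - t)" by (simp add: algebra_simps)
    ultimately show ?thesis using that
      by (simp only: H_def tpow_mult) (simp add: mult_ac)
  qed
  have intu: "integrable lborel (H u)" if "u > 0" for u
    using that int1 lborel_integrable_real_affine_iff[of u "H u" 0] by (simp add: scale)
  define B where "B = (LINT t|lborel. H 1 t)"
  have valu: "(LINT t|lborel. H u t) = tpow (a + b - 1) u * B" if "u > 0" for u
  proof -
    have "(LINT t|lborel. H u t) = u *\<^sub>R (LINT t|lborel. tpow (a + b - 2) u * H 1 t)"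
      using lborel_integral_real_affine[of u "H u" 0] that by (simp add: scale)
    also have "\<dots> = (tpow 1 u * tpow (a + b - 2) u) * B"
      using that by (simp add: B_def scaleR_conv_of_real tpow_powr)
    also have "tpow 1 u * tpow (a + b - 2) u = tpow (a + b - 1) u"
      by (simp add: tpow_add [symmetric] algebra_simps)
    finally show ?thesis .
  qed
  define C where "C = (LINT t|lborel. norm (H 1 t))"
  have normu: "(LINT t|lborel. norm (H u t)) = norm (tpow (a + b - 1) u) * C" if "u > 0" for u
  proof -
    have "(LINT t|lborel. norm (H u t)) = u *\<^sub>R (LINT t|lborel. norm (tpow (a + b - 2) u * H 1 t))"
      using lborel_integral_real_affine[of u "\<lambda>t. norm (H u t)" 0] that by (simp add: scale)
    also have "\<dots> = norm (tpow 1 u * tpow (a + b - 2) u) * C"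
      using that by (simp add: C_def norm_mult norm_tpow)
    also have "tpow 1 u * tpow (a + b - 2) u = tpow (a + b - 1) u"
      by (simp add: tpow_add [symmetric] algebra_simps)
    finally show ?thesis .
  qed
  have H0: "H u t = 0" if "u \<le> 0" for u t
    using that by (auto simp: H_def tpow_def)
  let ?F = "\<lambda>u t. H u t * complex_of_real (exp (- u))"
  have valu': "(LINT t|lborel. ?F u t) = tpow (a + b - 1) u * complex_of_real (exp (- u)) * B" for u
    by (cases "u > 0") (simp_all add: valu H0 tpow_def[of _ u] mult_ac)
  have normu': "(LINT t|lborel. norm (?F u t)) = norm (tpow (a + b - 1) u * complex_of_real (exp (- u))) * C" for u
    by (cases "u > 0") (simp_all add: normu H0 norm_mult tpow_def[of _ u] mult_ac)
  have ab: "Re (a + b) > 0" using a b by simp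
  have intF: "integrable (lborel \<Otimes>\<^sub>M lborel) (case_prod ?F)"
  proof (rule lborel_pair.Fubini_integrable)
    show "integrable lborel (\<lambda>u. LINT t|lborel. norm (case_prod ?F (u, t)))"
      using tpow_Gamma(1)[OF ab] by (simp add: normu' del: of_real_exp)
    show "AE u in lborel. integrable lborel (\<lambda>t. case_prod ?F (u, t))"
    proof (intro AE_I2)
      fix u show "integrable lborel (\<lambda>t. case_prod ?F (u, t))"
        by (cases "u > 0") (simp_all add: intu H0)
    qed
  qed (simp add: case_prod_unfold)
  have "Gamma (a + b) * B = (LINT u|lborel. LINT t|lborel. ?F u t)"
    unfolding valu' using tpow_Gamma(2)[OF ab] by (simp del: of_real_exp)
  also have "\<dots> = (LINT t|lborel. LINT u|lborel. ?F u t)"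
    using lborel_pair.Fubini_integral[OF intF] by simp
  also have "\<dots> = (LINT t|lborel. tpow (a - 1) t * complex_of_real (exp (- t)) * Gamma b)"
  proof (rule Bochner_Integration.integral_cong[OF refl])
    fix t :: real
    have "(LINT u|lborel. ?F u t) = (LINT v|lborel. ?F (t + v) t)"
      using lborel_integral_real_affine[of 1 "\<lambda>u. ?F u t" t] by simp
    also have "\<dots> = (LINT v|lborel. tpow (a - 1) t * complex_of_real (exp (- t)) *
                       (tpow (b - 1) v * complex_of_real (exp (- v))))"
    proof (rule Bochner_Integration.integral_cong[OF refl])
      fix v :: real
      have "exp (- (t + v)) = exp (- t) * exp (- v)" by (simp add: exp_add [symmetric])
      thus "?F (t + v) t = tpow (a - 1) t * complex_of_real (exp (- t)) *
              (tpow (b - 1) v * complex_of_real (exp (- v)))"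
        by (simp only: H_def of_real_mult) (simp add: mult_ac)
    qed
    also have "\<dots> = tpow (a - 1) t * complex_of_real (exp (- t)) * Gamma b"
      using tpow_Gamma(2)[OF b] by (simp del: of_real_exp)
    finally show "(LINT u|lborel. ?F u t) = tpow (a - 1) t * complex_of_real (exp (- t)) * Gamma b" .
  qed
  also have "\<dots> = Gamma a * Gamma b"
    using tpow_Gamma(2)[OF a] by (simp del: of_real_exp)
  finally have eq: "Gamma (a + b) * B = Gamma a * Gamma b" .
  have "Gamma (a + b) \<noteq> 0"
    using complex_Re_pos_nonpos_Ints[OF ab] by (simp add: Gamma_eq_zero_iff)
  hence "B = Beta a b"
    using eq by (simp add: Beta_def field_simps)
  with intu[OF u] valu[OF u]
  show "integrable lborel (\<lambda>t. tpow (a - 1) t * tpow (b - 1) (u - t))"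
    and "(LINT t|lborel. tpow (a - 1) t * tpow (b - 1) (u - t)) = tpow (a + b - 1) u * Beta a b"
    by (simp_all add: H_def)
qed

lemma RL_integral_pow:
  assumes g: "\<gamma> = 0 \<or> Re \<gamma> > 0" and b: "Re \<beta> > 0" and x: "x > 0"
  shows "RL_integral \<gamma> (pow_fun \<beta>) x = Gamma \<beta> * rGamma (\<gamma> + \<beta>) * complex_of_real x powr (\<gamma> + \<beta> - 1)"
proof (cases "\<gamma> = 0")
  case True
  have "Gamma \<beta> * rGamma \<beta> = 1"
    using complex_Re_pos_nonpos_Ints[OF b] by (simp add: rGamma_inverse_Gamma Gamma_eq_zero_iff)
  with True x show ?thesis by (simp add: RL_integral_def pow_fun_def)
next
  case False
  with g have g: "Re \<gamma> > 0" by simp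
  let ?f = "\<lambda>s. tpow (\<beta> - 1) s * tpow (\<gamma> - 1) (x - s)"
  let ?h = "\<lambda>s. complex_of_real (x - s) powr (\<gamma> - 1) * pow_fun \<beta> s"
  have "(?f has_integral (tpow (\<beta> + \<gamma> - 1) x * Beta \<beta> \<gamma>)) UNIV"
    using has_integral_integral_lborel[OF tpow_convolution(1)[OF b g x]] tpow_convolution(2)[OF b g x] by simp
  also have "?f = (\<lambda>s. if s \<in> {0<..<x} then ?h s else 0)"
    by (auto simp: fun_eq_iff tpow_powr pow_fun_def) (auto simp: tpow_def)
  finally have "(?h has_integral (tpow (\<beta> + \<gamma> - 1) x * Beta \<beta> \<gamma>)) {0..x}"
    by (subst (asm) has_integral_restrict_UNIV) (simp add: has_integral_Icc_iff_Ioo)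
  hence "integral {0..x} ?h = complex_of_real x powr (\<gamma> + \<beta> - 1) * Beta \<beta> \<gamma>"
    using x by (simp add: integral_unique tpow_powr add_ac)
  moreover have "Gamma \<gamma> \<noteq> 0"
    using complex_Re_pos_nonpos_Ints[OF g] by (simp add: Gamma_eq_zero_iff)
  ultimately show ?thesis using False
    by (simp add: RL_integral_def Beta_altdef add_ac)
qed

lemma vector_derivative_pow:
  assumes "\<And>x. x > 0 \<Longrightarrow> f x = K * rGamma c * complex_of_real x powr (c - 1)" and x: "x > 0"
  shows "vector_derivative f (at x) = K * rGamma (c - 1) * complex_of_real x powr (c - 1 - 1)"
proof -
  have "((\<lambda>z. K * rGamma c * z powr (c - 1)) has_field_derivative
           (K * rGamma c * ((c - 1) * complex_of_real x powr (c - 1 - 1)))) (at (complex_of_real x))"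
    using x by (auto intro!: derivative_eq_intros simp: complex_nonpos_Reals_iff)
  from has_vector_derivative_real_field[OF this]
  have "((\<lambda>t. K * rGamma c * complex_of_real t powr (c - 1)) has_vector_derivative
           (K * rGamma c * ((c - 1) * complex_of_real x powr (c - 1 - 1)))) (at x)" .
  moreover have "K * rGamma c * ((c - 1) * complex_of_real x powr (c - 1 - 1)) =
                 K * rGamma (c - 1) * complex_of_real x powr (c - 1 - 1)"
    using rGamma_plus1[of "c - 1"] by (simp add: mult_ac)
  ultimately have "((\<lambda>t. K * rGamma c * complex_of_real t powr (c - 1)) has_vector_derivative
           (K * rGamma (c - 1) * complex_of_real x powr (c - 1 - 1))) (at x)" by (simp only:)
  hence "(f has_vector_derivative (K * rGamma (c - 1) * complex_of_real x powr (c - 1 - 1))) (at x)"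
    by (rule has_vector_derivative_transform_within_open[of _ _ _ "{0<..}"]) (use assms in auto)
  thus ?thesis by (rule vector_derivative_at)
qed

lemma RL_derivs: "\<alpha> + of_nat (RL_derivs \<alpha>) = 0 \<or> Re (\<alpha> + of_nat (RL_derivs \<alpha>)) > 0"
proof -
  obtain n where "real n > - Re \<alpha>" using reals_Archimedean2 by blast
  hence "\<alpha> + of_nat n = 0 \<or> Re (\<alpha> + of_nat n) > 0" by simp
  thus ?thesis unfolding RL_derivs_def by (rule LeastI)
qed

lemma RL_derivs_eq:
  assumes "Re \<alpha> < 0" "Re \<alpha> \<notin> \<int> \<or> Im \<alpha> = 0"
  shows "RL_derivs \<alpha> = nat \<lceil>Re (- \<alpha>)\<rceil>"
  unfolding RL_derivs_def
proof (rule Least_equality)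
  let ?n = "nat \<lceil>Re (- \<alpha>)\<rceil>"
  have n: "real ?n = of_int \<lceil>- Re \<alpha>\<rceil>" using assms(1) by simp
  hence ge: "Re \<alpha> + real ?n \<ge> 0" by linarith
  show "\<alpha> + of_nat ?n = 0 \<or> Re (\<alpha> + of_nat ?n) > 0"
  proof (cases "Re \<alpha> + real ?n = 0")
    case True
    hence "Re \<alpha> = of_int (- \<lceil>- Re \<alpha>\<rceil>)" unfolding n by simp
    hence "Re \<alpha> \<in> \<int>" by (metis Ints_of_int)
    with assms(2) True show ?thesis by (auto simp: complex_eq_iff)
  next
    case False
    with ge show ?thesis by simp
  qed
next
  fix m assume "\<alpha> + of_nat m = 0 \<or> Re (\<alpha> + of_nat m) > 0"
  hence "Re \<alpha> + real m \<ge> 0" by (auto simp: complex_eq_iff)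
  thus "nat \<lceil>Re (- \<alpha>)\<rceil> \<le> m" by (simp add: nat_le_iff ceiling_le_iff)
qed

lemma RL_pow_eq:
  assumes x: "x > 0"
  shows "RL_pow \<alpha> \<beta> x = Gamma \<beta> * rGamma (\<alpha> + \<beta>) * complex_of_real x powr (\<alpha> + \<beta> - 1)"
proof (cases "Re \<beta> > 0")
  case True
  let ?D = "\<lambda>g x. vector_derivative g (at x) :: complex"
  have "(?D ^^ n) (RL_integral (\<alpha> + of_nat (RL_derivs \<alpha>)) (pow_fun \<beta>)) x =
          Gamma \<beta> * rGamma (\<alpha> + of_nat (RL_derivs \<alpha>) + \<beta> - of_nat n) *
            complex_of_real x powr (\<alpha> + of_nat (RL_derivs \<alpha>) + \<beta> - of_nat n - 1)" if "x > 0" for n x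
    using that
  proof (induction n arbitrary: x)
    case 0
    then show ?case using RL_integral_pow[OF RL_derivs True] by simp
  next
    case (Suc n)
    show ?case
      using vector_derivative_pow[OF Suc.IH Suc.prems] by (simp add: algebra_simps)
  qed
  from this[OF x, of "RL_derivs \<alpha>"] show ?thesis
    using True by (simp add: RL_pow_def RL_def)
qed (simp add: RL_pow_def)


section \<open>Shifted convolution quadratures\<close>

definition scq :: "(nat \<Rightarrow> complex) \<Rightarrow> complex \<Rightarrow> real \<Rightarrow> real \<Rightarrow> (real \<Rightarrow> complex) \<Rightarrow> real \<Rightarrow> complex" where
  "scq w \<alpha> \<theta> h f x =
     complex_of_real h powr \<alpha> * (\<Sum>j | real j * h \<le> x + \<theta> * h. w j * f (x + (\<theta> - real j) * h))"

definition scq_error_pow :: "(nat \<Rightarrow> complex) \<Rightarrow> complex \<Rightarrow> real \<Rightarrow> real \<Rightarrow> complex \<Rightarrow> real \<Rightarrow> complex" where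
  "scq_error_pow w \<alpha> \<theta> h \<beta> x = scq w \<alpha> \<theta> h (pow_fun \<beta>) x - RL_pow \<alpha> \<beta> x"

definition scq_stable :: "(nat \<Rightarrow> complex) \<Rightarrow> complex \<Rightarrow> bool" where
  "scq_stable w \<alpha> \<longleftrightarrow> w \<in> O(\<lambda>n. of_nat n powr (\<alpha> - 1))"

definition scq_consistent :: "(complex \<Rightarrow> complex) \<Rightarrow> complex \<Rightarrow> real \<Rightarrow> nat \<Rightarrow> bool" where
  "scq_consistent \<omega> \<alpha> \<theta> p \<longleftrightarrow>
     (\<lambda>h. complex_of_real h powr \<alpha> * complex_of_real (exp (\<theta> * h)) * \<omega> (complex_of_real (exp (- h))) - 1)
       \<in> O[at_right 0](\<lambda>h. complex_of_real (h ^ p))"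

text \<open>
  Convergence is tested at \<open>x = 1\<close> on uniform grids \<open>{0, h, 2h, \<dots>}\<close> that contain the point 1, so the
  limit \<open>h \<rightarrow> 0+\<close> is taken through the step sizes \<open>h = 1/n\<close>. Through arbitrary real \<open>h\<close> the estimate
  cannot be asked for: the last node \<open>t = 1 + (\<theta> - j) h \<ge> 0\<close> of the sum could then be positive but
  arbitrarily small relative to \<open>h\<close>, and for \<open>Re \<beta> < 1\<close> the term \<open>h^\<alpha> \<omega>\<^sub>j t^(\<beta>-1)\<close> would be
  unbounded near \<open>t = 0\<close> for every \<open>j\<close> with \<open>\<omega>\<^sub>j \<noteq> 0\<close> (already for \<open>\<omega>(\<xi>) = 1/(1-\<xi>)\<close>, \<open>\<alpha> = 1\<close>, \<open>\<theta> = 0\<close>).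
\<close>
definition scq_convergent :: "(nat \<Rightarrow> complex) \<Rightarrow> complex \<Rightarrow> real \<Rightarrow> nat \<Rightarrow> bool" where
  "scq_convergent w \<alpha> \<theta> p \<longleftrightarrow>
     (\<forall>\<beta>. \<beta> \<notin> \<int>\<^sub>\<le>\<^sub>0 \<longrightarrow>
        (\<exists>u v. u \<in> O[at 0 within {h. h > 0 \<and> 1 / h \<in> \<nat>}](\<lambda>h. complex_of_real h powr \<beta>) \<and>
               v \<in> O[at 0 within {h. h > 0 \<and> 1 / h \<in> \<nat>}](\<lambda>h. complex_of_real (h ^ p)) \<and>
               (\<forall>h. scq_error_pow w \<alpha> \<theta> h \<beta> 1 = u h + v h)))"


section \<open>Generating functions\<close>

definition generating_function :: "(nat \<Rightarrow> complex) \<Rightarrow> (complex \<Rightarrow> complex) \<Rightarrow> bool" where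
  "generating_function w \<omega> \<longleftrightarrow> (\<forall>z. norm z < 1 \<longrightarrow> (\<lambda>j. w j * z ^ j) sums \<omega> z)"

definition is_power_value :: "complex \<Rightarrow> complex \<Rightarrow> complex \<Rightarrow> bool" where
  "is_power_value w a v \<longleftrightarrow> (\<exists>L. exp L = w \<and> v = exp (a * L))"

text \<open>
  \<open>\<omega> = [p\<^sub>1/p\<^sub>2]^\<alpha> p\<^sub>3/p\<^sub>4\<close> on the unit disc, for some branch of the multivalued power. Only the values are
  prescribed; as two values of a power differ by one of countably many factors, an analytic \<open>\<omega>\<close> of
  this form does follow one analytic branch of the power.
\<close>
definition quotient_power_form ::
  "(complex \<Rightarrow> complex) \<Rightarrow> complex \<Rightarrow> complex poly \<Rightarrow> complex poly \<Rightarrow> complex poly \<Rightarrow> complex poly \<Rightarrow> bool" where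
  "quotient_power_form \<omega> \<alpha> p1 p2 p3 p4 \<longleftrightarrow>
     p1 \<noteq> 0 \<and> p2 \<noteq> 0 \<and> p4 \<noteq> 0 \<and> poly p2 1 = 0 \<and>
     (\<forall>z. norm z < 1 \<and> poly p1 z \<noteq> 0 \<and> poly p2 z \<noteq> 0 \<and> poly p4 z \<noteq> 0 \<longrightarrow>
        (\<exists>v. is_power_value (poly p1 z / poly p2 z) \<alpha> v \<and> \<omega> z = v * (poly p3 z / poly p4 z)))"

text \<open>
  \<open>\<omega> = \<nu> \<Prod>\<^sub>j (\<xi> - \<xi>\<^sub>j)^(-\<alpha>\<^sub>j)\<close> on the unit disc, where \<open>L j\<close> is any analytic branch of \<open>log (\<xi> - \<xi>\<^sub>j)\<close>
  there (the principal branch will not do: for \<open>\<xi>\<^sub>j = 1\<close> its cut runs through the disc).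
\<close>
definition singular_factorization ::
  "(complex \<Rightarrow> complex) \<Rightarrow> complex \<Rightarrow> nat \<Rightarrow> (nat \<Rightarrow> complex) \<Rightarrow> (nat \<Rightarrow> complex) \<Rightarrow> (complex \<Rightarrow> complex) \<Rightarrow> bool" where
  "singular_factorization \<omega> \<alpha> l \<xi> a \<nu> \<longleftrightarrow>
     \<xi> 0 = 1 \<and> a 0 = \<alpha> \<and> inj_on \<xi> {..l} \<and>
     (\<forall>j\<le>l. norm (\<xi> j) = 1 \<and> \<nu> (\<xi> j) \<noteq> 0) \<and>
     (\<forall>j\<in>{1..l}. a j \<notin> \<int>\<^sub>\<le>\<^sub>0) \<and>
     \<nu> analytic_on cball 0 1 \<and>
     (\<exists>L. (\<forall>j\<le>l. L j holomorphic_on ball 0 1 \<and> (\<forall>z\<in>ball 0 1. exp (L j z) = z - \<xi> j)) \<and>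
          (\<forall>z\<in>ball 0 1. \<omega> z = \<nu> z * (\<Prod>j\<le>l. exp (- a j * L j z))))"

definition condition_omega :: "(complex \<Rightarrow> complex) \<Rightarrow> complex \<Rightarrow> nat \<Rightarrow> (nat \<Rightarrow> complex) \<Rightarrow> bool" where
  "condition_omega \<omega> \<alpha> l a \<longleftrightarrow>
     \<omega> analytic_on ball 0 1 \<and> (\<forall>z\<in>ball 0 1. \<omega> z \<noteq> 0) \<and> (\<forall>j\<le>l. Re (a j) \<le> Re \<alpha>)"

end

theory Submission
  imports Defs "HOL-Complex_Analysis.Complex_Analysis" "HOL-Real_Asymp.Real_Asymp"
begin

text \<open>
  At \<open>h = 1 / n\<close> the quadrature of \<open>t\<^sup>\<beta>\<^sup>-\<^sup>1\<close> is, up to a power of \<open>n\<close>, the convolution of the weights with the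
  sequence \<open>(k + frac \<theta>)\<^sup>\<beta>\<^sup>-\<^sup>1\<close>. That sequence expands asymptotically into the coefficients of
  \<open>(1 - z)\<^sup>r\<^sup>-\<^sup>\<beta>\<close>, \<open>r = 0, 1, \<dots>\<close> (Watson's lemma), and the convolution with each of those is a coefficient
  of \<open>\<omega>(z) (1 - z)\<^sup>r\<^sup>-\<^sup>\<beta>\<close>, to which Darboux's method applies. The singularities other than \<open>1\<close> contribute
  only \<open>O(h\<^sup>\<beta>)\<close> because \<open>Re \<alpha>\<^sub>j \<le> Re \<alpha>\<close>. At the singularity \<open>1\<close> the symbol of the error is that of
  \<open>I\<^sup>\<alpha> t\<^sup>\<beta>\<^sup>-\<^sup>1\<close> times \<open>h\<^sup>\<alpha> exp (\<theta> h) \<omega>(exp (-h)) - 1\<close>, so the order of the error is the order of consistency;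
  conversely a large real \<open>\<beta>\<close>, for which no \<open>1 / \<Gamma>(\<alpha> + \<beta> - r)\<close> vanishes, recovers the expansion of
  the symbol. Stability always holds, again by Darboux's method.
\<close>

section \<open>Sequences of polynomial growth\<close>

text \<open>Two scales compete. Every expansion is therefore needed only modulo n^(Re \<alpha> - 1),
  with enough terms to get there. What remains is algebra of power series in y = 1 - z, where a
  series with coefficients c_i stands for the sum of c_i times the coefficients of (1 - z)^(i - s).
  Up to the factor \<Gamma>(\<beta>), the exact value is a series K with constant term 1 and the
  quadrature is K S with S the expansion of the symbol. The error is K (S - 1), and its first p
  coefficients vanish exactly when those of S - 1 do. The obstacle is that the Laplace integral
  behind Watson's lemma converges only for Re s < 1. Larger s are reached by multiplying the
  sequence by m + \<delta>, which needs a recurrence for the Taylor coefficients of K and hence a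
  differential equation for the kernel.\<close>

text \<open>The comparison is with \<open>(n + 1)\<^sup>\<sigma>\<close> rather than \<open>n\<^sup>\<sigma>\<close>, so that it is meaningful at \<open>n = 0\<close>.\<close>
definition poly_growth :: "real \<Rightarrow> (nat \<Rightarrow> complex) \<Rightarrow> bool" where
  "poly_growth \<sigma> x \<longleftrightarrow> (\<exists>C. \<forall>n. norm (x n) \<le> C * real (Suc n) powr \<sigma>)"

lemma poly_growthE:
  assumes "poly_growth \<sigma> x"
  obtains C where "C \<ge> 0" "\<And>n. norm (x n) \<le> C * real (Suc n) powr \<sigma>"
proof -
  from assms obtain C where C: "\<And>n. norm (x n) \<le> C * real (Suc n) powr \<sigma>"
    by (auto simp: poly_growth_def)
  moreover have "0 \<le> C" using C[of 0] norm_ge_zero[of "x 0"] by (simp del: norm_ge_zero)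
  ultimately show ?thesis using that by blast
qed

lemma poly_growth_eventuallyI:
  assumes "\<forall>\<^sub>F n in sequentially. norm (x n) \<le> C * real (Suc n) powr \<sigma>"
  shows "poly_growth \<sigma> x"
proof -
  from assms obtain N where N: "\<And>n. n \<ge> N \<Longrightarrow> norm (x n) \<le> C * real (Suc n) powr \<sigma>"
    by (auto simp: eventually_sequentially)
  define D where "D = \<bar>C\<bar> + (\<Sum>n<N. norm (x n) / real (Suc n) powr \<sigma>)"
  have "norm (x n) \<le> D * real (Suc n) powr \<sigma>" for n
  proof (cases "n < N")
    case True
    have "norm (x n) = norm (x n) / real (Suc n) powr \<sigma> * real (Suc n) powr \<sigma>" by simp
    also have "norm (x n) / real (Suc n) powr \<sigma> \<le> (\<Sum>n<N. norm (x n) / real (Suc n) powr \<sigma>)"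
      using True by (intro member_le_sum) auto
    also have "\<dots> \<le> D" by (simp add: D_def)
    finally show ?thesis by (simp add: mult_right_mono)
  next
    case False
    then have "norm (x n) \<le> C * real (Suc n) powr \<sigma>" using N by simp
    also have "C \<le> D" unfolding D_def by (smt (verit) sum_nonneg divide_nonneg_nonneg norm_ge_zero powr_ge_zero)
    finally show ?thesis by (simp add: mult_right_mono)
  qed
  then show ?thesis by (auto simp: poly_growth_def)
qed

lemma poly_growth_cong_eventually:
  assumes "poly_growth \<sigma> x" "\<forall>\<^sub>F n in sequentially. x n = y n"
  shows "poly_growth \<sigma> y"
proof -
  obtain C where "\<And>n. norm (x n) \<le> C * real (Suc n) powr \<sigma>"
    using assms(1) by (auto simp: poly_growth_def)
  with assms(2) show ?thesis
    by (intro poly_growth_eventuallyI[of _ C]) (auto elim!: eventually_mono, metis)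
qed

lemma poly_growth_mono:
  assumes "poly_growth \<sigma> x" "\<sigma> \<le> \<tau>"
  shows "poly_growth \<tau> x"
proof -
  obtain C where C: "C \<ge> 0" "\<And>n. norm (x n) \<le> C * real (Suc n) powr \<sigma>"
    using poly_growthE[OF assms(1)] by blast
  have "norm (x n) \<le> C * real (Suc n) powr \<tau>" for n
    using C(2)[of n] mult_left_mono[OF powr_mono[OF assms(2), of "real (Suc n)"] C(1)] by simp
  then show ?thesis by (auto simp: poly_growth_def)
qed

lemma poly_growth_zero [simp]: "poly_growth \<sigma> (\<lambda>_. 0)"
  by (auto simp: poly_growth_def intro: exI[of _ 0])

lemma poly_growth_add:
  assumes "poly_growth \<sigma> x" "poly_growth \<sigma> y"
  shows "poly_growth \<sigma> (\<lambda>n. x n + y n)"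
proof -
  from assms obtain C D where "\<And>n. norm (x n) \<le> C * real (Suc n) powr \<sigma>"
    "\<And>n. norm (y n) \<le> D * real (Suc n) powr \<sigma>" by (auto simp: poly_growth_def)
  then have "norm (x n + y n) \<le> (C + D) * real (Suc n) powr \<sigma>" for n
    using norm_triangle_mono by (fastforce simp: ring_distribs)
  then show ?thesis by (auto simp: poly_growth_def)
qed

lemma poly_growth_cmult:
  assumes "poly_growth \<sigma> x"
  shows "poly_growth \<sigma> (\<lambda>n. c * x n)"
proof -
  from assms obtain C where C: "\<And>n. norm (x n) \<le> C * real (Suc n) powr \<sigma>"
    by (auto simp: poly_growth_def)
  have "norm (c * x n) \<le> (norm c * C) * real (Suc n) powr \<sigma>" for n
    using mult_left_mono[OF C[of n] norm_ge_zero[of c]] by (simp add: norm_mult mult_ac)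
  then show ?thesis by (auto simp: poly_growth_def)
qed

lemma poly_growth_diff:
  "poly_growth \<sigma> x \<Longrightarrow> poly_growth \<sigma> y \<Longrightarrow> poly_growth \<sigma> (\<lambda>n. x n - y n)"
  using poly_growth_add[of \<sigma> x "\<lambda>n. (-1) * y n"] poly_growth_cmult[of \<sigma> y "-1"] by simp

lemma poly_growth_sum:
  "(\<And>i. i \<in> A \<Longrightarrow> poly_growth \<sigma> (x i)) \<Longrightarrow> poly_growth \<sigma> (\<lambda>n. \<Sum>i\<in>A. x i n)"
  by (induction A rule: infinite_finite_induct) (auto intro: poly_growth_add)

lemma poly_growth_mult_linear:
  assumes "poly_growth \<sigma> x"
  shows "poly_growth (\<sigma> + 1) (\<lambda>n. (of_nat n + c) * x n)"
proof -
  obtain C where C: "C \<ge> 0" "\<And>n. norm (x n) \<le> C * real (Suc n) powr \<sigma>"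
    using poly_growthE[OF assms] by blast
  have "norm ((of_nat n + c) * x n) \<le> ((1 + norm c) * C) * real (Suc n) powr (\<sigma> + 1)" for n
  proof -
    have "norm (of_nat n + c) \<le> real n + norm c" by (metis norm_triangle_ineq norm_of_nat)
    also have "\<dots> \<le> (1 + norm c) * real (Suc n)" by (simp add: algebra_simps)
    finally have "norm ((of_nat n + c) * x n) \<le> ((1 + norm c) * real (Suc n)) * (C * real (Suc n) powr \<sigma>)"
      unfolding norm_mult by (intro mult_mono C) (use C(1) in auto)
    then show ?thesis by (simp add: powr_add mult_ac del: of_nat_Suc)
  qed
  then show ?thesis by (auto simp: poly_growth_def)
qed

lemma poly_growth_mult_norm_le:
  assumes "poly_growth \<sigma> x" "\<And>n. norm (u n) \<le> 1"
  shows "poly_growth \<sigma> (\<lambda>n. u n * x n)"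
proof -
  from assms obtain C where C: "\<And>n. norm (x n) \<le> C * real (Suc n) powr \<sigma>"
    by (auto simp: poly_growth_def)
  have "norm (u n * x n) \<le> C * real (Suc n) powr \<sigma>" for n
    using mult_mono[OF assms(2)[of n] C[of n]] by (simp add: norm_mult)
  then show ?thesis by (auto simp: poly_growth_def)
qed

text \<open>By Peetre's inequality (i+1)^\<sigma> \<le> (n+1)^\<sigma> (n-i+1)^|\<sigma>|, a factor
  \<open>y\<close> that decays like k^(-|\<sigma>|-2) pays for the shift and leaves the summable
  k^(-2). This carries the remainder of an expansion through the convolution with the
  weights.\<close>

lemma poly_growth_convolution:
  assumes x: "poly_growth \<sigma> x" and y: "poly_growth \<tau> y" and \<tau>: "\<tau> \<le> - \<bar>\<sigma>\<bar> - 2"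
  shows "poly_growth \<sigma> (\<lambda>n. \<Sum>i\<le>n. x i * y (n - i))"
proof -
  obtain C where C: "C \<ge> 0" "\<And>n. norm (x n) \<le> C * real (Suc n) powr \<sigma>"
    using poly_growthE[OF x] by blast
  obtain D where D: "D \<ge> 0" "\<And>n. norm (y n) \<le> D * real (Suc n) powr \<tau>"
    using poly_growthE[OF y] by blast
  define Z where "Z = (\<Sum>k. real (Suc k) powr (-2))"
  have sm: "summable (\<lambda>k. real (Suc k) powr (-2))"
    by (subst summable_Suc_iff, subst summable_real_powr_iff) auto
  have peetre: "real (Suc i) powr \<sigma> \<le> real (Suc n) powr \<sigma> * real (Suc (n - i)) powr \<bar>\<sigma>\<bar>"
    if "i \<le> n" for i n
  proof (cases "\<sigma> \<ge> 0")
    case True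
    have "real (Suc i) powr \<sigma> \<le> real (Suc n) powr \<sigma> * 1"
      using True that by (simp add: powr_mono2)
    also have "\<dots> \<le> real (Suc n) powr \<sigma> * real (Suc (n - i)) powr \<bar>\<sigma>\<bar>"
      by (intro mult_left_mono ge_one_powr_ge_zero) auto
    finally show ?thesis .
  next
    case False
    \<comment> \<open>The right-hand side is n + 1 + i (n - i).\<close>
    have "real (Suc n) \<le> real (Suc i) * real (Suc (n - i))"
      using that by (simp add: of_nat_diff algebra_simps mult_left_mono)
    then have "(real (Suc i) * real (Suc (n - i))) powr \<sigma> \<le> real (Suc n) powr \<sigma>"
      using False by (intro powr_mono2') auto
    then have "real (Suc i) powr \<sigma> * real (Suc (n - i)) powr \<sigma> * real (Suc (n - i)) powr \<bar>\<sigma>\<bar> \<le>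
               real (Suc n) powr \<sigma> * real (Suc (n - i)) powr \<bar>\<sigma>\<bar>"
      by (intro mult_right_mono) (auto simp: powr_mult)
    moreover have "real (Suc (n - i)) powr \<sigma> * real (Suc (n - i)) powr \<bar>\<sigma>\<bar> = 1"
      using False by (simp add: powr_add [symmetric])
    ultimately show ?thesis by (simp add: mult.assoc del: of_nat_Suc)
  qed
  have "norm (\<Sum>i\<le>n. x i * y (n - i)) \<le> (C * D * Z) * real (Suc n) powr \<sigma>" for n
  proof -
    have "norm (\<Sum>i\<le>n. x i * y (n - i)) \<le> (\<Sum>i\<le>n. norm (x i * y (n - i)))"
      by (rule norm_sum)
    also have "\<dots> \<le> (\<Sum>i\<le>n. (C * D * real (Suc n) powr \<sigma>) * real (Suc (n - i)) powr (-2))"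
    proof (rule sum_mono)
      fix i assume i: "i \<in> {..n}"
      have "norm (x i * y (n - i)) \<le> (C * real (Suc i) powr \<sigma>) * (D * real (Suc (n - i)) powr \<tau>)"
        unfolding norm_mult by (intro mult_mono C D) (use C(1) in auto)
      also have "\<dots> \<le> (C * (real (Suc n) powr \<sigma> * real (Suc (n - i)) powr \<bar>\<sigma>\<bar>)) *
                       (D * real (Suc (n - i)) powr (- \<bar>\<sigma>\<bar> - 2))"
        using i C(1) D(1) \<tau> by (intro mult_mono mult_left_mono peetre powr_mono) auto
      also have "\<dots> = (C * D * real (Suc n) powr \<sigma>) *
                       (real (Suc (n - i)) powr \<bar>\<sigma>\<bar> * real (Suc (n - i)) powr (- \<bar>\<sigma>\<bar> - 2))"
        by simp
      also have "real (Suc (n - i)) powr \<bar>\<sigma>\<bar> * real (Suc (n - i)) powr (- \<bar>\<sigma>\<bar> - 2) = real (Suc (n - i)) powr (-2)"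
        by (simp only: powr_add [symmetric]) simp
      finally show "norm (x i * y (n - i)) \<le> (C * D * real (Suc n) powr \<sigma>) * real (Suc (n - i)) powr (-2)" .
    qed
    also have "\<dots> = (C * D * real (Suc n) powr \<sigma>) * (\<Sum>i\<le>n. real (Suc (n - i)) powr (-2))"
      by (simp add: sum_distrib_left)
    also have "(\<Sum>i\<le>n. real (Suc (n - i)) powr (-2)) = (\<Sum>i\<le>n. real (Suc i) powr (-2))"
      by (rule sum.reindex_bij_witness[of _ "\<lambda>i. n - i" "\<lambda>i. n - i"]) auto
    also have "(C * D * real (Suc n) powr \<sigma>) * \<dots> \<le> (C * D * real (Suc n) powr \<sigma>) * Z"
      unfolding Z_def using C(1) D(1) sm by (intro mult_left_mono sum_le_suminf) auto
    finally show ?thesis by (simp add: mult_ac)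
  qed
  then show ?thesis by (auto simp: poly_growth_def)
qed

text \<open>A fixed shift of the index changes n^\<sigma> by a factor tending to 1, and the cut-off
  of \<open>nat\<close> at 0 concerns finitely many n. The error is given along n, its expansion
  along m = n + \<lfloor>\<theta>\<rfloor>.\<close>

lemma poly_growth_shift_iff:
  fixes k :: int
  shows "poly_growth \<sigma> x \<longleftrightarrow> (\<exists>C. \<forall>\<^sub>F n in sequentially. norm (x (nat (int n + k))) \<le> C * real n powr \<sigma>)"
proof
  assume "poly_growth \<sigma> x"
  then obtain C where C: "C \<ge> 0" "\<And>n. norm (x n) \<le> C * real (Suc n) powr \<sigma>"
    using poly_growthE by blast
  have "((\<lambda>n. (real n + real_of_int k + 1) powr \<sigma> / real n powr \<sigma>) \<longlongrightarrow> 1) sequentially" by real_asymp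
  then have "\<forall>\<^sub>F n in sequentially. (real n + real_of_int k + 1) powr \<sigma> / real n powr \<sigma> < 2"
    by (rule order_tendstoD) simp
  moreover have "\<forall>\<^sub>F n in sequentially. real n + real_of_int k > 0 \<and> real n > 0"
    by (intro eventually_conj; real_asymp)
  ultimately have "\<forall>\<^sub>F n in sequentially. norm (x (nat (int n + k))) \<le> (2 * C) * real n powr \<sigma>"
  proof eventually_elim
    case (elim n)
    then have "int n + k > 0" by linarith
    then have "real (Suc (nat (int n + k))) = real n + real_of_int k + 1" by simp
    then have "norm (x (nat (int n + k))) \<le> C * (real n + real_of_int k + 1) powr \<sigma>"
      using C(2)[of "nat (int n + k)"] by (simp add: add_ac)
    also have "\<dots> \<le> C * (2 * real n powr \<sigma>)"
      using elim C(1) by (intro mult_left_mono) (simp_all add: divide_less_eq)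
    finally show ?case by simp
  qed
  then show "\<exists>C. \<forall>\<^sub>F n in sequentially. norm (x (nat (int n + k))) \<le> C * real n powr \<sigma>" by blast
next
  assume "\<exists>C. \<forall>\<^sub>F n in sequentially. norm (x (nat (int n + k))) \<le> C * real n powr \<sigma>"
  then obtain C N where N: "\<And>n. n \<ge> N \<Longrightarrow> norm (x (nat (int n + k))) \<le> C * real n powr \<sigma>"
    by (auto simp: eventually_sequentially)
  have "((\<lambda>m. (real m - real_of_int k) powr \<sigma> / real (Suc m) powr \<sigma>) \<longlongrightarrow> 1) sequentially" by real_asymp
  then have "\<forall>\<^sub>F m in sequentially. (real m - real_of_int k) powr \<sigma> / real (Suc m) powr \<sigma> < 2"
    by (rule order_tendstoD) simp
  moreover have "\<forall>\<^sub>F m in sequentially. real m - real_of_int k \<ge> real N" by real_asymp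
  ultimately have "\<forall>\<^sub>F m in sequentially. norm (x m) \<le> (2 * \<bar>C\<bar>) * real (Suc m) powr \<sigma>"
  proof eventually_elim
    case (elim m)
    define n where "n = nat (int m - k)"
    have mk: "int m - k \<ge> int N" using elim(2) by linarith
    then have n: "int n = int m - k" "n \<ge> N" by (auto simp: n_def)
    then have rn: "real n = real m - real_of_int k" by (metis of_int_of_nat_eq of_int_diff)
    have "norm (x m) \<le> C * real n powr \<sigma>" using N[OF n(2)] n(1) by simp
    also have "\<dots> \<le> \<bar>C\<bar> * (real m - real_of_int k) powr \<sigma>" unfolding rn by (intro mult_right_mono) auto
    also have "\<dots> \<le> \<bar>C\<bar> * (2 * real (Suc m) powr \<sigma>)"
      using elim(1) by (intro mult_left_mono) (simp_all add: divide_less_eq del: of_nat_Suc)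
    finally show ?case by simp
  qed
  then show "poly_growth \<sigma> x" by (rule poly_growth_eventuallyI)
qed

section \<open>Binomial coefficients and Taylor remainders\<close>

text \<open>The coefficient of z^n in (1 - z)^(-s), written with a rising factorial so that it is a
  polynomial in s.\<close>

definition bin_coeff :: "complex \<Rightarrow> nat \<Rightarrow> complex" where
  "bin_coeff s n = pochhammer s n / fact n"

text \<open>Coefficientwise form of (z d/dz + s) (1 - z)^(-s) = s (1 - z)^(-s-1). It drives the
  passage from s to s + 1 in the expansion of shifted powers.\<close>

lemma bin_coeff_plus1: "s * bin_coeff (s + 1) n = (of_nat n + s) * bin_coeff s n"
  using pochhammer_rec[of s n] pochhammer_rec'[of s n] by (simp add: bin_coeff_def add_ac)

lemma bin_coeff_1 [simp]: "bin_coeff 1 n = 1"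
  by (simp add: bin_coeff_def pochhammer_fact [symmetric])

lemma bin_coeff_nonpos_eq_0: "n > k \<Longrightarrow> bin_coeff (- of_nat k) n = 0"
  by (simp add: bin_coeff_def pochhammer_of_nat_eq_0_lemma)

lemma bin_coeff_sums:
  assumes "norm z < 1"
  shows "(\<lambda>n. bin_coeff s n * z ^ n) sums ((1 - z) powr (- s))"
proof -
  have "(\<lambda>n. ((- s) gchoose n) * (- z) ^ n) sums (1 + (- z)) powr (- s)"
    using assms by (intro gen_binomial_complex) simp
  moreover have "((- s) gchoose n) * (- z) ^ n = bin_coeff s n * z ^ n" for n
  proof -
    have "(- 1) ^ n * (- 1) ^ n = (1 :: complex)" by (simp flip: power_mult_distrib)
    then show ?thesis
      by (simp add: bin_coeff_def gbinomial_pochhammer power_minus[of z n] mult_ac)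
  qed
  ultimately show ?thesis by simp
qed

text \<open>The Gauss product for 1/\<Gamma>(s) converges, so this gives the behaviour
  n^(s-1)/\<Gamma>(s) of the coefficients, used both for their upper bound and for its
  converse.\<close>

lemma bin_coeff_Suc_rGamma_series:
  assumes "n > 0"
  shows "bin_coeff s (Suc n) = rGamma_series s n * of_nat n powr s / of_nat (Suc n)"
proof -
  have "exp (s * of_real (ln (real n))) = of_nat n powr s"
    using assms by (simp add: powr_def Ln_of_nat)
  with assms show ?thesis
    by (simp add: bin_coeff_def rGamma_series_def field_simps)
qed

lemma poly_growth_bin_coeff: "poly_growth (Re s - 1) (bin_coeff s)"
proof -
  have "Bseq (rGamma_series s)"
    by (intro convergent_imp_Bseq convergentI[OF rGamma_series_LIMSEQ])
  then obtain K where K: "K > 0" "\<And>n. norm (rGamma_series s n) \<le> K" by (auto elim!: BseqE)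
  have "((\<lambda>n. real n powr Re s / real (Suc n) / real (Suc (Suc n)) powr (Re s - 1)) \<longlongrightarrow> 1) sequentially"
    by real_asymp
  then have "\<forall>\<^sub>F n in sequentially. real n powr Re s / real (Suc n) / real (Suc (Suc n)) powr (Re s - 1) < 2"
    by (rule order_tendstoD) simp
  then have "\<forall>\<^sub>F n in sequentially. norm (bin_coeff s (Suc n)) \<le> 2 * K * real (Suc (Suc n)) powr (Re s - 1)"
    using eventually_gt_at_top[of 0]
  proof eventually_elim
    case (elim n)
    have "norm (bin_coeff s (Suc n)) = norm (rGamma_series s n) * (real n powr Re s / real (Suc n))"
      using elim(2) by (simp add: bin_coeff_Suc_rGamma_series norm_mult norm_divide norm_powr_real_powr del: of_nat_Suc)
    also have "\<dots> \<le> K * (2 * real (Suc (Suc n)) powr (Re s - 1))"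
      using elim K by (intro mult_mono) (simp_all add: divide_less_eq divide_le_eq mult_ac del: of_nat_Suc)
    finally show ?case by (simp add: mult_ac)
  qed
  then have "\<forall>\<^sub>F n in sequentially. norm (bin_coeff s n) \<le> 2 * K * real (Suc n) powr (Re s - 1)"
    by (subst (asm) eventually_sequentially_Suc)
  then show ?thesis by (rule poly_growth_eventuallyI)
qed

text \<open>The Gauss product would tend to 0, but its limit is 1/\<Gamma>(s). This is how a
  coefficient is read off a growth bound; for s = 0, -1, ... the sequence is eventually 0 and
  nothing can be read off.\<close>

lemma poly_growth_bin_coeff_imp_rGamma_eq_0:
  assumes "poly_growth \<sigma> (bin_coeff s)" "\<sigma> < Re s - 1"
  shows "rGamma s = 0"
proof -
  obtain C where C: "\<And>n. norm (bin_coeff s n) \<le> C * real (Suc n) powr \<sigma>"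
    using assms by (auto simp: poly_growth_def)
  have "rGamma_series s \<longlonglongrightarrow> 0"
  proof (rule Lim_null_comparison)
    have "norm (rGamma_series s n) \<le> C * real (Suc (Suc n)) powr \<sigma> * real (Suc n) / real n powr Re s" if "n > 0" for n
    proof -
      have "norm (rGamma_series s n) = norm (bin_coeff s (Suc n)) * real (Suc n) / real n powr Re s"
        using that by (simp add: bin_coeff_Suc_rGamma_series norm_mult norm_divide norm_powr_real_powr del: of_nat_Suc)
      also have "\<dots> \<le> C * real (Suc (Suc n)) powr \<sigma> * real (Suc n) / real n powr Re s"
        by (intro divide_right_mono mult_right_mono C) auto
      finally show ?thesis .
    qed
    then show "\<forall>\<^sub>F n in sequentially. norm (rGamma_series s n) \<le> C * real (Suc (Suc n)) powr \<sigma> * real (Suc n) / real n powr Re s"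
      using eventually_gt_at_top[of 0] by (rule eventually_mono[rotated])
    show "(\<lambda>n. C * real (Suc (Suc n)) powr \<sigma> * real (Suc n) / real n powr Re s) \<longlonglongrightarrow> 0"
      using assms(2) by real_asymp
  qed
  with rGamma_series_LIMSEQ[of s] show ?thesis by (rule LIMSEQ_unique)
qed

section \<open>Taylor remainders and orders of vanishing\<close>

text \<open>The remainder is kept as an analytic factor \<open>Q\<close> and not as a bound, because
  at a singularity of the generating function its derivatives have to be controlled too.\<close>

lemma has_fps_expansion_Taylor_remainder:
  fixes F :: "complex \<Rightarrow> complex"
  assumes "F has_fps_expansion X"
  obtains Q where "Q analytic_on {0}" "\<forall>\<^sub>F z in nhds 0. F z = (\<Sum>r<R. fps_nth X r * z ^ r) + z ^ R * Q z"
proof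
  define Q where "Q = eval_fps (fps_shift R X)"
  have Q: "Q has_fps_expansion fps_shift R X"
    unfolding Q_def using assms by (intro eval_fps_has_fps_expansion) (simp add: has_fps_expansion_def)
  then show "Q analytic_on {0}" by (rule has_fps_expansion_imp_analytic_0)
  have "X = (\<Sum>r<R. fps_const (fps_nth X r) * fps_X ^ r) + fps_X ^ R * fps_shift R X"
    by (rule fps_ext, simp add: fps_sum_nth fps_X_power_mult_nth)
       (simp add: fps_X_power_iff if_distrib sum.delta' cong: if_cong)
  moreover have "(\<lambda>z. (\<Sum>r<R. fps_nth X r * z ^ r) + z ^ R * Q z) has_fps_expansion
      (\<Sum>r<R. fps_const (fps_nth X r) * fps_X ^ r) + fps_X ^ R * fps_shift R X"
    by (intro fps_expansion_intros Q)
  ultimately have "(\<lambda>z. (\<Sum>r<R. fps_nth X r * z ^ r) + z ^ R * Q z) has_fps_expansion X" by simp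
  then have "\<forall>\<^sub>F z in nhds 0. eval_fps X z = (\<Sum>r<R. fps_nth X r * z ^ r) + z ^ R * Q z"
    by (simp add: has_fps_expansion_def)
  moreover have "\<forall>\<^sub>F z in nhds 0. eval_fps X z = F z" using assms by (simp add: has_fps_expansion_def)
  ultimately show "\<forall>\<^sub>F z in nhds 0. F z = (\<Sum>r<R. fps_nth X r * z ^ r) + z ^ R * Q z"
    by eventually_elim simp
qed

lemma analytic_at_imp_bounded_near:
  assumes "f analytic_on {x}"
  shows "\<forall>\<^sub>F z in nhds x. norm (f z :: complex) \<le> norm (f x) + 1"
proof -
  have "(f \<longlongrightarrow> f x) (nhds x)"
    using analytic_at_imp_isCont[OF assms] by (simp add: isCont_def tendsto_at_iff_tendsto_nhds)
  then have "((\<lambda>z. norm (f z)) \<longlongrightarrow> norm (f x)) (nhds x)" by (rule tendsto_norm)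
  then have "\<forall>\<^sub>F z in nhds x. norm (f z) < norm (f x) + 1" by (rule order_tendstoD) simp
  then show ?thesis by (auto elim: eventually_mono)
qed

lemma has_fps_expansion_Taylor_bound:
  fixes F :: "complex \<Rightarrow> complex"
  assumes "F has_fps_expansion X"
  shows "\<exists>C. \<forall>\<^sub>F z in nhds 0. norm (F z - (\<Sum>r<R. fps_nth X r * z ^ r)) \<le> C * norm z ^ R"
proof -
  obtain Q where Q: "Q analytic_on {0}" and F: "\<forall>\<^sub>F z in nhds 0. F z = (\<Sum>r<R. fps_nth X r * z ^ r) + z ^ R * Q z"
    using has_fps_expansion_Taylor_remainder[OF assms] by blast
  have "\<forall>\<^sub>F z in nhds 0. norm (F z - (\<Sum>r<R. fps_nth X r * z ^ r)) \<le> (norm (Q 0) + 1) * norm z ^ R"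
    using F analytic_at_imp_bounded_near[OF Q]
  proof eventually_elim
    case (elim z)
    then have "norm z ^ R * norm (Q z) \<le> norm z ^ R * (norm (Q 0) + 1)" by (intro mult_left_mono) auto
    with elim(1) show ?case by (simp add: norm_mult norm_power mult.commute)
  qed
  then show ?thesis by blast
qed

text \<open>For small h, y = 1 - exp (-h) lies between h/2 and h, so orders in y and in h agree. For
  the converse the coefficients are removed one at a time: once the lower ones vanish, division by
  y^r leaves the r-th coefficient bounded by O(h).\<close>

lemma has_fps_expansion_bigo_iff:
  assumes F: "F has_fps_expansion X"
  shows "(\<lambda>h. F (of_real (1 - exp (- h)))) \<in> O[at_right 0](\<lambda>h. complex_of_real (h ^ p)) \<longleftrightarrow> (\<forall>r<p. fps_nth X r = 0)"
proof -
  have lim: "filterlim (\<lambda>h. complex_of_real (1 - exp (- h))) (nhds 0) (at_right 0)"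
  proof -
    have "((\<lambda>h::real. 1 - exp (- h)) \<longlongrightarrow> 0) (at_right 0)" by real_asymp
    from tendsto_of_real[OF this] show ?thesis by simp
  qed
  have bounds: "\<forall>\<^sub>F h in at_right (0::real). 0 < 1 - exp (- h) \<and> 1 - exp (- h) \<le> h \<and> h \<le> 2 * (1 - exp (- h)) \<and> h < 1"
  proof -
    have "\<forall>\<^sub>F h in at_right (0::real). h \<le> 2 * (1 - exp (- h))" by real_asymp
    moreover have "\<forall>\<^sub>F h in at_right (0::real). h \<in> {0<..<1}" by (rule eventually_at_right_real) simp
    ultimately show ?thesis
    proof eventually_elim
      case (elim h)
      then show ?case using exp_ge_add_one_self[of "- h"] by simp
    qed
  qed
  have taylor: "\<exists>C\<ge>0. \<forall>\<^sub>F h in at_right 0. norm (F (of_real (1 - exp (- h))) - (\<Sum>r<R. fps_nth X r * of_real (1 - exp (- h)) ^ r)) \<le> C * h ^ R" for R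
  proof -
    obtain C where C: "\<forall>\<^sub>F z in nhds 0. norm (F z - (\<Sum>r<R. fps_nth X r * z ^ r)) \<le> C * norm z ^ R"
      using has_fps_expansion_Taylor_bound[OF F] by blast
    have "\<forall>\<^sub>F h in at_right 0. norm (F (of_real (1 - exp (- h))) - (\<Sum>r<R. fps_nth X r * of_real (1 - exp (- h)) ^ r)) \<le> \<bar>C\<bar> * h ^ R"
      using eventually_compose_filterlim[OF C lim] bounds
    proof eventually_elim
      case (elim h)
      have "norm (complex_of_real (1 - exp (- h))) = 1 - exp (- h)" using elim(2) by (simp only: norm_of_real) simp
      then have "C * norm (complex_of_real (1 - exp (- h))) ^ R \<le> \<bar>C\<bar> * h ^ R"
        using elim(2) by (intro mult_mono power_mono) auto
      with elim(1) show ?case by linarith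
    qed
    then show ?thesis by (intro exI[of _ "\<bar>C\<bar>"]) auto
  qed
  show ?thesis
  proof
    assume "\<forall>r<p. fps_nth X r = 0"
    then have "(\<Sum>r<p. fps_nth X r * y ^ r) = 0" for y by (intro sum.neutral) auto
    then obtain C where C: "\<forall>\<^sub>F h in at_right 0. norm (F (of_real (1 - exp (- h)))) \<le> C * h ^ p"
      using taylor[of p] by (simp only: diff_0_right) blast
    have "\<forall>\<^sub>F h in at_right 0. norm (F (of_real (1 - exp (- h)))) \<le> C * norm (complex_of_real (h ^ p))"
      using C bounds by eventually_elim (simp add: norm_power)
    then show "(\<lambda>h. F (of_real (1 - exp (- h)))) \<in> O[at_right 0](\<lambda>h. complex_of_real (h ^ p))"
      by (rule bigoI)
  next
    assume "(\<lambda>h. F (of_real (1 - exp (- h)))) \<in> O[at_right 0](\<lambda>h. complex_of_real (h ^ p))"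
    then obtain C where C: "C > 0" "\<forall>\<^sub>F h in at_right 0. norm (F (of_real (1 - exp (- h)))) \<le> C * norm (complex_of_real (h ^ p))"
      by (elim landau_o.bigE)
    show "\<forall>r<p. fps_nth X r = 0"
    proof (intro allI impI)
      fix r assume "r < p"
      then show "fps_nth X r = 0"
      proof (induction r rule: less_induct)
        case (less r)
        have 0: "(\<Sum>i<Suc r. fps_nth X i * y ^ i) = fps_nth X r * y ^ r" for y
          using less by (simp add: sum.neutral)
        obtain D where D: "D \<ge> 0" "\<forall>\<^sub>F h in at_right 0. norm (F (of_real (1 - exp (- h))) - fps_nth X r * of_real (1 - exp (- h)) ^ r) \<le> D * h ^ Suc r"
          using taylor[of "Suc r"] unfolding 0 by blast
        have ev: "\<forall>\<^sub>F h in at_right 0. norm (fps_nth X r) \<le> 2 ^ r * (C + D) * h"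
          using C(2) D(2) bounds
        proof eventually_elim
          case (elim h)
          define y where "y = 1 - exp (- h)"
          have y: "0 < y" "h \<le> 2 * y" "h > 0" "h < 1" using elim(3) by (auto simp: y_def)
          have "norm (fps_nth X r) * y ^ r = norm (fps_nth X r * of_real y ^ r)"
            using y by (simp add: norm_mult norm_power)
          also have "\<dots> \<le> norm (F (of_real y)) + norm (F (of_real y) - fps_nth X r * of_real y ^ r)"
            by (metis norm_triangle_sub norm_minus_commute)
          also have "norm (F (of_real y)) \<le> C * h ^ p" using elim(1) y by (simp add: y_def norm_power)
          also have "C * h ^ p \<le> C * h ^ Suc r"
            using C(1) y less.prems by (intro mult_left_mono power_decreasing) auto
          also have "norm (F (of_real y) - fps_nth X r * of_real y ^ r) \<le> D * h ^ Suc r"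
            using elim(2) by (simp add: y_def)
          finally have "norm (fps_nth X r) * y ^ r \<le> (C + D) * h * h ^ r" by (simp add: algebra_simps)
          \<comment> \<open>h^r is traded for y^r through h \<le> 2 y, whence the factor
            2^r.\<close>
          also have "\<dots> \<le> (C + D) * h * (2 * y) ^ r"
            using y C(1) D(1) by (intro mult_left_mono power_mono) auto
          also have "\<dots> = (2 ^ r * (C + D) * h) * y ^ r" by (simp add: power_mult_distrib)
          finally show ?case using y(1) by (metis mult_le_cancel_right_pos zero_less_power)
        qed
        have "((\<lambda>h. 2 ^ r * (C + D) * h) \<longlongrightarrow> 2 ^ r * (C + D) * 0) (at_right (0::real))"
          by (intro tendsto_intros)
        then have "norm (fps_nth X r) \<le> 2 ^ r * (C + D) * 0"
          using ev by (intro tendsto_le[OF _ _ tendsto_const]) auto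
        then show "fps_nth X r = 0" by simp
      qed
    qed
  qed
qed

section \<open>The expansion of shifted powers\<close>

text \<open>For y = 1 - exp (-t) this is t / y; the value 1 removes the singularity at y =
  0.\<close>

definition log_quot :: "complex \<Rightarrow> complex" where
  "log_quot y = (if y = 0 then 1 else - Ln (1 - y) / y)"

lemma one_minus_notin_nonpos_Reals: "norm (y :: complex) < 1 \<Longrightarrow> 1 - y \<notin> \<real>\<^sub>\<le>\<^sub>0"
  using complex_Re_le_cmod[of y] by (auto simp: complex_nonpos_Reals_iff)

lemma log_quot_mult: "log_quot y * y = - Ln (1 - y)"
  by (simp add: log_quot_def)

lemma log_quot_holomorphic: "log_quot holomorphic_on ball 0 1"
proof -
  define f where "f = (\<lambda>y :: complex. - Ln (1 - y))"
  have f: "f holomorphic_on ball 0 1"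
    unfolding f_def using one_minus_notin_nonpos_Reals by (auto intro!: holomorphic_intros)
  have "(f has_field_derivative 1) (at 0)"
    unfolding f_def by (auto intro!: derivative_eq_intros)
  then have "deriv f 0 = 1" by (rule DERIV_imp_deriv)
  then have "(\<lambda>z. if z = 0 then deriv f 0 else (f z - f 0) / (z - 0)) = log_quot"
    by (auto simp: fun_eq_iff log_quot_def f_def)
  then show ?thesis using pole_lemma_open[OF f, of 0] by simp
qed

text \<open>Differentiation of \<open>log_quot y * y = - Ln (1 - y)\<close>. It serves to eliminate
  the derivative of \<open>log_quot\<close> from the differential equation of the kernel.\<close>

lemma log_quot_deriv:
  assumes "norm y < 1"
  shows "(1 - y) * (y * deriv log_quot y) = 1 - (1 - y) * log_quot y"
proof -
  have y: "1 - y \<notin> \<real>\<^sub>\<le>\<^sub>0" and y1: "1 - y \<noteq> 0"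
    using one_minus_notin_nonpos_Reals[OF assms] by auto
  have "(log_quot has_field_derivative deriv log_quot y) (at y)"
    using log_quot_holomorphic assms by (auto intro!: holomorphic_derivI[of _ "ball 0 1"])
  then have "((\<lambda>y. log_quot y * y) has_field_derivative (deriv log_quot y * y + log_quot y)) (at y)"
    by (auto intro!: derivative_eq_intros)
  moreover have "((\<lambda>y. - Ln (1 - y)) has_field_derivative (1 / (1 - y))) (at y)"
    using y by (auto intro!: derivative_eq_intros simp: field_simps)
  ultimately have "deriv log_quot y * y + log_quot y = 1 / (1 - y)"
    unfolding log_quot_mult by (rule DERIV_unique)
  then have "(1 - y) * (deriv log_quot y * y + log_quot y) = 1" using y1 by simp
  then show ?thesis by (simp add: algebra_simps)
qed

text \<open>
  With \<open>y = 1 - exp (-t)\<close> this is \<open>exp (\<delta> t) (y / t)\<^sup>s\<close>, so its Taylor coefficients in \<open>y\<close> expand the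
  symbol \<open>exp (\<delta> t) t\<^sup>-\<^sup>s\<close> of the sequence \<open>(m + \<delta>)\<^sup>s\<^sup>-\<^sup>1 / \<Gamma>(s)\<close> in powers \<open>(1 - z)\<^sup>r\<^sup>-\<^sup>s\<close>, \<open>z = exp (-t)\<close>.
\<close>
definition pow_kernel :: "complex \<Rightarrow> real \<Rightarrow> complex \<Rightarrow> complex" where
  "pow_kernel s \<delta> y = exp (- of_real \<delta> * Ln (1 - y) - s * Ln (log_quot y))"

lemma pow_kernel_0 [simp]: "pow_kernel s \<delta> 0 = 1"
  by (simp add: pow_kernel_def log_quot_def)

text \<open>One exponential of fixed logarithms, in place of a product of powers, makes this exact
  for every y with no condition on branches.\<close>

lemma pow_kernel_add: "pow_kernel (s + t) (\<delta> + \<epsilon>) y = pow_kernel s \<delta> y * pow_kernel t \<epsilon> y"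
  by (simp add: pow_kernel_def algebra_simps flip: exp_add)

lemma log_quot_near_0: "\<forall>\<^sub>F y in nhds 0. norm y < 1 \<and> log_quot y \<notin> \<real>\<^sub>\<le>\<^sub>0"
proof -
  have "isCont log_quot 0"
    using log_quot_holomorphic
    by (meson holomorphic_on_imp_continuous_on continuous_on_eq_continuous_at open_ball centre_in_ball zero_less_one)
  then have "(log_quot \<longlongrightarrow> 1) (nhds 0)"
    using tendsto_at_iff_tendsto_nhds[of log_quot 0] by (simp add: isCont_def log_quot_def[of 0])
  then have "\<forall>\<^sub>F y in nhds 0. log_quot y \<in> ball 1 1"
    by (rule topological_tendstoD) auto
  moreover have "\<forall>\<^sub>F y in nhds 0. (y :: complex) \<in> ball 0 1"
    by (intro eventually_nhds_in_open) auto
  ultimately show ?thesis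
  proof eventually_elim
    case (elim y)
    then have "norm (1 - log_quot y) < 1" by (simp add: dist_norm)
    then show ?case using one_minus_notin_nonpos_Reals[of "1 - log_quot y"] elim by simp
  qed
qed

lemma pow_kernel_analytic: "pow_kernel s \<delta> analytic_on {0}"
proof -
  from log_quot_near_0 obtain \<rho> where \<rho>: "\<rho> > 0"
    "\<And>y. dist y 0 < \<rho> \<Longrightarrow> norm y < 1 \<and> log_quot y \<notin> \<real>\<^sub>\<le>\<^sub>0"
    by (auto simp: eventually_nhds_metric)
  have "log_quot holomorphic_on ball 0 \<rho>"
    by (rule holomorphic_on_subset[OF log_quot_holomorphic]) (use \<rho>(2) in \<open>force simp: dist_commute\<close>)
  moreover have "log_quot y \<notin> \<real>\<^sub>\<le>\<^sub>0" "1 - y \<notin> \<real>\<^sub>\<le>\<^sub>0" if "y \<in> ball 0 \<rho>" for y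
    using \<rho>(2)[of y] that one_minus_notin_nonpos_Reals by (auto simp: dist_commute)
  ultimately have "pow_kernel s \<delta> holomorphic_on ball 0 \<rho>"
    unfolding pow_kernel_def by (auto intro!: holomorphic_intros)
  then show ?thesis using \<rho>(1) by (metis analytic_at centre_in_ball open_ball)
qed

definition kernel_coeff :: "complex \<Rightarrow> real \<Rightarrow> nat \<Rightarrow> complex" where
  "kernel_coeff s \<delta> r = fps_nth (fps_expansion (pow_kernel s \<delta>) 0) r"

lemma pow_kernel_expansion: "pow_kernel s \<delta> has_fps_expansion fps_expansion (pow_kernel s \<delta>) 0"
  by (rule analytic_at_imp_has_fps_expansion_0[OF pow_kernel_analytic])

text \<open>The pair (\<beta>, frac \<theta>) of the quadrature is the sum of the pair (\<alpha> +
  \<beta>, -\<lfloor>\<theta>\<rfloor>) of the exact value and the pair (-\<alpha>, \<theta>) of the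
  symbol; this splits off the common factor in the error.\<close>

lemma kernel_fps_mult:
  "fps_expansion (pow_kernel (s + t) (\<delta> + \<epsilon>)) 0 = fps_expansion (pow_kernel s \<delta>) 0 * fps_expansion (pow_kernel t \<epsilon>) 0"
proof (rule fps_expansion_unique_complex)
  show "(\<lambda>y. pow_kernel s \<delta> y * pow_kernel t \<epsilon> y) has_fps_expansion fps_expansion (pow_kernel s \<delta>) 0 * fps_expansion (pow_kernel t \<epsilon>) 0"
    by (intro fps_expansion_intros pow_kernel_expansion)
  show "(\<lambda>y. pow_kernel s \<delta> y * pow_kernel t \<epsilon> y) has_fps_expansion fps_expansion (pow_kernel (s + t) (\<delta> + \<epsilon>)) 0"
    unfolding pow_kernel_add [symmetric] by (rule pow_kernel_expansion)
qed

lemma kernel_coeff_0 [simp]: "kernel_coeff s \<delta> 0 = 1"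
  by (simp add: kernel_coeff_def fps_expansion_def)

text \<open>The logarithmic derivative of the kernel contains q'/q with q = \<open>log_quot\<close>.
  By \<open>log_quot_deriv\<close> this becomes an expression in 1/q, and 1/q is the quotient of the
  kernels at s + 1 and s.\<close>

lemma pow_kernel_deriv:
  "\<forall>\<^sub>F y in nhds 0. s * pow_kernel (s + 1) \<delta> y =
     of_real \<delta> * (y * pow_kernel s \<delta> y) + s * ((1 - y) * pow_kernel s \<delta> y) - (1 - y) * (y * deriv (pow_kernel s \<delta>) y)"
  using log_quot_near_0
proof eventually_elim
  case (elim y)
  let ?q = "log_quot y" and ?q' = "deriv log_quot y" and ?k = "pow_kernel s \<delta> y"
  have q0: "?q \<noteq> 0" and y1: "1 - y \<notin> \<real>\<^sub>\<le>\<^sub>0" "1 - y \<noteq> 0"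
    using elim one_minus_notin_nonpos_Reals[of y] by auto
  have dq: "(log_quot has_field_derivative ?q') (at y)"
    using log_quot_holomorphic elim by (auto intro!: holomorphic_derivI[of _ "ball 0 1"])
  have "(pow_kernel s \<delta> has_field_derivative (of_real \<delta> / (1 - y) - s * (?q' / ?q)) * ?k) (at y)"
    unfolding pow_kernel_def using elim y1
    by (auto intro!: derivative_eq_intros dq simp: field_simps)
  then have d: "deriv (pow_kernel s \<delta>) y = (of_real \<delta> / (1 - y) - s * (?q' / ?q)) * ?k"
    by (rule DERIV_imp_deriv)
  have "?k = pow_kernel (s + 1) \<delta> y * ?q"
    using q0 pow_kernel_add[of s "1" \<delta> 0 y]
    by (simp add: pow_kernel_def[of 1 0] exp_minus field_simps)
  then have P: "pow_kernel (s + 1) \<delta> y = ?k / ?q" using q0 by simp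
  have "(1 - y) * (y * deriv (pow_kernel s \<delta>) y) = (of_real \<delta> * y - s * (((1 - y) * (y * ?q')) / ?q)) * ?k"
    unfolding d using y1(2) q0 by (simp add: field_simps)
  also have "(((1 - y) * (y * ?q')) / ?q) = 1 / ?q - (1 - y)"
    using log_quot_deriv[of y] elim q0 by (simp add: diff_divide_distrib)
  finally show ?case unfolding P by (simp add: algebra_simps)
qed

lemma kernel_coeff_rec:
  "s * kernel_coeff (s + 1) \<delta> (Suc r) =
     (s - of_nat (Suc r)) * kernel_coeff s \<delta> (Suc r) + (of_real \<delta> - s + of_nat r) * kernel_coeff s \<delta> r"
proof -
  define K where "K = (\<lambda>s. fps_expansion (pow_kernel s \<delta>) 0)"
  have K: "pow_kernel s \<delta> has_fps_expansion K s" for s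
    unfolding K_def by (rule pow_kernel_expansion)
  have "(\<lambda>y. s * pow_kernel (s + 1) \<delta> y) has_fps_expansion fps_const s * K (s + 1)"
    by (intro fps_expansion_intros K)
  also have "?this \<longleftrightarrow> (\<lambda>y. of_real \<delta> * (y * pow_kernel s \<delta> y) + s * ((1 - y) * pow_kernel s \<delta> y) -
       (1 - y) * (y * deriv (pow_kernel s \<delta>) y)) has_fps_expansion fps_const s * K (s + 1)"
    by (intro has_fps_expansion_cong pow_kernel_deriv refl)
  finally have 1: "(\<lambda>y. of_real \<delta> * (y * pow_kernel s \<delta> y) + s * ((1 - y) * pow_kernel s \<delta> y) -
       (1 - y) * (y * deriv (pow_kernel s \<delta>) y)) has_fps_expansion fps_const s * K (s + 1)" .
  have 2: "(\<lambda>y. of_real \<delta> * (y * pow_kernel s \<delta> y) + s * ((1 - y) * pow_kernel s \<delta> y) -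
       (1 - y) * (y * deriv (pow_kernel s \<delta>) y)) has_fps_expansion
       fps_const (of_real \<delta>) * (fps_X * K s) + fps_const s * ((1 - fps_X) * K s) - (1 - fps_X) * (fps_X * fps_deriv (K s))"
    by (intro fps_expansion_intros K)
  have "fps_const s * K (s + 1) =
    fps_const (of_real \<delta>) * (fps_X * K s) + fps_const s * ((1 - fps_X) * K s) - (1 - fps_X) * (fps_X * fps_deriv (K s))"
    by (rule fps_expansion_unique_complex[OF 1 2])
  also have "\<dots> = fps_const (of_real \<delta>) * (fps_X * K s) + fps_const s * K s - fps_const s * (fps_X * K s)
       - fps_X * fps_deriv (K s) + fps_X * (fps_X * fps_deriv (K s))"
    by (simp add: algebra_simps)
  finally have "fps_nth (fps_const s * K (s + 1)) (Suc r) = fps_nth (fps_const (of_real \<delta>) * (fps_X * K s) + fps_const s * K s - fps_const s * (fps_X * K s)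
       - fps_X * fps_deriv (K s) + fps_X * (fps_X * fps_deriv (K s))) (Suc r)" by simp
  then show ?thesis
    \<comment> \<open>The last summand has y^2 in front, so its coefficient at r + 1 is that of the
      derivative at r - 1; this separates r = 0.\<close>
    by (cases r) (simp_all add: kernel_coeff_def K_def algebra_simps)
qed

text \<open>For t > 0 all logarithms involved are real, so the exponential splits into principal
  powers.\<close>

lemma pow_kernel_exp_minus:
  assumes "t > 0"
  shows "pow_kernel s \<delta> (of_real (1 - exp (- t))) =
    of_real t powr (- s) * of_real (exp (\<delta> * t)) * of_real (1 - exp (- t)) powr s"
proof -
  define y where "y = 1 - exp (- t)"
  have y: "y > 0" using assms by (simp add: y_def)
  have "1 - complex_of_real y = of_real (exp (- t))" by (simp add: y_def)
  then have ln: "Ln (1 - of_real y) = of_real (- t)" by (simp only:) (subst Ln_of_real, auto)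
  then have "log_quot (of_real y) = of_real (t / y)" using y by (simp add: log_quot_def)
  moreover have "Ln (of_real (t / y)) = of_real (ln (t / y))" using y assms by (intro Ln_of_real) simp
  moreover have "ln (t / y) = ln t - ln y" using y assms by (simp add: ln_div)
  ultimately have lq: "Ln (log_quot (of_real y)) = of_real (ln t - ln y)" by (simp only:)
  have "pow_kernel s \<delta> (of_real y) = exp (- s * of_real (ln t) + of_real (\<delta> * t) + s * of_real (ln y))"
    unfolding pow_kernel_def ln lq by (simp add: algebra_simps)
  also have "\<dots> = of_real t powr (- s) * of_real (exp (\<delta> * t)) * of_real y powr s"
    using y assms by (simp only: exp_add powr_def Ln_of_real exp_of_real of_real_eq_0_iff less_imp_neq[symmetric] if_False)
  finally show ?thesis unfolding y_def .
qed

section \<open>Laplace and Beta integrals\<close>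

lemma tpow_Laplace:
  assumes "Re z > 0" and k: "k > 0"
  shows "integrable lborel (\<lambda>t. tpow (z - 1) t * of_real (exp (- (k * t))))"
    and "(LINT t|lborel. tpow (z - 1) t * of_real (exp (- (k * t)))) = of_real k powr (- z) * Gamma z"
proof -
  let ?f = "\<lambda>t. tpow (z - 1) t * complex_of_real (exp (- t))"
  let ?g = "\<lambda>t. tpow (z - 1) t * complex_of_real (exp (- (k * t)))"
  have scale: "?f (k * t) = tpow (z - 1) k * ?g t" for t
    using k by (simp add: tpow_mult mult_ac)
  have k0: "tpow (z - 1) k \<noteq> 0" using k by (simp add: tpow_def)
  have "integrable lborel (\<lambda>t. ?f (0 + k * t))"
    using lborel_integrable_real_affine_iff[of k ?f 0] tpow_Gamma(1)[OF assms(1)] k by simp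
  then have "integrable lborel (\<lambda>t. inverse (tpow (z - 1) k) * (tpow (z - 1) k * ?g t))"
    by (intro integrable_mult_right[of _ lborel "\<lambda>t. tpow (z - 1) k * ?g t"]) (simp only: scale add_0_left)
  then show i: "integrable lborel ?g"
  proof -
    have "(\<lambda>t. inverse (tpow (z - 1) k) * (tpow (z - 1) k * ?g t)) = ?g"
      using k0 by (simp add: fun_eq_iff field_simps)
    then show "integrable lborel (\<lambda>t. inverse (tpow (z - 1) k) * (tpow (z - 1) k * ?g t)) \<Longrightarrow> integrable lborel ?g"
      by (simp only:)
  qed
  have "Gamma z = k *\<^sub>R (LINT t|lborel. ?f (0 + k * t))"
    using lborel_integral_real_affine[of k ?f 0] tpow_Gamma(2)[OF assms(1)] k by simp
  also have "\<dots> = of_real k powr 1 * of_real k powr (z - 1) * (LINT t|lborel. ?g t)"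
    using k by (simp add: scale scaleR_conv_of_real tpow_powr)
  also have "of_real k powr 1 * of_real k powr (z - 1) = of_real k powr z"
    using k by (simp add: powr_diff)
  finally show "(LINT t|lborel. ?g t) = of_real k powr (- z) * Gamma z"
    using k by (simp add: powr_minus)
qed

text \<open>The substitution t = - ln (1 - y), under which exp t - 1 = y / (1 - y), turns the
  integral into Euler's Beta integral. \<open>Re a < 1\<close> gives convergence at t = 0 and
  \<open>k + Re a > 0\<close> at infinity.\<close>

lemma tpow_Beta_Laplace:
  assumes a: "Re a < 1" and k: "k + Re a > 0"
  shows "integrable lborel (\<lambda>t. tpow (- a) (exp t - 1) * of_real (exp (- (k * t))))" (is ?A)
    and "(LINT t|lborel. tpow (- a) (exp t - 1) * of_real (exp (- (k * t)))) = Beta (1 - a) (of_real k + a)" (is ?B)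
proof -
  let ?F = "\<lambda>t. tpow (- a) (exp t - 1) * complex_of_real (exp (- (k * t)))"
  let ?h = "\<lambda>y. tpow (- a) y * tpow (of_real k + a - 1) (1 - y)"
  define g where "g = (\<lambda>y :: real. - ln (1 - y))"
  \<comment> \<open>The derivative of \<open>g\<close> on (0, 1); the absolute value makes it
    nonnegative everywhere.\<close>
  define g' where "g' = (\<lambda>y :: real. 1 / \<bar>1 - y\<bar>)"
  have conv: "integrable lborel ?h" "(LINT y|lborel. ?h y) = Beta (1 - a) (of_real k + a)"
    using tpow_convolution[of "1 - a" "of_real k + a" 1] a k by (simp_all add: tpow_def)
  have h: "g' y *\<^sub>R ?F (g y) = ?h y" if y: "0 < y" "y < 1" for y
  proof -
    have 1: "exp (g y) = 1 / (1 - y)" and 2: "exp (- (k * g y)) = exp (k * ln (1 - y))"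
      using y by (simp_all add: g_def exp_minus field_simps)
    have 3: "tpow (- a) (1 / (1 - y) - 1) = tpow (- a) y * tpow a (1 - y)"
    proof -
      have "1 / (1 - y) - 1 = y / (1 - y)" using y by (simp add: field_simps)
      then show ?thesis using y
        by (simp add: tpow_def ln_div ring_distribs exp_add exp_diff exp_minus field_simps)
    qed
    have 4: "of_real (exp (k * ln (1 - y))) = tpow (of_real k) (1 - y)"
      using y by (simp add: tpow_def exp_of_real[symmetric])
    have 5: "complex_of_real (g' y) = tpow (- 1) (1 - y)"
      using y by (simp add: tpow_def g'_def exp_minus exp_of_real divide_inverse)
    have 6: "tpow (of_real k + a - 1) (1 - y) = tpow (of_real k) (1 - y) * tpow a (1 - y) * tpow (- 1) (1 - y)"
      by (simp add: tpow_add [symmetric])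
    show ?thesis
      unfolding 1 2 3 4 scaleR_conv_of_real 5 6 by (simp add: mult_ac)
  qed
  have eint: "einterval 0 1 = {0<..<1::real}" "einterval 0 \<infinity> = {0<..}"
    by (auto simp: einterval_def zero_ereal_def one_ereal_def)
  have F0: "?F t = indicator {0<..} t *\<^sub>R ?F t" for t by (auto simp: indicator_def tpow_def)
  have h0: "?h t = indicator {0<..<1} t *\<^sub>R ?h t" for t by (auto simp: indicator_def tpow_def)
  have dg: "DERIV g y :> g' y" if "0 < ereal y" "ereal y < 1" for y
    using that by (auto simp: g_def g'_def zero_ereal_def one_ereal_def intro!: derivative_eq_intros)
  have g'c: "isCont g' y" if "0 < ereal y" "ereal y < 1" for y
    using that unfolding g'_def by (auto simp: zero_ereal_def one_ereal_def intro!: continuous_intros)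
  have gpos: "g y > 0" if "0 < ereal y" "ereal y < 1" for y
    using that by (simp add: g_def zero_ereal_def one_ereal_def)
  have Fc: "isCont ?F (g y)" if "0 < ereal y" "ereal y < 1" for y
  proof -
    let ?E = "\<lambda>x. exp (- a * of_real (ln (exp x - 1))) * complex_of_real (exp (- (k * x)))"
    have "\<forall>\<^sub>F x in nhds (g y). x \<in> {0<..}"
      using gpos[OF that] by (intro eventually_nhds_in_open) auto
    then have "\<forall>\<^sub>F x in nhds (g y). ?F x = ?E x"
      by eventually_elim (simp add: tpow_def)
    moreover have "isCont ?E (g y)" using gpos[OF that] by (intro continuous_intros) auto
    ultimately show ?thesis by (subst isCont_cong)
  qed
  have limA: "((ereal \<circ> g \<circ> real_of_ereal) \<longlongrightarrow> 0) (at_right 0)"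
  proof -
    have "(g \<longlongrightarrow> 0) (at_right 0)" unfolding g_def by real_asymp
    then have "((\<lambda>x. ereal (g x)) \<longlongrightarrow> 0) (at_right 0)" by (simp add: zero_ereal_def)
    then show ?thesis unfolding zero_ereal_def by (simp add: ereal_tendsto_simps)
  qed
  have limB: "((ereal \<circ> g \<circ> real_of_ereal) \<longlongrightarrow> \<infinity>) (at_left 1)"
  proof -
    have "filterlim g at_top (at_left 1)" unfolding g_def by real_asymp
    then show ?thesis unfolding one_ereal_def
      by (simp add: ereal_tendsto_simps tendsto_PInfty_eq_at_top)
  qed
  have ih: "set_integrable lborel (einterval 0 1) ?h"
    using conv(1) h0 by (simp add: set_integrable_def eint cong: Bochner_Integration.integrable_cong)
  have iF: "set_integrable lborel (einterval 0 1) (\<lambda>y. g' y *\<^sub>R ?F (g y))"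
    using ih unfolding eint by (rule set_integrable_cong[THEN iffD1, rotated 3]) (auto simp: h)
  \<comment> \<open>Substitution for complex functions presupposes integrability on both sides, so
    this comes first, from the rule for nonnegative functions applied to the norm.\<close>
  have "set_integrable lborel (einterval 0 \<infinity>) (\<lambda>t. norm (?F t))"
  proof (rule interval_integral_substitution_nonneg(1)[where g = g and g' = g' and a = 0 and b = 1])
    have "set_integrable lborel (einterval 0 1) (\<lambda>y. norm (g' y *\<^sub>R ?F (g y)))"
      using iF by (rule set_integrable_norm)
    then show "set_integrable lborel (einterval 0 1) (\<lambda>x. norm (?F (g x)) * g' x)"
      by (simp add: g'_def mult.commute)
  qed (use dg g'c Fc limA limB in \<open>auto simp: g'_def intro!: isCont_norm\<close>)
  then have "integrable lborel (\<lambda>t. norm (indicator {0<..} t *\<^sub>R ?F t))"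
    by (simp add: set_integrable_def eint)
  then have "integrable lborel (\<lambda>t. norm (?F t))"
    by (simp only: F0[symmetric])
  then show A: ?A
    by (subst (asm) integrable_norm_iff) auto
  have "(LBINT t=0..\<infinity>. ?F t) = (LBINT y=0..1. g' y *\<^sub>R ?F (g y))"
  proof (rule interval_integral_substitution_integrable)
    show "set_integrable lborel (einterval 0 \<infinity>) ?F"
      using A F0 by (simp add: set_integrable_def eint cong: Bochner_Integration.integrable_cong)
  qed (use dg g'c Fc limA limB iF in \<open>auto simp: g'_def\<close>)
  also have "(LBINT t=0..\<infinity>. ?F t) = (LINT t|lborel. ?F t)"
    using F0 by (simp add: interval_lebesgue_integral_def set_lebesgue_integral_def eint)
  also have "(LBINT y=0..1. g' y *\<^sub>R ?F (g y)) = (LINT y:{0<..<1}|lborel. ?h y)"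
    unfolding interval_lebesgue_integral_def eint
    by (auto simp: h intro!: set_lebesgue_integral_cong)
  also have "\<dots> = (LINT y|lborel. ?h y)"
    unfolding set_lebesgue_integral_def using h0 by simp
  finally show ?B using conv(2) by simp
qed

lemma pow_kernel_real:
  assumes "t > 0"
  shows "pow_kernel s \<delta> (1 - of_real (exp t)) * tpow (- s) (exp t - 1) = tpow (- s) t * of_real (exp (- (\<delta> * t)))"
proof -
  have "Ln (of_real (exp t)) = of_real t" by (subst Ln_of_real) auto
  moreover have "log_quot (1 - of_real (exp t)) = of_real (t / (exp t - 1))"
    using assms calculation by (simp add: log_quot_def field_simps del: of_real_exp)
  moreover have "t / (exp t - 1) > 0" using assms by simp
  then have "Ln (of_real (t / (exp t - 1))) = of_real (ln (t / (exp t - 1)))"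
    by (rule Ln_of_real)
  moreover have "ln (t / (exp t - 1)) = ln t - ln (exp t - 1)"
    using assms by (simp add: ln_div)
  ultimately have "pow_kernel s \<delta> (1 - of_real (exp t)) =
      exp (- of_real \<delta> * of_real t - s * of_real (ln t - ln (exp t - 1)))"
    by (simp add: pow_kernel_def)
  then have "pow_kernel s \<delta> (1 - of_real (exp t)) * tpow (- s) (exp t - 1) =
      exp (- of_real \<delta> * of_real t - s * of_real (ln t - ln (exp t - 1)) + - s * of_real (ln (exp t - 1)))"
    using assms by (simp only: exp_add tpow_def) simp
  also have "\<dots> = exp (- s * of_real (ln t) + of_real (- (\<delta> * t)))"
    by (simp add: algebra_simps)
  also have "\<dots> = tpow (- s) t * of_real (exp (- (\<delta> * t)))"
    using assms by (simp only: tpow_def exp_add exp_of_real if_True)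
  finally show ?thesis .
qed

text \<open>
  The kernel is evaluated at \<open>y = 1 - exp t < 0\<close>: by the reflection formula this puts
  \<open>(m + \<delta>)\<^sup>s\<^sup>-\<^sup>1 / \<Gamma>(s)\<close> and all \<open>bin_coeff (s - r) m\<close> in the form \<open>sin (\<pi> s) / \<pi>\<close> times a Laplace integral.
\<close>
definition kernel_remainder :: "complex \<Rightarrow> real \<Rightarrow> nat \<Rightarrow> real \<Rightarrow> complex" where
  "kernel_remainder s \<delta> R t = tpow (- s) t * of_real (exp (- (\<delta> * t))) -
     (\<Sum>r<R. (- 1) ^ r * kernel_coeff s \<delta> r * tpow (of_nat r - s) (exp t - 1))"

lemma exp_minus_1_bounds:
  fixes t :: real
  assumes "t > 0"
  shows "t \<le> exp t - 1" "exp t - 1 \<le> t * exp t"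
proof -
  show "t \<le> exp t - 1" using exp_ge_add_one_self[of t] by linarith
  have "1 - t \<le> exp (- t)" using exp_ge_add_one_self[of "- t"] by simp
  then have "exp t * (1 - t) \<le> exp t * exp (- t)" by (intro mult_left_mono) auto
  then show "exp t - 1 \<le> t * exp t" by (simp add: algebra_simps flip: exp_add)
qed

text \<open>Near 0 the Taylor bound for the kernel gives (exp t - 1)^(R - Re s); away from 0 each of
  the finitely many terms grows at most exponentially. The exponential factor is harmless since it
  only shifts the Laplace variable.\<close>

lemma kernel_remainder_bound:
  assumes R: "R > 0" and s: "Re s < 1"
  obtains C A where "C \<ge> 0" "A \<ge> 0"
    "\<And>t. t > 0 \<Longrightarrow> norm (kernel_remainder s \<delta> R t) \<le> C * (t powr (real R - Re s) * exp (A * t))"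
proof -
  define p where "p = real R - Re s"
  have p: "p > 0" using R s by (simp add: p_def)
  \<comment> \<open>|\<delta>| absorbs exp (-\<delta> t), and p absorbs the last factor in (exp t -
    1)^p \<le> t^p exp (p t).\<close>
  define A where "A = \<bar>\<delta>\<bar> + p"
  have A: "A \<ge> 0" using p by (simp add: A_def)
  let ?G = "\<lambda>t. t powr p * exp (A * t)"
  have pow_le: "(exp t - 1) powr p \<le> ?G t" if "t > 0" for t
  proof -
    have "(exp t - 1) powr p \<le> (t * exp t) powr p"
      using that exp_minus_1_bounds[OF that] p by (intro powr_mono2) auto
    also have "\<dots> = t powr p * exp (p * t)"
      using that by (simp add: powr_mult exp_powr_real mult_ac)
    also have "\<dots> \<le> ?G t"
      using that by (intro mult_left_mono) (auto simp: A_def)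
    finally show ?thesis .
  qed
  obtain C1 where C1: "\<forall>\<^sub>F y in nhds 0. norm (pow_kernel s \<delta> y - (\<Sum>r<R. kernel_coeff s \<delta> r * y ^ r)) \<le> C1 * norm y ^ R"
    using has_fps_expansion_Taylor_bound[OF pow_kernel_expansion] unfolding kernel_coeff_def by blast
  then obtain \<rho> where \<rho>: "\<rho> > 0" "\<And>y. norm y < \<rho> \<Longrightarrow>
      norm (pow_kernel s \<delta> y - (\<Sum>r<R. kernel_coeff s \<delta> r * y ^ r)) \<le> C1 * norm y ^ R"
    by (auto simp: eventually_nhds_metric)
  \<comment> \<open>For t < \<tau> the point 1 - exp t stays in the disc of radius \<rho>.\<close>
  define \<tau> where "\<tau> = ln (1 + \<rho>)"
  have \<tau>: "\<tau> > 0" using \<rho> by (simp add: \<tau>_def)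
  have small: "norm (kernel_remainder s \<delta> R t) \<le> \<bar>C1\<bar> * ?G t" if t: "0 < t" "t < \<tau>" for t
  proof -
    let ?u = "exp t - 1"
    have u: "?u > 0" "?u < \<rho>"
      using t \<rho>(1) by (auto simp: \<tau>_def) (metis add.commute add_pos_pos exp_less_mono exp_ln less_diff_eq zero_less_one diff_less_eq)
    have "(- 1) ^ r * kernel_coeff s \<delta> r * tpow (of_nat r - s) ?u =
      kernel_coeff s \<delta> r * (1 - of_real (exp t)) ^ r * tpow (- s) ?u" for r
    proof -
      have "of_nat r - s = of_nat r + (- s)" by simp
      then have "tpow (of_nat r - s) ?u = tpow (of_nat r) ?u * tpow (- s) ?u" by (metis tpow_add)
      moreover have "tpow (of_nat r) ?u = of_real ?u ^ r" using u(1) by (simp add: tpow_powr powr_nat')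
      moreover have "(1 - of_real (exp t)) ^ r = (- 1) ^ r * complex_of_real ?u ^ r"
        by (simp flip: power_mult_distrib)
      ultimately show ?thesis by (simp add: mult_ac)
    qed
    then have "kernel_remainder s \<delta> R t = (pow_kernel s \<delta> (1 - of_real (exp t)) -
        (\<Sum>r<R. kernel_coeff s \<delta> r * (1 - of_real (exp t)) ^ r)) * tpow (- s) ?u"
      using pow_kernel_real[OF t(1)]
      by (simp only: kernel_remainder_def left_diff_distrib sum_distrib_right)
    moreover have nu: "norm (1 - complex_of_real (exp t)) = ?u"
      using u(1) by (metis abs_of_pos norm_minus_commute norm_of_real of_real_1 of_real_diff)
    ultimately have "norm (kernel_remainder s \<delta> R t) \<le> (C1 * ?u ^ R) * ?u powr (- Re s)"
      using \<rho>(2)[of "1 - of_real (exp t)"] u by (simp add: norm_mult norm_tpow mult_right_mono)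
    also have "\<dots> = C1 * ?u powr p"
      using u(1) by (simp add: p_def powr_diff powr_minus powr_realpow field_simps)
    also have "\<dots> \<le> \<bar>C1\<bar> * ?G t"
      using pow_le[OF t(1)] by (intro mult_mono) auto
    finally show ?thesis .
  qed
  \<comment> \<open>For t \<ge> \<tau> also exp t - 1 \<ge> \<tau>, so the negative powers t^(-R)
    and (exp t - 1)^(r - R) are at most the same powers of \<tau>.\<close>
  define C2 where "C2 = \<tau> powr (- real R) + (\<Sum>r<R. norm (kernel_coeff s \<delta> r) * \<tau> powr (real r - real R))"
  have C2: "C2 \<ge> 0" by (auto simp: C2_def intro!: add_nonneg_nonneg sum_nonneg)
  have large: "norm (kernel_remainder s \<delta> R t) \<le> C2 * ?G t" if t: "t \<ge> \<tau>" for t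
  proof -
    have t0: "t > 0" using t \<tau> by simp
    let ?u = "exp t - 1"
    have u: "?u > 0" "?u \<ge> \<tau>" using exp_minus_1_bounds[OF t0] t t0 by auto
    have 1: "norm (tpow (- s) t * of_real (exp (- (\<delta> * t)))) \<le> \<tau> powr (- real R) * ?G t"
    proof -
      have "norm (tpow (- s) t * of_real (exp (- (\<delta> * t)))) = t powr (- Re s) * exp (- (\<delta> * t))"
        using t0 by (simp add: norm_mult norm_tpow)
      also have "t powr (- Re s) = t powr (- real R) * t powr p"
        by (simp add: p_def flip: powr_add)
      also have "\<dots> * exp (- (\<delta> * t)) \<le> (\<tau> powr (- real R) * t powr p) * exp (A * t)"
      proof (intro mult_mono mult_right_mono)
        show "t powr (- real R) \<le> \<tau> powr (- real R)" using t \<tau> by (intro powr_mono2') auto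
        have "- \<delta> \<le> A" using p by (simp add: A_def)
        then show "exp (- (\<delta> * t)) \<le> exp (A * t)" using t0 mult_right_mono[of "- \<delta>" A t] by simp
      qed auto
      finally show ?thesis by (simp add: mult_ac)
    qed
    have 2: "norm ((- 1) ^ r * kernel_coeff s \<delta> r * tpow (of_nat r - s) ?u) \<le>
        (norm (kernel_coeff s \<delta> r) * \<tau> powr (real r - real R)) * ?G t" if "r < R" for r
    proof -
      have "norm ((- 1) ^ r * kernel_coeff s \<delta> r * tpow (of_nat r - s) ?u) =
          norm (kernel_coeff s \<delta> r) * ?u powr (real r - Re s)"
        using t0 by (simp add: norm_mult norm_power norm_tpow)
      also have "?u powr (real r - Re s) = ?u powr (real r - real R) * ?u powr p"
        by (simp add: p_def flip: powr_add)
      also have "norm (kernel_coeff s \<delta> r) * \<dots> \<le> norm (kernel_coeff s \<delta> r) * (\<tau> powr (real r - real R) * ?G t)"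
        using that u \<tau> pow_le[OF t0] by (intro mult_left_mono mult_mono powr_mono2') auto
      finally show ?thesis by (simp add: mult_ac)
    qed
    have "norm (kernel_remainder s \<delta> R t) \<le> norm (tpow (- s) t * of_real (exp (- (\<delta> * t)))) +
        norm (\<Sum>r<R. (- 1) ^ r * kernel_coeff s \<delta> r * tpow (of_nat r - s) ?u)"
      unfolding kernel_remainder_def by (rule norm_triangle_ineq4)
    also have "\<dots> \<le> \<tau> powr (- real R) * ?G t + (\<Sum>r<R. (norm (kernel_coeff s \<delta> r) * \<tau> powr (real r - real R)) * ?G t)"
      using 2 by (intro add_mono 1 order.trans[OF norm_sum] sum_mono) auto
    also have "\<dots> = C2 * ?G t" by (simp add: C2_def ring_distribs sum_distrib_right)
    finally show ?thesis .
  qed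
  show ?thesis
  proof (rule that[of "\<bar>C1\<bar> + C2" A])
    fix t :: real assume t: "t > 0"
    have "0 \<le> ?G t" by simp
    then have "0 \<le> \<bar>C1\<bar> * ?G t" "0 \<le> C2 * ?G t" using C2 by (intro mult_nonneg_nonneg; simp)+
    then show "norm (kernel_remainder s \<delta> R t) \<le> (\<bar>C1\<bar> + C2) * (t powr (real R - Re s) * exp (A * t))"
      using small[of t] large[of t] t unfolding p_def [symmetric] by (cases "t < \<tau>") (auto simp add: distrib_right intro: add_increasing add_increasing2)
  qed (use C2 A in auto)
qed


lemma kernel_remainder_measurable [measurable]: "kernel_remainder s \<delta> R \<in> borel_measurable borel"
  unfolding kernel_remainder_def by measurable

text \<open>The estimate in Watson's lemma: for m > A the bound integrates to C \<Gamma>(q + 1) (m -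
  A)^(-q-1), and the shift by A does not change the order.\<close>

lemma poly_growth_Laplace:
  assumes H: "H \<in> borel_measurable borel" "\<And>t. t \<le> 0 \<Longrightarrow> H t = 0"
    and bd: "\<And>t. t > 0 \<Longrightarrow> norm (H t) \<le> C * (t powr q * exp (A * t))"
    and C: "C \<ge> 0" and q: "q > -1"
  shows "poly_growth (- q - 1) (\<lambda>m. LINT t|lborel. H t * complex_of_real (exp (- (real m * t))))"
proof -
  define G where "G = C * Gamma (q + 1)"
  have le: "norm (LINT t|lborel. H t * complex_of_real (exp (- (real m * t)))) \<le> G * (real m - A) powr (- (q + 1))"
    if m: "real m > A" for m
  proof -
    define k where "k = real m - A"
    have k: "k > 0" using m by (simp add: k_def)
    let ?D = "\<lambda>t. C * norm (tpow (of_real q) t * complex_of_real (exp (- (k * t))))"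
    \<comment> \<open>With a real exponent the complex integrand equals its own norm, so the complex
      Gamma integral evaluates the real one.\<close>
    have eq: "tpow (of_real (q + 1) - 1) t * complex_of_real (exp (- (k * t))) =
      complex_of_real (norm (tpow (of_real q) t * complex_of_real (exp (- (k * t)))))" for t
      by (simp add: norm_mult norm_tpow) (simp add: tpow_def powr_def exp_of_real[symmetric])
    have int: "integrable lborel (\<lambda>t. norm (tpow (of_real q) t * complex_of_real (exp (- (k * t)))))"
      using tpow_Laplace(1)[of "of_real (q + 1)" k] q k by (simp add: integrable_norm_iff del: of_real_exp)
    have "complex_of_real (LINT t|lborel. norm (tpow (of_real q) t * complex_of_real (exp (- (k * t))))) =
       of_real k powr (- of_real (q + 1)) * Gamma (of_real (q + 1))"
      using tpow_Laplace(2)[of "of_real (q + 1)" k] q k unfolding eq by simp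
    also have "\<dots> = of_real (k powr (- (q + 1)) * Gamma (q + 1))"
      using k by (simp add: powr_of_real[symmetric] Gamma_complex_of_real[symmetric])
    finally have val: "(LINT t|lborel. norm (tpow (of_real q) t * complex_of_real (exp (- (k * t))))) =
       k powr (- (q + 1)) * Gamma (q + 1)"
      by (simp only: of_real_eq_iff)
    have "norm (LINT t|lborel. H t * complex_of_real (exp (- (real m * t)))) \<le> (LINT t|lborel. ?D t)"
    proof (rule Bochner_Integration.integral_norm_bound_integral)
      have nle: "norm (H t * complex_of_real (exp (- (real m * t)))) \<le> ?D t" for t
      proof (cases "t > 0")
        case True
        have "norm (H t * complex_of_real (exp (- (real m * t)))) \<le> (C * (t powr q * exp (A * t))) * exp (- (real m * t))"
          unfolding norm_mult using bd[OF True] by (simp add: mult_right_mono)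
        also have "\<dots> = C * (t powr q * exp (- (k * t)))"
          by (simp add: k_def algebra_simps flip: exp_add)
        finally show ?thesis using True by (simp add: norm_mult norm_tpow)
      next
        case False
        then show ?thesis using C by (simp add: H)
      qed
      then show "norm (H t * complex_of_real (exp (- (real m * t)))) \<le> ?D t" for t .
      show iD: "integrable lborel ?D" using int by simp
      show "integrable lborel (\<lambda>t. H t * complex_of_real (exp (- (real m * t))))"
        by (rule Bochner_Integration.integrable_bound[OF iD])
           (use H nle C in \<open>auto intro!: AE_I2 simp del: norm_mult\<close>)
    qed
    also have "\<dots> = G * k powr (- (q + 1))"
      using val by (simp add: G_def mult_ac)
    finally show ?thesis by (simp add: k_def)
  qed
  have "((\<lambda>m. (real m - A) powr (- (q + 1)) / real (Suc m) powr (- q - 1)) \<longlongrightarrow> 1) sequentially"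
    by real_asymp
  then have "\<forall>\<^sub>F m in sequentially. (real m - A) powr (- (q + 1)) / real (Suc m) powr (- q - 1) < 2"
    by (rule order_tendstoD) simp
  moreover have "\<forall>\<^sub>F m in sequentially. real m > A" by real_asymp
  ultimately have "\<forall>\<^sub>F m in sequentially. norm (LINT t|lborel. H t * complex_of_real (exp (- (real m * t)))) \<le>
     (2 * G) * real (Suc m) powr (- q - 1)"
  proof eventually_elim
    case (elim m)
    have "G \<ge> 0" using C q by (auto simp: G_def intro!: mult_nonneg_nonneg less_imp_le Gamma_real_pos)
    then have "G * (real m - A) powr (- (q + 1)) \<le> G * (2 * real (Suc m) powr (- q - 1))"
      using elim by (intro mult_left_mono) (simp_all add: divide_less_eq del: of_nat_Suc)
    then show ?case using le[OF elim(2)] by (simp add: mult_ac)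
  qed
  then show ?thesis by (rule poly_growth_eventuallyI)
qed

lemma sin_pi_diff_of_nat:
  "sin (of_real pi * (s - of_nat r)) = (- 1) ^ r * sin (of_real pi * (s :: complex))"
proof (induction r)
  case (Suc r)
  have "sin (of_real pi * (s - of_nat (Suc r))) = sin (of_real pi * (s - of_nat r) - of_real pi)"
    by (simp add: algebra_simps)
  also have "\<dots> = - sin (of_real pi * (s - of_nat r))"
    unfolding sin_diff sin_of_real cos_of_real by simp
  finally show ?case using Suc.IH by simp
qed simp

text \<open>With c = sin (\<pi> s) / \<pi> every term on the left is c times an integral, a Gamma
  integral for the power and a Beta integral for each \<open>bin_coeff\<close>. The sign (-1)^r in
  \<open>kernel_remainder\<close> cancels the one in sin (\<pi> (s - r)). The bounds on m make the
  integrals converge.\<close>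

lemma kernel_remainder_Laplace:
  assumes s: "Re s < 1" and m: "real m + \<delta> > 0" "real m > real R + \<bar>Re s\<bar>"
  shows "rGamma s * of_real (real m + \<delta>) powr (s - 1) - (\<Sum>r<R. kernel_coeff s \<delta> r * bin_coeff (s - of_nat r) m) =
     sin (of_real pi * s) / of_real pi * (LINT t|lborel. kernel_remainder s \<delta> R t * complex_of_real (exp (- (real m * t))))"
proof -
  define c where "c = sin (of_real pi * s) / of_real pi"
  let ?e = "\<lambda>t. complex_of_real (exp (- (real m * t)))"
  have rG1: "rGamma (1 - s) * Gamma (1 - s) = 1"
    using complex_Re_pos_nonpos_Ints[of "1 - s"] s by (simp add: rGamma_inverse_Gamma Gamma_eq_zero_iff)
  define f0 where "f0 = (\<lambda>t. tpow (- s) t * of_real (exp (- (\<delta> * t))) * ?e t)"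
  define f where "f = (\<lambda>r t. (- 1) ^ r * kernel_coeff s \<delta> r * (tpow (of_nat r - s) (exp t - 1) * ?e t))"
  have f0eq: "f0 = (\<lambda>t. tpow ((1 - s) - 1) t * of_real (exp (- ((real m + \<delta>) * t))))"
    by (simp add: f0_def fun_eq_iff exp_add[symmetric] algebra_simps flip: of_real_mult)
  have i0: "integrable lborel f0" and v0: "(LINT t|lborel. f0 t) = of_real (real m + \<delta>) powr (s - 1) * Gamma (1 - s)"
    using tpow_Laplace[of "1 - s" "real m + \<delta>"] s m unfolding f0eq by (simp_all del: of_real_add)
  have 0: "rGamma s * of_real (real m + \<delta>) powr (s - 1) = c * (LINT t|lborel. f0 t)"
    using rG1 unfolding v0 c_def rGamma_reflection_complex [symmetric] by (simp add: mult_ac)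
  have ir: "integrable lborel (f r)" and 1: "kernel_coeff s \<delta> r * bin_coeff (s - of_nat r) m = c * (LINT t|lborel. f r t)" if r: "r < R" for r
  proof -
    define a where "a = s - of_nat r"
    have a: "Re a < 1" "real m + Re a > 0" using s r m by (auto simp: a_def)
    have fr: "f r = (\<lambda>t. ((- 1) ^ r * kernel_coeff s \<delta> r) * (tpow (- a) (exp t - 1) * ?e t))"
      by (simp add: f_def a_def)
    show "integrable lborel (f r)"
      unfolding fr using tpow_Beta_Laplace(1)[OF a] by (intro integrable_mult_right)
    have v: "(LINT t|lborel. f r t) = (- 1) ^ r * kernel_coeff s \<delta> r * Beta (1 - a) (of_nat m + a)"
      unfolding fr using tpow_Beta_Laplace(2)[OF a] by simp
    have "sin (of_real pi * a) = (- 1) ^ r * sin (of_real pi * s)"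
      unfolding a_def by (rule sin_pi_diff_of_nat)
    then have refl: "rGamma a * rGamma (1 - a) = (- 1) ^ r * c"
      unfolding rGamma_reflection_complex c_def by simp
    have rGa: "rGamma (1 - a) * Gamma (1 - a) = 1" "rGamma (of_nat m + a) * Gamma (of_nat m + a) = 1"
      using complex_Re_pos_nonpos_Ints[of "1 - a"] complex_Re_pos_nonpos_Ints[of "of_nat m + a"] a
      by (simp_all add: rGamma_inverse_Gamma Gamma_eq_zero_iff)
    \<comment> \<open>Inserting these products avoids a division by \<Gamma>(a): at a nonpositive
      integer \<open>a\<close> the factor \<open>rGamma a\<close> is 0 and the identity
      persists.\<close>
    have "bin_coeff a m = bin_coeff a m * (rGamma (of_nat m + a) * Gamma (of_nat m + a)) * (rGamma (1 - a) * Gamma (1 - a))"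
      by (simp add: rGa)
    also have "\<dots> = (rGamma a * rGamma (1 - a)) * (Gamma (1 - a) * Gamma (of_nat m + a) / fact m)"
      using pochhammer_rGamma[of a m] by (simp add: bin_coeff_def add.commute mult_ac)
    also have "Gamma (1 - a) * Gamma (of_nat m + a) / fact m = Beta (1 - a) (of_nat m + a)"
      using Gamma_fact[of m, where 'a = complex] by (simp add: Beta_def add_ac)
    finally show "kernel_coeff s \<delta> r * bin_coeff (s - of_nat r) m = c * (LINT t|lborel. f r t)"
      unfolding v refl a_def [symmetric] by (simp add: mult_ac)
  qed
  have "(\<lambda>t. kernel_remainder s \<delta> R t * ?e t) = (\<lambda>t. f0 t - (\<Sum>r<R. f r t))"
    unfolding kernel_remainder_def f0_def f_def left_diff_distrib sum_distrib_right by (simp only: mult.assoc)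
  note eq = this
  have "(LINT t|lborel. kernel_remainder s \<delta> R t * ?e t) = (LINT t|lborel. f0 t) - (\<Sum>r<R. LINT t|lborel. f r t)"
  proof -
    have "integrable lborel (\<lambda>t. \<Sum>r<R. f r t)" by (intro Bochner_Integration.integrable_sum ir) simp
    then have "(LINT t|lborel. f0 t - (\<Sum>r<R. f r t)) = (LINT t|lborel. f0 t) - (LINT t|lborel. (\<Sum>r<R. f r t))"
      by (rule Bochner_Integration.integral_diff[OF i0])
    also have "(LINT t|lborel. (\<Sum>r<R. f r t)) = (\<Sum>r<R. LINT t|lborel. f r t)"
      by (intro Bochner_Integration.integral_sum ir) simp
    finally show ?thesis unfolding eq .
  qed
  then show ?thesis
    using 0 1 by (simp add: c_def [symmetric] right_diff_distrib sum_distrib_left)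
qed

section \<open>Expansion of shifted powers for every exponent\<close>

text \<open>Division by \<Gamma>(s) normalizes the expansion: its leading coefficient against
  \<open>bin_coeff s\<close> is 1.\<close>

definition shifted_pow :: "complex \<Rightarrow> real \<Rightarrow> nat \<Rightarrow> complex" where
  "shifted_pow s \<delta> m = rGamma s * of_real (real m + \<delta>) powr (s - 1)"

lemma shifted_pow_asymptotics_aux:
  assumes "R > 0" "Re s < 1"
  shows "poly_growth (Re s - 1 - real R) (\<lambda>m. shifted_pow s \<delta> m - (\<Sum>r<R. kernel_coeff s \<delta> r * bin_coeff (s - of_nat r) m))"
proof -
  obtain C A where CA: "C \<ge> 0" "\<And>t. t > 0 \<Longrightarrow> norm (kernel_remainder s \<delta> R t) \<le> C * (t powr (real R - Re s) * exp (A * t))"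
    using kernel_remainder_bound[OF assms, of \<delta>] by metis
  have 0: "kernel_remainder s \<delta> R t = 0" if "t \<le> 0" for t
    using that by (simp add: kernel_remainder_def tpow_def)
  have "poly_growth (Re s - 1 - real R) (\<lambda>m. sin (of_real pi * s) / of_real pi *
      (LINT t|lborel. kernel_remainder s \<delta> R t * complex_of_real (exp (- (real m * t)))))"
  proof -
    have "- (real R - Re s) - 1 = Re s - 1 - real R" by simp
    moreover have "poly_growth (- (real R - Re s) - 1) (\<lambda>m. sin (of_real pi * s) / of_real pi *
      (LINT t|lborel. kernel_remainder s \<delta> R t * complex_of_real (exp (- (real m * t)))))"
      using assms by (intro poly_growth_cmult poly_growth_Laplace[OF _ 0 CA(2,1)]) simp_all
    ultimately show ?thesis by (simp only:)
  qed
  moreover have "\<forall>\<^sub>F m in sequentially. real m + \<delta> > 0" "\<forall>\<^sub>F m in sequentially. real m > real R + \<bar>Re s\<bar>"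
    by real_asymp+
  then have "\<forall>\<^sub>F m in sequentially. sin (of_real pi * s) / of_real pi *
      (LINT t|lborel. kernel_remainder s \<delta> R t * complex_of_real (exp (- (real m * t)))) =
      shifted_pow s \<delta> m - (\<Sum>r<R. kernel_coeff s \<delta> r * bin_coeff (s - of_nat r) m)"
    unfolding shifted_pow_def by eventually_elim (rule kernel_remainder_Laplace[OF assms(2), symmetric])
  ultimately show ?thesis by (rule poly_growth_cong_eventually)
qed

text \<open>
  Multiplication of the expansion by \<open>m + \<delta>\<close>. The factor \<open>1 / \<Gamma>\<close> in \<open>shifted_pow\<close> makes this fail at
  \<open>s = 0\<close>, which is why \<open>s = 1\<close> needs a proof of its own.
\<close>
lemma shifted_pow_asymptotics_step:
  assumes R: "R > 0" and s: "s \<noteq> 0"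
    and IH: "poly_growth (Re s - 1 - real R) (\<lambda>m. shifted_pow s \<delta> m - (\<Sum>r<R. kernel_coeff s \<delta> r * bin_coeff (s - of_nat r) m))"
  shows "poly_growth (Re s - real R) (\<lambda>m. shifted_pow (s + 1) \<delta> m - (\<Sum>r<R. kernel_coeff (s + 1) \<delta> r * bin_coeff (s + 1 - of_nat r) m))"
proof -
  let ?e = "kernel_coeff s \<delta>" and ?e' = "kernel_coeff (s + 1) \<delta>"
  obtain Q where Q: "R = Suc Q" using R by (cases R) auto
  \<comment> \<open>The term of index R left over when the coefficients for s + 1 are assembled; it
    has the size of the remainder.\<close>
  define last where "last = (\<lambda>m. ?e Q * (of_real \<delta> - s + of_nat Q) * bin_coeff (s + 1 - of_nat R) m)"
  have sums: "(of_nat m + of_real \<delta>) * (\<Sum>r<R. ?e r * bin_coeff (s - of_nat r) m) =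
      s * (\<Sum>r<R. ?e' r * bin_coeff (s + 1 - of_nat r) m) + last m" for m
  proof -
    let ?B = "\<lambda>r. bin_coeff (s + 1 - of_nat r) m"
    \<comment> \<open>m + \<delta> is split as (m + s - r) + (\<delta> - s + r); the first part
      raises the parameter of \<open>bin_coeff\<close> by 1.\<close>
    have B: "(of_nat m + of_real \<delta>) * bin_coeff (s - of_nat r) m =
       (s - of_nat r) * ?B r + (of_real \<delta> - s + of_nat r) * ?B (Suc r)" for r
      using bin_coeff_plus1[of "s - of_nat r" m] by (simp add: algebra_simps)
    have "(of_nat m + of_real \<delta>) * (\<Sum>r<R. ?e r * bin_coeff (s - of_nat r) m) =
       (\<Sum>r<R. ?e r * ((of_nat m + of_real \<delta>) * bin_coeff (s - of_nat r) m))"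
      by (simp add: sum_distrib_left mult_ac)
    also have "\<dots> = (\<Sum>r<Suc Q. (s - of_nat r) * ?e r * ?B r) + (\<Sum>r<Suc Q. (of_real \<delta> - s + of_nat r) * ?e r * ?B (Suc r))"
      unfolding B Q by (simp add: distrib_left sum.distrib mult_ac)
    also have "(\<Sum>r<Suc Q. (s - of_nat r) * ?e r * ?B r) = s * ?B 0 + (\<Sum>r<Q. (s - of_nat (Suc r)) * ?e (Suc r) * ?B (Suc r))"
      by (subst sum.lessThan_Suc_shift) simp
    also have "(\<Sum>r<Suc Q. (of_real \<delta> - s + of_nat r) * ?e r * ?B (Suc r)) =
       (\<Sum>r<Q. (of_real \<delta> - s + of_nat r) * ?e r * ?B (Suc r)) + last m"
      by (simp add: last_def Q mult_ac)
    also have "s * ?B 0 + (\<Sum>r<Q. (s - of_nat (Suc r)) * ?e (Suc r) * ?B (Suc r)) +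
        ((\<Sum>r<Q. (of_real \<delta> - s + of_nat r) * ?e r * ?B (Suc r)) + last m) =
        s * ?B 0 + (\<Sum>r<Q. ((s - of_nat (Suc r)) * ?e (Suc r) + (of_real \<delta> - s + of_nat r) * ?e r) * ?B (Suc r)) + last m"
      by (simp add: sum.distrib distrib_right)
    also have "\<dots> = s * ?B 0 + (\<Sum>r<Q. s * ?e' (Suc r) * ?B (Suc r)) + last m"
      by (simp only: kernel_coeff_rec)
    also have "s * ?B 0 + (\<Sum>r<Q. s * ?e' (Suc r) * ?B (Suc r)) = s * (\<Sum>r<Suc Q. ?e' r * ?B r)"
      by (subst sum.lessThan_Suc_shift) (simp add: distrib_left sum_distrib_left mult_ac)
    finally show ?thesis by (simp add: Q)
  qed
  have pw: "\<forall>\<^sub>F m in sequentially. (of_nat m + of_real \<delta>) * shifted_pow s \<delta> m = s * shifted_pow (s + 1) \<delta> m"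
  proof -
    have "\<forall>\<^sub>F m in sequentially. real m + \<delta> > 0" by real_asymp
    then show ?thesis
    proof eventually_elim
      case (elim m)
      have "of_nat m + complex_of_real \<delta> = of_real (real m + \<delta>)" by simp
      moreover have "of_real (real m + \<delta>) * complex_of_real (real m + \<delta>) powr (s - 1) = of_real (real m + \<delta>) powr s"
        using elim by (simp add: powr_diff del: of_real_add)
      ultimately show ?case
        using rGamma_plus1[of s] by (simp add: shifted_pow_def mult_ac del: of_real_add)
    qed
  qed
  have "poly_growth (Re s - real R) (\<lambda>m. (of_nat m + of_real \<delta>) * (shifted_pow s \<delta> m - (\<Sum>r<R. ?e r * bin_coeff (s - of_nat r) m)))"
    using poly_growth_mult_linear[OF IH, of "of_real \<delta>"] by (simp add: algebra_simps)
  moreover have "poly_growth (Re s - real R) last"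
    unfolding last_def using poly_growth_bin_coeff[of "s + 1 - of_nat R"] by (intro poly_growth_cmult) simp
  ultimately have "poly_growth (Re s - real R) (\<lambda>m. (of_nat m + of_real \<delta>) *
      (shifted_pow s \<delta> m - (\<Sum>r<R. ?e r * bin_coeff (s - of_nat r) m)) + last m)"
    by (rule poly_growth_add)
  then have "poly_growth (Re s - real R) (\<lambda>m. s * (shifted_pow (s + 1) \<delta> m - (\<Sum>r<R. ?e' r * bin_coeff (s + 1 - of_nat r) m)))"
    by (rule poly_growth_cong_eventually)
       (use pw in \<open>auto elim!: eventually_mono simp: right_diff_distrib sums\<close>)
  from poly_growth_cmult[OF this, of "inverse s"] show ?thesis
    using s by (simp flip: mult.assoc)
qed

text \<open>The sequence is eventually 1 = \<open>bin_coeff 1 m\<close>, and the terms with r \<ge>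
  1 are coefficients of the polynomials (1 - z)^(r - 1), which vanish for m \<ge> R. The remainder
  is eventually 0, so \<sigma> is arbitrary.\<close>

lemma shifted_pow_asymptotics_1:
  assumes "R > 0"
  shows "poly_growth \<sigma> (\<lambda>m. shifted_pow 1 \<delta> m - (\<Sum>r<R. kernel_coeff 1 \<delta> r * bin_coeff (1 - of_nat r) m))"
proof (rule poly_growth_cong_eventually[OF poly_growth_zero])
  have "\<forall>\<^sub>F m in sequentially. real m + \<delta> > 0" by real_asymp
  then show "\<forall>\<^sub>F m in sequentially. 0 = shifted_pow 1 \<delta> m - (\<Sum>r<R. kernel_coeff 1 \<delta> r * bin_coeff (1 - of_nat r) m)"
    using eventually_ge_at_top[of R]
  proof eventually_elim
    case (elim m)
    obtain Q where Q: "R = Suc Q" using assms by (cases R) auto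
    have "(\<Sum>r<Q. kernel_coeff 1 \<delta> (Suc r) * bin_coeff (1 - of_nat (Suc r)) m) = 0"
    proof (intro sum.neutral ballI)
      fix r assume "r \<in> {..<Q}"
      then have "bin_coeff (- of_nat r) m = 0" using elim Q by (intro bin_coeff_nonpos_eq_0) simp
      then show "kernel_coeff 1 \<delta> (Suc r) * bin_coeff (1 - of_nat (Suc r)) m = 0" by simp
    qed
    then have "(\<Sum>r<R. kernel_coeff 1 \<delta> r * bin_coeff (1 - of_nat r) m) = 1"
      unfolding Q by (subst sum.lessThan_Suc_shift) simp
    moreover have "complex_of_real (real m + \<delta>) \<noteq> 0" using elim by (metis less_irrefl of_real_eq_0_iff)
    ultimately show ?case by (simp add: shifted_pow_def)
  qed
qed

text \<open>The Laplace integral covers Re s < 1, and the induction moves right by one unit at a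
  time. There is no step from 0 to 1, so s = 1 enters on its own.\<close>

theorem shifted_pow_asymptotics:
  assumes R: "R > 0"
  shows "poly_growth (Re s - 1 - real R) (\<lambda>m. shifted_pow s \<delta> m - (\<Sum>r<R. kernel_coeff s \<delta> r * bin_coeff (s - of_nat r) m))"
proof -
  have "Re s < real n + 1 \<Longrightarrow> ?thesis" for n
  proof (induction n arbitrary: s)
    case 0
    then show ?case using shifted_pow_asymptotics_aux[OF R] by simp
  next
    case (Suc n)
    show ?case
    proof (cases "s = 1")
      case True
      then show ?thesis using shifted_pow_asymptotics_1[OF R] by simp
    next
      case False
      have "poly_growth (Re (s - 1) - 1 - real R) (\<lambda>m. shifted_pow (s - 1) \<delta> m -
          (\<Sum>r<R. kernel_coeff (s - 1) \<delta> r * bin_coeff (s - 1 - of_nat r) m))"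
        using Suc.prems by (intro Suc.IH) simp
      from shifted_pow_asymptotics_step[OF R _ this] False show ?thesis by simp
    qed
  qed
  moreover obtain n where "Re s < real n" using reals_Archimedean2 by blast
  then have "Re s < real n + 1" by simp
  ultimately show ?thesis by blast
qed

section \<open>Darboux's method\<close>

text \<open>Meant for the closed disc \<open>K\<close> and the open disc \<open>S\<close>: boundary
  points are covered by neighbourhoods although the function is controlled only inside.\<close>

lemma locally_bounded_imp_bounded_on_compact:
  fixes g :: "'a :: metric_space \<Rightarrow> 'b :: real_normed_vector"
  assumes "compact K" and loc: "\<And>x. x \<in> K \<Longrightarrow> \<exists>B. \<forall>\<^sub>F z in nhds x. z \<in> S \<longrightarrow> norm (g z) \<le> B"
  shows "\<exists>B. \<forall>z\<in>K \<inter> S. norm (g z) \<le> B"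
proof -
  have "\<exists>p. open (snd p) \<and> x \<in> snd p \<and> (\<forall>z\<in>snd p. z \<in> S \<longrightarrow> norm (g z) \<le> fst p)" if "x \<in> K" for x
    using loc[OF that] by (auto simp: eventually_nhds)
  then have "\<forall>x\<in>K. \<exists>p. open (snd p) \<and> x \<in> snd p \<and> (\<forall>z\<in>snd p. z \<in> S \<longrightarrow> norm (g z) \<le> fst p)" by blast
  from bchoice[OF this] obtain P where P: "\<forall>x\<in>K. open (snd (P x)) \<and> x \<in> snd (P x) \<and>
      (\<forall>z\<in>snd (P x). z \<in> S \<longrightarrow> norm (g z) \<le> fst (P x))" by blast
  define U B where "U = snd \<circ> P" and "B = fst \<circ> P"
  have BU: "open (U x)" "x \<in> U x" "\<And>z. z \<in> U x \<Longrightarrow> z \<in> S \<Longrightarrow> norm (g z) \<le> B x" if "x \<in> K" for x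
    using P that by (auto simp: U_def B_def)
  have cover: "K \<subseteq> (\<Union>x\<in>K. U x)" using BU(2) by blast
  obtain D where D: "D \<subseteq> K" "finite D" "K \<subseteq> (\<Union>x\<in>D. U x)"
    by (rule compactE_image[OF assms(1) BU(1) cover])
  have "norm (g z) \<le> (\<Sum>x\<in>D. \<bar>B x\<bar>)" if z: "z \<in> K \<inter> S" for z
  proof -
    obtain x where x: "x \<in> D" "z \<in> U x" using D(3) z by blast
    then have "norm (g z) \<le> B x" using BU(3)[of x z] D(1) z by blast
    also have "\<dots> \<le> \<bar>B x\<bar>" by simp
    also have "\<dots> \<le> (\<Sum>x\<in>D. \<bar>B x\<bar>)" using x(1) D(2) by (intro member_le_sum) auto
    finally show ?thesis .
  qed
  then show ?thesis by blast
qed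

text \<open>Cauchy's estimate on circles of radius r, with r tending to 1, bounds all Taylor
  coefficients of the M-th derivative by B. Coefficient n + M of \<open>D\<close> carries in
  addition the factor n! / (n + M)!, of order n^(-M).\<close>

lemma poly_growth_if_higher_deriv_bounded:
  assumes holo: "D holomorphic_on ball 0 1" and B: "\<And>z. z \<in> ball 0 1 \<Longrightarrow> norm ((deriv ^^ M) D z) \<le> B"
  shows "poly_growth (- real M) (\<lambda>n. (deriv ^^ n) D 0 / fact n)"
proof -
  let ?g = "(deriv ^^ M) D"
  have g: "?g holomorphic_on ball 0 1" by (intro holomorphic_higher_deriv holo) auto
  have B0: "B \<ge> 0" using B[of 0] norm_ge_zero[of "?g 0"] by (simp del: norm_ge_zero)
  have cauchy: "norm ((deriv ^^ n) ?g 0) \<le> fact n * B" for n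
  proof -
    have "norm ((deriv ^^ n) ?g 0) \<le> fact n * B / r ^ n" if "0 < r" "r < 1" for r
    proof (rule Cauchy_inequality)
      have "?g holomorphic_on cball 0 r" using g that by (auto intro: holomorphic_on_subset)
      then show "continuous_on (cball 0 r) ?g" "?g holomorphic_on ball 0 r"
        by (auto intro: holomorphic_on_imp_continuous_on holomorphic_on_subset)
    qed (use that B in auto)
    then have "\<forall>\<^sub>F r in at_left (1::real). norm ((deriv ^^ n) ?g 0) \<le> fact n * B / r ^ n"
      by (intro eventually_at_leftI[of 0]) auto
    moreover have "((\<lambda>r::real. fact n * B / r ^ n) \<longlongrightarrow> fact n * B / 1 ^ n) (at_left 1)"
      by (intro tendsto_intros) auto
    ultimately have "norm ((deriv ^^ n) ?g 0) \<le> fact n * B / 1 ^ n"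
      by (intro tendsto_le[OF _ _ tendsto_const]) (auto simp: trivial_limit_at_left_real)
    then show ?thesis by simp
  qed
  have fact_ge: "fact n * real (Suc n) ^ k \<le> fact (n + k)" for n k
  proof (induction k)
    case (Suc k)
    have "fact n * real (Suc n) ^ Suc k = real (Suc n) * (fact n * real (Suc n) ^ k)" by simp
    also have "\<dots> \<le> real (Suc (n + k)) * fact (n + k)" by (intro mult_mono Suc) auto
    finally show ?case by simp
  qed simp
  have "norm ((deriv ^^ k) D 0 / fact k) \<le> (B * real (Suc M) ^ M) * real (Suc k) powr (- real M)" if k: "k \<ge> M" for k
  proof -
    define n where "n = k - M"
    have kn: "k = n + M" using k by (simp add: n_def)
    have "norm ((deriv ^^ k) D 0) \<le> fact n * B"
      using cauchy[of n] by (simp add: kn funpow_add)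
    also have "fact n \<le> fact k / real (Suc n) ^ M"
      using fact_ge[of n M] by (simp add: kn field_simps)
    finally have "norm ((deriv ^^ k) D 0 / fact k) \<le> B / real (Suc n) ^ M"
      using B0 by (simp add: norm_divide field_simps mult_right_mono)
    also have "\<dots> \<le> B * (real (Suc M) ^ M / real (Suc k) ^ M)"
    proof -
      \<comment> \<open>The right-hand side is n + M + 1 + M n; it is the source of the constant (M
        + 1)^M.\<close>
      have "real (Suc k) \<le> real (Suc M) * real (Suc n)" by (simp add: kn algebra_simps)
      then have "real (Suc k) ^ M \<le> (real (Suc M) * real (Suc n)) ^ M" by (intro power_mono) auto
      then have "1 / real (Suc n) ^ M \<le> real (Suc M) ^ M / real (Suc k) ^ M"
        by (simp add: field_simps power_mult_distrib del: of_nat_Suc)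
      then show ?thesis using mult_left_mono[OF _ B0] by fastforce
    qed
    also have "\<dots> = (B * real (Suc M) ^ M) * real (Suc k) powr (- real M)"
      by (simp add: powr_minus powr_realpow field_simps del: of_nat_Suc)
    finally show ?thesis .
  qed
  then show ?thesis
    by (intro poly_growth_eventuallyI[of _ "B * real (Suc M) ^ M"] eventually_sequentiallyI[of M])
qed

text \<open>In the closed disc z / \<zeta> can be real and \<ge> 1 only at \<zeta>. So principal
  powers of 1 - z / \<zeta> are analytic up to the boundary except at \<zeta>.\<close>

lemma one_minus_divide_notin_nonpos_Reals:
  fixes z \<zeta> :: complex
  assumes "norm \<zeta> = 1" "norm z \<le> 1" "z \<noteq> \<zeta>"
  shows "1 - z / \<zeta> \<notin> \<real>\<^sub>\<le>\<^sub>0"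
proof
  assume "1 - z / \<zeta> \<in> \<real>\<^sub>\<le>\<^sub>0"
  then have re: "Re (z / \<zeta>) \<ge> 1" and im: "Im (z / \<zeta>) = 0" by (auto simp: complex_nonpos_Reals_iff)
  have "norm (z / \<zeta>) \<le> 1" using assms by (simp add: norm_divide)
  then have "Re (z / \<zeta>) = 1" using re complex_Re_le_cmod[of "z / \<zeta>"] by linarith
  then have "z / \<zeta> = 1" using im by (simp add: complex_eq_iff)
  then show False using assms by auto
qed

text \<open>For a complex exponent the argument of w contributes exp (- Im c arg w), bounded because
  the principal argument is at most \<pi> in modulus.\<close>

lemma norm_powr_complex_le:
  assumes "norm w \<le> 2" "Re c \<ge> 0"
  shows "norm (w powr c) \<le> 2 powr Re c * exp (\<bar>Im c\<bar> * pi)"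
proof (cases "w = 0")
  case False
  have "norm (w powr c) = exp (Re c * ln (norm w) - Im c * Im (Ln w))"
    using False by (simp add: powr_def)
  also have "\<dots> \<le> exp (Re c * ln 2 + \<bar>Im c\<bar> * pi)"
  proof -
    have "Re c * ln (norm w) \<le> Re c * ln 2" using assms False by (intro mult_left_mono) auto
    moreover have "- Im c * Im (Ln w) \<le> \<bar>Im c\<bar> * pi"
    proof -
      have "\<bar>Im (Ln w)\<bar> \<le> pi" using mpi_less_Im_Ln[OF False] Im_Ln_le_pi[OF False] by simp
      then have "\<bar>Im c * Im (Ln w)\<bar> \<le> \<bar>Im c\<bar> * pi" unfolding abs_mult by (intro mult_left_mono) auto
      then show ?thesis by simp
    qed
    ultimately show ?thesis by simp
  qed
  also have "\<dots> = 2 powr Re c * exp (\<bar>Im c\<bar> * pi)" by (simp add: powr_def exp_add)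
  finally show ?thesis .
qed auto

text \<open>Each derivative lowers the exponent by 1 and leaves a factor analytic at \<zeta>, so
  after M of them the exponent still has nonnegative real part. The bound concerns only the open
  disc, where the principal branch has no cut.\<close>

lemma higher_deriv_singular_bounded:
  assumes \<zeta>: "norm \<zeta> = 1" and "Re c \<ge> real M" "q analytic_on {\<zeta>}"
  shows "\<exists>B. \<forall>\<^sub>F z in nhds \<zeta>. z \<in> ball 0 1 \<longrightarrow> norm ((deriv ^^ M) (\<lambda>z. (1 - z / \<zeta>) powr c * q z) z) \<le> B"
  using assms(2,3)
proof (induction M arbitrary: c q)
  case 0
  define K where "K = 2 powr Re c * exp (\<bar>Im c\<bar> * pi)"
  have "\<forall>\<^sub>F z in nhds \<zeta>. z \<in> ball 0 1 \<longrightarrow> norm ((1 - z / \<zeta>) powr c * q z) \<le> K * (norm (q \<zeta>) + 1)"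
    using analytic_at_imp_bounded_near[OF 0(2)]
  proof eventually_elim
    case (elim z)
    have "norm (1 - z / \<zeta>) \<le> 2" if "z \<in> ball 0 1"
      using that \<zeta> norm_triangle_ineq4[of 1 "z / \<zeta>"] by (simp add: norm_divide)
    then have "norm ((1 - z / \<zeta>) powr c) \<le> K" if "z \<in> ball 0 1"
      unfolding K_def using that 0(1) by (intro norm_powr_complex_le) auto
    then show ?case unfolding norm_mult using elim by (auto intro!: mult_mono simp: K_def)
  qed
  then show ?case by auto
next
  case (Suc M)
  define q2 where "q2 = (\<lambda>z. - (c / \<zeta>) * q z + (1 - z / \<zeta>) * deriv q z)"
  have z0: "\<zeta> \<noteq> 0" using \<zeta> by auto
  have "q2 analytic_on {\<zeta>}"
    unfolding q2_def using Suc.prems(2) z0 by (intro analytic_intros) auto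
  moreover have "Re (c - 1) \<ge> real M" using Suc.prems(1) by simp
  ultimately obtain B where B: "\<forall>\<^sub>F z in nhds \<zeta>. z \<in> ball 0 1 \<longrightarrow>
      norm ((deriv ^^ M) (\<lambda>z. (1 - z / \<zeta>) powr (c - 1) * q2 z) z) \<le> B"
    using Suc.IH by blast
  obtain S where S: "open S" "\<zeta> \<in> S" "q holomorphic_on S"
    using Suc.prems(2) by (auto simp: analytic_at)
  let ?W = "S \<inter> ball 0 1"
  let ?f = "\<lambda>z. (1 - z / \<zeta>) powr c * q z" and ?f' = "\<lambda>z. (1 - z / \<zeta>) powr (c - 1) * q2 z"
  have W: "open ?W" using S by auto
  have np: "1 - z / \<zeta> \<notin> \<real>\<^sub>\<le>\<^sub>0" if "z \<in> ball 0 1" for z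
    using that \<zeta> by (intro one_minus_divide_notin_nonpos_Reals) auto
  have qW: "q holomorphic_on ?W" using S by (auto intro: holomorphic_on_subset)
  have fW: "?f holomorphic_on ?W"
    using qW np z0 by (intro holomorphic_intros) auto
  have f'W: "?f' holomorphic_on ?W"
    unfolding q2_def using qW np z0 W by (intro holomorphic_intros) auto
  have "deriv ?f z = ?f' z" if z: "z \<in> ?W" for z
  proof (rule DERIV_imp_deriv)
    have "(q has_field_derivative deriv q z) (at z)" using qW W z by (rule holomorphic_derivI)
    then have "(?f has_field_derivative (c * (1 - z / \<zeta>) powr (c - 1) * (- 1 / \<zeta>)) * q z + (1 - z / \<zeta>) powr c * deriv q z) (at z)"
      using np[of z] z z0 by (auto intro!: derivative_eq_intros)
    also have "(1 - z / \<zeta>) powr c = (1 - z / \<zeta>) powr (c - 1) * (1 - z / \<zeta>)"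
      using np[of z] z by (auto simp: powr_diff)
    also have "(c * (1 - z / \<zeta>) powr (c - 1) * (- 1 / \<zeta>)) * q z + (1 - z / \<zeta>) powr (c - 1) * (1 - z / \<zeta>) * deriv q z = ?f' z"
      by (simp add: q2_def ring_distribs mult_ac)
    finally show "(?f has_field_derivative ?f' z) (at z)" .
  qed
  then have eq: "(deriv ^^ M) (deriv ?f) z = (deriv ^^ M) ?f' z" if "z \<in> ?W" for z
    using that by (intro higher_deriv_transform_within_open[of _ ?W] holomorphic_deriv fW f'W W) auto
  have "\<forall>\<^sub>F z in nhds \<zeta>. z \<in> S" using S by (intro eventually_nhds_in_open)
  with B have "\<forall>\<^sub>F z in nhds \<zeta>. z \<in> ball 0 1 \<longrightarrow> norm ((deriv ^^ Suc M) ?f z) \<le> B"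
  proof eventually_elim
    case (elim z)
    then show ?case using eq[of z] by (auto simp: funpow_Suc_right simp del: funpow.simps)
  qed
  then show ?case by blast
qed

section \<open>Power singularities on the unit circle\<close>

text \<open>The base 1 - z / \<xi> j, instead of z - \<xi> j, lets the principal power serve as an
  analytic branch on the whole disc.\<close>

definition singular_product :: "(complex \<Rightarrow> complex) \<Rightarrow> (nat \<Rightarrow> complex) \<Rightarrow> (nat \<Rightarrow> complex) \<Rightarrow> nat set \<Rightarrow> complex \<Rightarrow> complex" where
  "singular_product \<nu> \<xi> a J z = \<nu> z * (\<Prod>j\<in>J. (1 - z / \<xi> j) powr (- a j))"

text \<open>The local variable at \<open>\<xi> j\<close> is y = 1 - z / \<xi> j, which for
  \<open>\<xi> j = 1\<close> is the variable of the power kernel.\<close>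

definition singular_coeff :: "(complex \<Rightarrow> complex) \<Rightarrow> (nat \<Rightarrow> complex) \<Rightarrow> (nat \<Rightarrow> complex) \<Rightarrow> nat set \<Rightarrow> nat \<Rightarrow> nat \<Rightarrow> complex" where
  "singular_coeff \<nu> \<xi> a J j r = fps_nth (fps_expansion (\<lambda>y. singular_product \<nu> \<xi> a (J - {j}) (\<xi> j * (1 - y))) 0) r"

lemma singular_factor_analytic:
  assumes "norm \<zeta> = 1" "norm z \<le> 1" "z \<noteq> \<zeta>"
  shows "(\<lambda>z. (1 - z / \<zeta>) powr c) analytic_on {z}"
  using one_minus_divide_notin_nonpos_Reals[OF assms] assms
  by (intro analytic_intros) auto

lemma singular_product_analytic:
  assumes "\<nu> analytic_on cball 0 1" "\<And>j. j \<in> J \<Longrightarrow> norm (\<xi> j) = 1" "norm z \<le> 1" "\<And>j. j \<in> J \<Longrightarrow> z \<noteq> \<xi> j"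
  shows "singular_product \<nu> \<xi> a J analytic_on {z}"
  unfolding singular_product_def
proof (intro analytic_on_mult analytic_on_prod)
  show "\<nu> analytic_on {z}" using assms by (auto intro: analytic_on_subset)
qed (use assms in \<open>auto intro: singular_factor_analytic\<close>)

lemma singular_factor_expansion:
  assumes "norm \<zeta> = 1"
  shows "(\<lambda>z. (1 - z / \<zeta>) powr (- c)) has_fps_expansion Abs_fps (\<lambda>n. bin_coeff c n / \<zeta> ^ n)"
proof (rule has_fps_expansionI)
  have "\<forall>\<^sub>F z in nhds (0::complex). z \<in> ball 0 1" by (intro eventually_nhds_in_open) auto
  then show "\<forall>\<^sub>F z in nhds 0. (\<lambda>n. fps_nth (Abs_fps (\<lambda>n. bin_coeff c n / \<zeta> ^ n)) n * z ^ n) sums (1 - z / \<zeta>) powr (- c)"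
  proof eventually_elim
    case (elim z)
    then have "(\<lambda>n. bin_coeff c n * (z / \<zeta>) ^ n) sums (1 - z / \<zeta>) powr (- c)"
      using assms by (intro bin_coeff_sums) (simp add: norm_divide)
    then show ?case by (simp add: power_divide)
  qed
qed

text \<open>
  Darboux's method: after subtraction of the Taylor expansions at the singularities the function has a
  bounded \<open>M\<close>-th derivative on the disc.
\<close>
theorem singular_product_coeff_asymptotics:
  assumes \<nu>: "\<nu> analytic_on cball 0 1" and \<xi>: "\<And>j. j \<in> J \<Longrightarrow> norm (\<xi> j) = 1" and inj: "inj_on \<xi> J"
    and fin: "finite J" and X: "singular_product \<nu> \<xi> a J has_fps_expansion X"
    and M: "\<And>j. j \<in> J \<Longrightarrow> real M \<le> real R - Re (a j)"
  shows "poly_growth (- real M) (\<lambda>n. fps_nth X n - (\<Sum>j\<in>J. \<Sum>r<R. singular_coeff \<nu> \<xi> a J j r * (bin_coeff (a j - of_nat r) n / \<xi> j ^ n)))"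
proof -
  let ?F = "singular_product \<nu> \<xi> a J"
  let ?s = "\<lambda>j c z. (1 - z / \<xi> j) powr (- c)"
  define T where "T = (\<lambda>j z. \<Sum>r<R. singular_coeff \<nu> \<xi> a J j r * ?s j (a j - of_nat r) z)"
  define D where "D = (\<lambda>z. ?F z - (\<Sum>j\<in>J. T j z))"
  have T_an: "T j analytic_on {z}" if "j \<in> J" "norm z \<le> 1" "z \<noteq> \<xi> j" for j z
    unfolding T_def using that \<xi> by (intro analytic_intros singular_factor_analytic) auto
  have D_an: "D analytic_on {z}" if "norm z \<le> 1" "\<And>j. j \<in> J \<Longrightarrow> z \<noteq> \<xi> j" for z
    unfolding D_def using that \<xi> by (intro analytic_intros singular_product_analytic[OF \<nu>] T_an) auto
  have "D analytic_on ball 0 1"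
    using D_an \<xi> by (subst analytic_on_analytic_at) (metis less_irrefl less_imp_le mem_ball_0)
  then have D_holo: "D holomorphic_on ball 0 1" by (rule analytic_imp_holomorphic)
  have local: "\<exists>B. \<forall>\<^sub>F z in nhds x. z \<in> ball 0 1 \<longrightarrow> norm ((deriv ^^ M) D z) \<le> B" if x: "x \<in> cball 0 1" for x
  proof (cases "x \<in> \<xi> ` J")
    case False
    then have "(deriv ^^ M) D analytic_on {x}"
      using x by (intro analytic_higher_deriv D_an) auto
    from analytic_at_imp_bounded_near[OF this] show ?thesis by (auto elim!: eventually_mono)
  next
    case True
    then obtain j where j: "j \<in> J" "x = \<xi> j" by blast
    have x1: "norm x = 1" using j \<xi> by simp
    then have x0: "x \<noteq> 0" by auto
    have other: "x \<noteq> \<xi> i" if "i \<in> J - {j}" for i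
      using that j inj by (auto dest: inj_onD)
    define h where "h = singular_product \<nu> \<xi> a (J - {j})"
    have F: "?F z = ?s j (a j) z * h z" for z
      using fin j(1) by (simp add: singular_product_def h_def prod.remove mult_ac)
    have h: "h analytic_on {x}"
      unfolding h_def using other \<xi> x1 by (intro singular_product_analytic[OF \<nu>]) auto
    have "(\<lambda>y. h (x * (1 - y))) analytic_on {0}"
    proof -
      have "(\<lambda>y. x * (1 - y)) analytic_on {0}" by (intro analytic_intros)
      from analytic_on_compose[OF this, of h] h show ?thesis by (simp add: o_def)
    qed
    then have "(\<lambda>y. h (x * (1 - y))) has_fps_expansion fps_expansion (\<lambda>y. h (x * (1 - y))) 0"
      by (rule analytic_at_imp_has_fps_expansion_0)
    then obtain Q where Q: "Q analytic_on {0}"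
      "\<forall>\<^sub>F y in nhds 0. h (x * (1 - y)) = (\<Sum>r<R. singular_coeff \<nu> \<xi> a J j r * y ^ r) + y ^ R * Q y"
      using has_fps_expansion_Taylor_remainder[of _ _ R] unfolding singular_coeff_def h_def j(2) by blast
    define q where "q = (\<lambda>z. Q (1 - z / x))"
    have q: "q analytic_on {x}"
    proof -
      have "(\<lambda>z. 1 - z / x) analytic_on {x}" using x0 by (intro analytic_intros) auto
      from analytic_on_compose[OF this, of Q] Q(1) x0 show ?thesis by (simp add: o_def q_def)
    qed
    have "((\<lambda>z. 1 - z / x) \<longlongrightarrow> 1 - x / x) (nhds x)"
      using x0 by (intro tendsto_intros) (auto simp: filterlim_ident)
    then have lim: "filterlim (\<lambda>z. 1 - z / x) (nhds 0) (nhds x)" using x0 by simp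
    have hq: "\<forall>\<^sub>F z in nhds x. h z = (\<Sum>r<R. singular_coeff \<nu> \<xi> a J j r * (1 - z / x) ^ r) + (1 - z / x) ^ R * q z"
      using eventually_compose_filterlim[OF Q(2) lim] x0 by (simp add: q_def)
    \<comment> \<open>What remains of the singularity at x after R Taylor terms are subtracted; by
      \<open>M\<close> the exponent has real part at least M.\<close>
    let ?G = "\<lambda>z. (1 - z / x) powr (of_nat R - a j) * q z"
    \<comment> \<open>The terms subtracted for the other singularities, which are analytic at
      x.\<close>
    let ?E = "\<lambda>z. - (\<Sum>i\<in>J - {j}. T i z)"
    have E: "?E analytic_on {x}"
      using other x1 \<xi> by (intro analytic_intros T_an) auto
    obtain B1 where B1: "\<forall>\<^sub>F z in nhds x. z \<in> ball 0 1 \<longrightarrow> norm ((deriv ^^ M) ?G z) \<le> B1"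
      using higher_deriv_singular_bounded[OF x1 _ q, of M "of_nat R - a j"] M[OF j(1)] by auto
    have B2: "\<forall>\<^sub>F z in nhds x. norm ((deriv ^^ M) ?E z) \<le> norm ((deriv ^^ M) ?E x) + 1"
      by (intro analytic_at_imp_bounded_near analytic_higher_deriv E)
    obtain S1 where S1: "open S1" "x \<in> S1" "?E holomorphic_on S1"
      using E by (auto simp: analytic_at)
    obtain S2 where S2: "open S2" "x \<in> S2" "q holomorphic_on S2"
      using q by (auto simp: analytic_at)
    obtain S3 where S3: "open S3" "x \<in> S3"
      "\<And>z. z \<in> S3 \<Longrightarrow> h z = (\<Sum>r<R. singular_coeff \<nu> \<xi> a J j r * (1 - z / x) ^ r) + (1 - z / x) ^ R * q z"
      using hq by (auto simp: eventually_nhds)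
    define W where "W = S1 \<inter> S2 \<inter> S3 \<inter> ball 0 1"
    have W: "open W" using S1 S2 S3 by (auto simp: W_def)
    have np: "1 - z / x \<notin> \<real>\<^sub>\<le>\<^sub>0" if "z \<in> ball 0 1" for z
      using that x1 by (intro one_minus_divide_notin_nonpos_Reals) auto
    have qW: "q holomorphic_on W" and EW: "?E holomorphic_on W" and DW: "D holomorphic_on W"
      using S1(3) S2(3) D_holo by (auto intro: holomorphic_on_subset simp: W_def)
    have GW: "?G holomorphic_on W"
      using qW np x0 by (intro holomorphic_intros) (auto simp: W_def)
    have "D z = ?G z + ?E z" if z: "z \<in> W" for z
    proof -
      have y: "1 - z / x \<noteq> 0" using np[of z] z by (auto simp: W_def)
      have pw: "?s j (a j - of_nat r) z = ?s j (a j) z * (1 - z / x) ^ r" for r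
      proof -
        have "- (a j - of_nat r) = - a j + of_nat r" by simp
        then show ?thesis using y by (simp only: powr_add j(2)[symmetric]) (simp add: powr_nat)
      qed
      have G: "?G z = ?s j (a j) z * ((1 - z / x) ^ R * q z)"
      proof -
        have "of_nat R - a j = - a j + of_nat R" by simp
        then have "(1 - z / x) powr (of_nat R - a j) = ?s j (a j) z * (1 - z / x) ^ R"
          using y by (simp only: powr_add j(2)[symmetric]) (simp add: powr_nat)
        then show ?thesis by simp
      qed
      have "?F z = ?G z + T j z"
        unfolding F T_def G pw using z S3(3)[of z] by (simp add: W_def distrib_left sum_distrib_left mult_ac)
      then show ?thesis
        using fin j(1) by (simp add: D_def sum.remove)
    qed
    then have "(deriv ^^ M) D z = (deriv ^^ M) (\<lambda>z. ?G z + ?E z) z" if "z \<in> W" for z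
      using that by (intro higher_deriv_transform_within_open[OF DW _ W] holomorphic_intros GW EW) auto
    then have deq: "(deriv ^^ M) D z = (deriv ^^ M) ?G z + (deriv ^^ M) ?E z" if "z \<in> W" for z
      using that higher_deriv_add[OF GW EW W that] by simp
    have "\<forall>\<^sub>F z in nhds x. z \<in> S1 \<inter> S2 \<inter> S3"
      using S1 S2 S3 by (intro eventually_nhds_in_open) auto
    with B1 B2 have "\<forall>\<^sub>F z in nhds x. z \<in> ball 0 1 \<longrightarrow> norm ((deriv ^^ M) D z) \<le> B1 + (norm ((deriv ^^ M) ?E x) + 1)"
    proof eventually_elim
      case (elim z)
      show ?case
      proof
        assume z: "z \<in> ball 0 1"
        then have "z \<in> W" using elim by (simp add: W_def)
        have "norm ((deriv ^^ M) ?G z) \<le> B1" using elim(1) z by blast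
        from norm_triangle_mono[OF this elim(2)]
        show "norm ((deriv ^^ M) D z) \<le> B1 + (norm ((deriv ^^ M) ?E x) + 1)"
          unfolding deq[OF \<open>z \<in> W\<close>] .
      qed
    qed
    then show ?thesis by blast
  qed
  obtain B where B: "\<And>z. z \<in> cball 0 1 \<inter> ball 0 1 \<Longrightarrow> norm ((deriv ^^ M) D z) \<le> B"
    using locally_bounded_imp_bounded_on_compact[OF compact_cball local] by blast
  have "poly_growth (- real M) (\<lambda>n. (deriv ^^ n) D 0 / fact n)"
    using B by (intro poly_growth_if_higher_deriv_bounded[OF D_holo, of M B]) auto
  moreover have "D has_fps_expansion X - (\<Sum>j\<in>J. \<Sum>r<R. fps_const (singular_coeff \<nu> \<xi> a J j r) * Abs_fps (\<lambda>n. bin_coeff (a j - of_nat r) n / \<xi> j ^ n))"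
    unfolding D_def T_def by (intro fps_expansion_intros X singular_factor_expansion \<xi>)
  from fps_nth_fps_expansion[OF this] have "(\<lambda>n. (deriv ^^ n) D 0 / fact n) =
     (\<lambda>n. fps_nth X n - (\<Sum>j\<in>J. \<Sum>r<R. singular_coeff \<nu> \<xi> a J j r * (bin_coeff (a j - of_nat r) n / \<xi> j ^ n)))"
    by (simp add: fun_eq_iff fps_sum_nth)
  ultimately show ?thesis by simp
qed

lemma bin_coeff_expansion: "(\<lambda>z. (1 - z) powr (- c)) has_fps_expansion Abs_fps (bin_coeff c)"
  using singular_factor_expansion[of 1 c] by simp

text \<open>The difference \<open>D\<close> of the two logarithms satisfies exp D = -\<zeta>, so its
  derivative is 0 and it is constant on the convex disc. Its value depends on the branch and goes
  into c.\<close>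

lemma log_branch_powr:
  assumes L: "L holomorphic_on ball 0 1" "\<And>z. z \<in> ball 0 1 \<Longrightarrow> exp (L z) = z - \<zeta>" and \<zeta>: "norm \<zeta> = 1"
  shows "\<exists>c. \<forall>z\<in>ball 0 1. exp (- a * L z) = c * (1 - z / \<zeta>) powr (- a)"
proof -
  define D where "D = (\<lambda>z. L z - Ln (1 - z / \<zeta>))"
  have np: "1 - z / \<zeta> \<notin> \<real>\<^sub>\<le>\<^sub>0" if "z \<in> ball 0 1" for z
    using that \<zeta> by (intro one_minus_divide_notin_nonpos_Reals) auto
  have \<zeta>0: "\<zeta> \<noteq> 0" using \<zeta> by auto
  have D: "D holomorphic_on ball 0 1"
    unfolding D_def using L(1) np \<zeta>0 by (intro holomorphic_intros) auto
  have expD: "exp (D z) = - \<zeta>" if z: "z \<in> ball 0 1" for z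
  proof -
    have "1 - z / \<zeta> \<noteq> 0" "z - \<zeta> = - \<zeta> * (1 - z / \<zeta>)" using np[OF z] \<zeta>0 by (auto simp: field_simps)
    then show ?thesis using L(2)[OF z] by (simp add: D_def exp_diff)
  qed
  have "(D has_field_derivative 0) (at z within ball 0 1)" if z: "z \<in> ball 0 1" for z
  proof -
    have d: "(D has_field_derivative deriv D z) (at z)"
      using D z by (auto intro: holomorphic_derivI)
    have "((\<lambda>z. exp (D z)) has_field_derivative exp (D z) * deriv D z) (at z)"
      by (rule DERIV_fun_exp[OF d])
    moreover have "((\<lambda>z. exp (D z)) has_field_derivative 0) (at z)"
      by (rule DERIV_cong_ev[THEN iffD2, OF refl _ refl DERIV_const[of "- \<zeta>"]])
         (use eventually_nhds_in_open[of "ball 0 1" z] z expD in \<open>auto elim!: eventually_mono\<close>)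
    ultimately have "exp (D z) * deriv D z = 0" by (rule DERIV_unique)
    with d show ?thesis by (simp add: has_field_derivative_at_within)
  qed
  then obtain d where d: "\<And>z. z \<in> ball 0 1 \<Longrightarrow> D z = d"
    using has_field_derivative_zero_constant[of "ball 0 1" D] by (auto simp: convex_ball)
  have "exp (- a * L z) = exp (- a * d) * (1 - z / \<zeta>) powr (- a)" if z: "z \<in> ball 0 1" for z
  proof -
    have "L z = d + Ln (1 - z / \<zeta>)" using d[OF z] by (simp add: D_def algebra_simps)
    moreover have "1 - z / \<zeta> \<noteq> 0" using np[OF z] by auto
    ultimately show ?thesis by (simp add: powr_def distrib_left flip: exp_add)
  qed
  then show ?thesis by blast
qed

lemma singular_factorization_product:
  assumes "singular_factorization \<omega> \<alpha> l \<xi> a \<nu>"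
  obtains \<mu> where "\<mu> analytic_on cball 0 1" "\<And>z. z \<in> ball 0 1 \<Longrightarrow> \<omega> z = singular_product \<mu> \<xi> a {..l} z"
proof -
  from assms obtain L where L: "\<And>j. j \<le> l \<Longrightarrow> L j holomorphic_on ball 0 1"
    "\<And>j z. j \<le> l \<Longrightarrow> z \<in> ball 0 1 \<Longrightarrow> exp (L j z) = z - \<xi> j"
    "\<And>z. z \<in> ball 0 1 \<Longrightarrow> \<omega> z = \<nu> z * (\<Prod>j\<le>l. exp (- a j * L j z))"
    and \<xi>: "\<And>j. j \<le> l \<Longrightarrow> norm (\<xi> j) = 1" and \<nu>: "\<nu> analytic_on cball 0 1"
    unfolding singular_factorization_def by blast
  have "\<forall>j\<in>{..l}. \<exists>c. \<forall>z\<in>ball 0 1. exp (- a j * L j z) = c * (1 - z / \<xi> j) powr (- a j)"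
    using L \<xi> by (intro ballI log_branch_powr) auto
  from bchoice[OF this] obtain c where "\<forall>j\<in>{..l}. \<forall>z\<in>ball 0 1. exp (- a j * L j z) = c j * (1 - z / \<xi> j) powr (- a j)"
    by blast
  then have c: "exp (- a j * L j z) = c j * (1 - z / \<xi> j) powr (- a j)" if "j \<le> l" "z \<in> ball 0 1" for j z
    using that by blast
  show ?thesis
  proof
    show "(\<lambda>z. \<nu> z * (\<Prod>j\<le>l. c j)) analytic_on cball 0 1" by (intro analytic_intros \<nu>)
    show "\<omega> z = singular_product (\<lambda>z. \<nu> z * (\<Prod>j\<le>l. c j)) \<xi> a {..l} z" if z: "z \<in> ball 0 1" for z
    proof -
      have "(\<Prod>j\<le>l. exp (- a j * L j z)) = (\<Prod>j\<le>l. c j * (1 - z / \<xi> j) powr (- a j))"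
        using z by (intro prod.cong c) auto
      then show ?thesis unfolding L(3)[OF z] by (simp add: singular_product_def prod.distrib)
    qed
  qed
qed

section \<open>Step sizes\<close>

text \<open>Homogeneity survives at the node 0: both sides are 0 there unless \<beta> = 1, when the
  factor is c^0 = 1.\<close>

lemma pow_fun_divide:
  assumes "x \<ge> 0" "c > 0"
  shows "pow_fun \<beta> (x / c) = of_real c powr (1 - \<beta>) * pow_fun \<beta> x"
proof (cases "x = 0")
  case False
  then have "complex_of_real (x / c) powr (\<beta> - 1) = of_real x powr (\<beta> - 1) * of_real c powr (- (\<beta> - 1))"
    using assms by (simp add: powr_def Ln_of_real ln_div exp_add[symmetric] algebra_simps del: of_real_divide)
  then show ?thesis using False assms by (simp add: pow_fun_def mult.commute del: of_real_divide)
qed (use assms in \<open>simp add: pow_fun_def\<close>)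

lemma eventually_unit_fraction_grid:
  "(\<forall>\<^sub>F h in at 0 within {h. h > 0 \<and> 1 / h \<in> \<nat>}. P h) \<longleftrightarrow> (\<forall>\<^sub>F n in sequentially. P (1 / real n))"
proof
  assume ev: "\<forall>\<^sub>F h in at 0 within {h. h > 0 \<and> 1 / h \<in> \<nat>}. P h"
  have "filterlim (\<lambda>n. 1 / real n) (at 0 within {h. h > 0 \<and> 1 / h \<in> \<nat>}) sequentially"
    unfolding filterlim_at using lim_1_over_n eventually_gt_at_top[of 0]
    by (auto elim!: eventually_mono)
  then show "\<forall>\<^sub>F n in sequentially. P (1 / real n)"
    by (rule eventually_compose_filterlim[OF ev])
next
  assume "\<forall>\<^sub>F n in sequentially. P (1 / real n)"
  then obtain N where N: "\<And>n. n \<ge> N \<Longrightarrow> P (1 / real n)" by (auto simp: eventually_sequentially)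
  show "\<forall>\<^sub>F h in at 0 within {h. h > 0 \<and> 1 / h \<in> \<nat>}. P h"
    unfolding eventually_at
  proof (intro exI[of _ "1 / real (Suc N)"] conjI ballI impI)
    fix h :: real assume h: "h \<in> {h. h > 0 \<and> 1 / h \<in> \<nat>}" and d: "h \<noteq> 0 \<and> dist h 0 < 1 / real (Suc N)"
    then obtain n where n: "1 / h = real n" by (auto elim: Nats_cases)
    then have hn: "h = 1 / real n" by (metis divide_divide_eq_right div_by_1 mult_1)
    have "h < 1 / real (Suc N)" "h > 0" using h d by auto
    then have "real (Suc N) < 1 / h" by (simp add: field_simps)
    then have "n \<ge> N" unfolding n by simp
    then show "P h" using N hn by simp
  qed simp
qed

text \<open>A sum O(h^\<beta>) + O(h^p) amounts to one bound with the smaller exponent. Conversely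
  the whole error is assigned to the summand with that exponent, and the other summand is 0.\<close>

lemma scq_convergent_iff:
  "scq_convergent w \<alpha> \<theta> p \<longleftrightarrow> (\<forall>\<beta>. \<beta> \<notin> \<int>\<^sub>\<le>\<^sub>0 \<longrightarrow>
     (\<exists>C. \<forall>\<^sub>F n in sequentially. norm (scq_error_pow w \<alpha> \<theta> (1 / real n) \<beta> 1) \<le> C * real n powr (- min (Re \<beta>) (real p))))"
proof -
  let ?F = "at 0 within {h::real. h > 0 \<and> 1 / h \<in> \<nat>}"
  have key: "(\<exists>u v. u \<in> O[?F](\<lambda>h. complex_of_real h powr \<beta>) \<and> v \<in> O[?F](\<lambda>h. complex_of_real (h ^ p)) \<and> (\<forall>h. E h = u h + v h)) \<longleftrightarrow>
    (\<exists>C. \<forall>\<^sub>F n in sequentially. norm (E (1 / real n)) \<le> C * real n powr (- min (Re \<beta>) (real p)))"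
    for E :: "real \<Rightarrow> complex" and \<beta>
  proof -
    have npow: "norm (complex_of_real (1 / real n) powr \<beta>) = real n powr (- Re \<beta>)"
      "norm (complex_of_real ((1 / real n) ^ p)) = real n powr (- real p)" if "n > 0" for n
      using that by (simp_all add: norm_powr_real_powr powr_divide powr_minus powr_realpow norm_power norm_divide field_simps del: of_real_divide)
    have powr_le: "real n powr (- Re \<beta>) \<le> real n powr (- min (Re \<beta>) (real p))"
      "real n powr (- real p) \<le> real n powr (- min (Re \<beta>) (real p))" if "n > 0" for n
      using that by (intro powr_mono; simp)+
    show ?thesis
    proof
      assume "\<exists>u v. u \<in> O[?F](\<lambda>h. complex_of_real h powr \<beta>) \<and> v \<in> O[?F](\<lambda>h. complex_of_real (h ^ p)) \<and> (\<forall>h. E h = u h + v h)"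
      then obtain u v where "u \<in> O[?F](\<lambda>h. complex_of_real h powr \<beta>)" "v \<in> O[?F](\<lambda>h. complex_of_real (h ^ p))"
        and E: "\<And>h. E h = u h + v h" by blast
      then obtain c d where c: "c > 0" "\<forall>\<^sub>F h in ?F. norm (u h) \<le> c * norm (complex_of_real h powr \<beta>)"
        and d: "d > 0" "\<forall>\<^sub>F h in ?F. norm (v h) \<le> d * norm (complex_of_real (h ^ p))"
        by (elim landau_o.bigE)
      have "\<forall>\<^sub>F n in sequentially. norm (E (1 / real n)) \<le> (c + d) * real n powr (- min (Re \<beta>) (real p))"
        using c(2)[unfolded eventually_unit_fraction_grid] d(2)[unfolded eventually_unit_fraction_grid] eventually_gt_at_top[of 0]
      proof eventually_elim
        case (elim n)
        have "norm (E (1 / real n)) \<le> norm (u (1 / real n)) + norm (v (1 / real n))"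
          unfolding E by (rule norm_triangle_ineq)
        also have "\<dots> \<le> c * real n powr (- Re \<beta>) + d * real n powr (- real p)"
          using elim(1,2) unfolding npow[OF elim(3)] by simp
        also have "\<dots> \<le> c * real n powr (- min (Re \<beta>) (real p)) + d * real n powr (- min (Re \<beta>) (real p))"
          using c(1) d(1) powr_le[OF elim(3)] by (intro add_mono mult_left_mono) auto
        finally show ?case by (simp add: distrib_right)
      qed
      then show "\<exists>C. \<forall>\<^sub>F n in sequentially. norm (E (1 / real n)) \<le> C * real n powr (- min (Re \<beta>) (real p))" by blast
    next
      assume "\<exists>C. \<forall>\<^sub>F n in sequentially. norm (E (1 / real n)) \<le> C * real n powr (- min (Re \<beta>) (real p))"
      then obtain C where C: "\<forall>\<^sub>F n in sequentially. norm (E (1 / real n)) \<le> C * real n powr (- min (Re \<beta>) (real p))" by blast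
      show "\<exists>u v. u \<in> O[?F](\<lambda>h. complex_of_real h powr \<beta>) \<and> v \<in> O[?F](\<lambda>h. complex_of_real (h ^ p)) \<and> (\<forall>h. E h = u h + v h)"
      proof (cases "Re \<beta> < real p")
        case True
        have "\<forall>\<^sub>F n in sequentially. norm (E (1 / real n)) \<le> C * norm (complex_of_real (1 / real n) powr \<beta>)"
          using C eventually_gt_at_top[of 0]
          by eventually_elim (use True in \<open>simp only: npow min_absorb1[OF less_imp_le]\<close>)
        then have "\<forall>\<^sub>F h in ?F. norm (E h) \<le> C * norm (complex_of_real h powr \<beta>)"
          by (subst eventually_unit_fraction_grid)
        then have "E \<in> O[?F](\<lambda>h. complex_of_real h powr \<beta>)" by (rule bigoI)
        then show ?thesis by (intro exI[of _ E] exI[of _ "\<lambda>_. 0"]) simp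
      next
        case False
        then have min: "min (Re \<beta>) (real p) = real p" by simp
        have "\<forall>\<^sub>F n in sequentially. norm (E (1 / real n)) \<le> C * norm (complex_of_real ((1 / real n) ^ p))"
          using C eventually_gt_at_top[of 0] by eventually_elim (simp only: npow min)
        then have "\<forall>\<^sub>F h in ?F. norm (E h) \<le> C * norm (complex_of_real (h ^ p))"
          by (subst eventually_unit_fraction_grid)
        then have "E \<in> O[?F](\<lambda>h. complex_of_real (h ^ p))" by (rule bigoI)
        then show ?thesis by (intro exI[of _ "\<lambda>_. 0"] exI[of _ E]) simp
      qed
    qed
  qed
  show ?thesis unfolding scq_convergent_def key ..
qed

section \<open>Generating functions of quadratures\<close>

locale singular_generating_function =
  fixes w :: "nat \<Rightarrow> complex" and \<omega> \<nu> :: "complex \<Rightarrow> complex" and \<alpha> :: complex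
    and l :: nat and \<xi> a :: "nat \<Rightarrow> complex"
  assumes gen: "generating_function w \<omega>"
    and \<omega>: "\<And>z. z \<in> ball 0 1 \<Longrightarrow> \<omega> z = singular_product \<nu> \<xi> a {..l} z"
    and \<nu>: "\<nu> analytic_on cball 0 1"
    and \<xi>0: "\<xi> 0 = 1" and a0: "a 0 = \<alpha>" and inj: "inj_on \<xi> {..l}"
    and \<xi>: "\<And>j. j \<le> l \<Longrightarrow> norm (\<xi> j) = 1" and Re_a: "\<And>j. j \<le> l \<Longrightarrow> Re (a j) \<le> Re \<alpha>"
begin

text \<open>The cofactor of (1 - z)^(-\<alpha>) in \<omega>, in the variable y = 1 - z.\<close>

definition reg :: "complex \<Rightarrow> complex" where
  "reg y = singular_product \<nu> \<xi> a ({..l} - {0}) (1 - y)"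

definition reg_fps :: "complex fps" where
  "reg_fps = fps_expansion reg 0"

lemma reg_expansion: "reg has_fps_expansion reg_fps"
proof -
  have "\<xi> j \<noteq> 1" if "j \<in> {..l} - {0}" for j
    using that inj \<xi>0 by (metis Diff_iff atMost_iff inj_onD insertI1 le0)
  then have "singular_product \<nu> \<xi> a ({..l} - {0}) analytic_on {1}"
    using \<xi> by (intro singular_product_analytic[OF \<nu>]) (auto dest: not_sym)
  moreover have "(\<lambda>y::complex. 1 - y) analytic_on {0}" by (intro analytic_intros)
  ultimately have "reg analytic_on {0}"
    using analytic_on_compose[of "\<lambda>y. 1 - y" "{0}" "singular_product \<nu> \<xi> a ({..l} - {0})"]
    by (simp add: o_def reg_def[abs_def])
  then show ?thesis unfolding reg_fps_def by (rule analytic_at_imp_has_fps_expansion_0)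
qed

lemma \<omega>_reg: "z \<in> ball 0 1 \<Longrightarrow> \<omega> z = (1 - z) powr (- \<alpha>) * reg (1 - z)"
  by (simp add: \<omega> reg_def singular_product_def prod.remove[of "{..l}" 0] \<xi>0 a0)

lemma \<omega>_expansion: "\<omega> has_fps_expansion Abs_fps w"
proof (rule has_fps_expansionI)
  have "\<forall>\<^sub>F z in nhds (0::complex). z \<in> ball 0 1" by (intro eventually_nhds_in_open) auto
  then show "\<forall>\<^sub>F z in nhds 0. (\<lambda>n. fps_nth (Abs_fps w) n * z ^ n) sums \<omega> z"
    by eventually_elim (use gen in \<open>auto simp: generating_function_def\<close>)
qed

text \<open>The convolution is a coefficient of \<omega>(z) (1 - z)^(-\<beta>), again a singular
  product, whose exponent at 1 has become \<alpha> + \<beta>. By \<open>Re_a\<close> the other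
  singularities contribute at most n^(Re \<alpha> - 1).\<close>

lemma convolution_bin_coeff_asymptotics:
  "poly_growth (max (Re \<alpha> - 1) (Re (\<alpha> + \<beta>) - 1 - real R))
     (\<lambda>n. (\<Sum>i\<le>n. w i * bin_coeff \<beta> (n - i)) - (\<Sum>r<R. fps_nth reg_fps r * bin_coeff (\<alpha> + \<beta> - of_nat r) n))"
proof -
  define b where "b = a(0 := \<alpha> + \<beta>)"
  define \<sigma> where "\<sigma> = max (Re \<alpha> - 1) (Re (\<alpha> + \<beta>) - 1 - real R)"
  define X where "X = Abs_fps w * Abs_fps (bin_coeff \<beta>)"
  have X_nth: "fps_nth X n = (\<Sum>i\<le>n. w i * bin_coeff \<beta> (n - i))" for n
    by (simp add: X_def fps_mult_nth atLeast0AtMost)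
  have rest: "singular_product \<nu> \<xi> b ({..l} - {0}) = singular_product \<nu> \<xi> a ({..l} - {0})"
    unfolding fun_eq_iff singular_product_def by (auto simp: b_def intro!: prod.cong)
  have "singular_product \<nu> \<xi> b {..l} z = \<omega> z * (1 - z) powr (- \<beta>)" if "z \<in> ball 0 1" for z
  proof -
    have z: "z \<noteq> 1" using that by auto
    have "singular_product \<nu> \<xi> b {..l} z = (1 - z) powr (- (\<alpha> + \<beta>)) * singular_product \<nu> \<xi> b ({..l} - {0}) z"
      by (simp add: singular_product_def prod.remove[of "{..l}" 0] \<xi>0 b_def)
    also have "\<dots> = (1 - z) powr (- \<alpha>) * (1 - z) powr (- \<beta>) * reg (1 - z)"
      using z by (simp add: rest reg_def powr_diff powr_minus field_simps)
    finally show ?thesis by (simp add: \<omega>_reg[OF that])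
  qed
  then have "\<forall>\<^sub>F z in nhds 0. \<omega> z * (1 - z) powr (- \<beta>) = singular_product \<nu> \<xi> b {..l} z"
    using eventually_nhds_in_open[of "ball 0 1" "0::complex"] by (auto elim!: eventually_mono)
  note ev = this
  have "(\<lambda>z. \<omega> z * (1 - z) powr (- \<beta>)) has_fps_expansion X"
    unfolding X_def by (intro fps_expansion_intros \<omega>_expansion bin_coeff_expansion)
  then have X: "singular_product \<nu> \<xi> b {..l} has_fps_expansion X"
    by (rule has_fps_expansion_cong[OF ev refl, THEN iffD1])
  \<comment> \<open>The Darboux error n^(-M) has to stay within n^(Re \<alpha> - 1).\<close>
  obtain M :: nat where M: "real M \<ge> 1 - Re \<alpha>" using real_arch_simple by blast
  \<comment> \<open>Enough Taylor terms at every singularity to leave M bounded derivatives. This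
    may exceed R; the surplus terms at 1 are of order at most n^(Re (\<alpha> + \<beta>) - 1 -
    R).\<close>
  obtain N :: nat where N: "real N \<ge> real M + max (Re \<alpha>) (Re (\<alpha> + \<beta>))" using real_arch_simple by blast
  define R' where "R' = max R N"
  have bR: "real M \<le> real R' - Re (b j)" if "j \<in> {..l}" for j
    using that Re_a[of j] N by (auto simp: b_def R'_def)
  let ?S = "\<lambda>j r n. singular_coeff \<nu> \<xi> b {..l} j r * (bin_coeff (b j - of_nat r) n / \<xi> j ^ n)"
  have growth: "poly_growth (- real M) (\<lambda>n. fps_nth X n - (\<Sum>j\<le>l. \<Sum>r<R'. ?S j r n))"
    using \<xi> bR by (intro singular_product_coeff_asymptotics[OF \<nu> _ inj _ X]) auto
  have g1: "poly_growth \<sigma> (\<lambda>n. fps_nth X n - (\<Sum>j\<le>l. \<Sum>r<R'. ?S j r n))"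
    by (rule poly_growth_mono[OF growth]) (use M in \<open>auto simp: \<sigma>_def\<close>)
  have S_growth: "poly_growth (Re (b j) - real r - 1) (?S j r)" if "j \<le> l" for j r
  proof -
    have "poly_growth (Re (b j - of_nat r) - 1) (\<lambda>n. (1 / \<xi> j ^ n) * bin_coeff (b j - of_nat r) n)"
      by (intro poly_growth_mult_norm_le poly_growth_bin_coeff)
         (simp add: \<xi>[OF that] norm_divide norm_power)
    from poly_growth_cmult[OF this, of "singular_coeff \<nu> \<xi> b {..l} j r"] show ?thesis by simp
  qed
  have g2: "poly_growth \<sigma> (\<lambda>n. \<Sum>j\<in>{..l} - {0}. \<Sum>r<R'. ?S j r n)"
  proof (intro poly_growth_sum)
    fix j r assume j: "j \<in> {..l} - {0}"
    show "poly_growth \<sigma> (?S j r)"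
      by (rule poly_growth_mono[OF S_growth]) (use j Re_a[of j] in \<open>auto simp: b_def \<sigma>_def\<close>)
  qed
  have g3: "poly_growth \<sigma> (\<lambda>n. \<Sum>r\<in>{R..<R'}. ?S 0 r n)"
    by (intro poly_growth_sum poly_growth_mono[OF S_growth]) (auto simp: b_def \<sigma>_def)
  have coeff: "singular_coeff \<nu> \<xi> b {..l} 0 r = fps_nth reg_fps r" for r
    by (simp add: singular_coeff_def reg_fps_def reg_def[abs_def] rest \<xi>0)
  have "(\<Sum>j\<le>l. \<Sum>r<R'. ?S j r n) = (\<Sum>r<R. fps_nth reg_fps r * bin_coeff (\<alpha> + \<beta> - of_nat r) n) +
      (\<Sum>r\<in>{R..<R'}. ?S 0 r n) + (\<Sum>j\<in>{..l} - {0}. \<Sum>r<R'. ?S j r n)" for n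
  proof -
    have "(\<Sum>j\<le>l. \<Sum>r<R'. ?S j r n) = (\<Sum>r<R'. ?S 0 r n) + (\<Sum>j\<in>{..l} - {0}. \<Sum>r<R'. ?S j r n)"
      by (simp add: sum.remove[of "{..l}" 0])
    also have "(\<Sum>r<R'. ?S 0 r n) = (\<Sum>r<R. ?S 0 r n) + (\<Sum>r\<in>{R..<R'}. ?S 0 r n)"
      using sum.atLeastLessThan_concat[of 0 R R' "\<lambda>r. ?S 0 r n"] by (simp add: R'_def lessThan_atLeast0)
    also have "(\<Sum>r<R. ?S 0 r n) = (\<Sum>r<R. fps_nth reg_fps r * bin_coeff (\<alpha> + \<beta> - of_nat r) n)"
      unfolding coeff by (simp add: \<xi>0 b_def)
    finally show ?thesis .
  qed
  with poly_growth_add[OF poly_growth_add[OF g1 g2] g3] show ?thesis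
    unfolding \<sigma>_def [symmetric] by (simp add: X_nth algebra_simps)
qed

text \<open>\<open>bin_coeff 0\<close> is the unit of convolution, so \<beta> = 0 and R = 0 in the
  preceding asymptotics leave the weights themselves, with an empty main sum.\<close>

lemma weights_growth: "poly_growth (Re \<alpha> - 1) w"
proof -
  have "(\<Sum>i\<le>n. w i * bin_coeff 0 (n - i)) = w n" for n
  proof -
    have "(\<Sum>i\<le>n. w i * bin_coeff 0 (n - i)) = (\<Sum>i\<le>n. if i = n then w i else 0)"
      by (intro sum.cong) (auto simp: bin_coeff_def pochhammer_0_left)
    then show ?thesis by simp
  qed
  with convolution_bin_coeff_asymptotics[of 0 0] show ?thesis by simp
qed

lemma stable: "scq_stable w \<alpha>"
proof -
  obtain C where C: "\<forall>\<^sub>F n in sequentially. norm (w n) \<le> C * real n powr (Re \<alpha> - 1)"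
    using weights_growth poly_growth_shift_iff[of "Re \<alpha> - 1" w 0] by auto
  then have "\<forall>\<^sub>F n in sequentially. norm (w n) \<le> C * norm (complex_of_nat n powr (\<alpha> - 1))"
    using eventually_gt_at_top[of 0]
  proof eventually_elim
    case (elim n)
    have "norm (complex_of_real (real n) powr (\<alpha> - 1)) = real n powr Re (\<alpha> - 1)"
      using elim(2) by (simp add: norm_powr_real_powr)
    with elim(1) show ?case by simp
  qed
  then show ?thesis unfolding scq_stable_def by (rule bigoI)
qed

text \<open>The expansion of \<open>h\<^sup>\<alpha> exp (\<theta> h) \<omega>(exp (-h))\<close> in powers of \<open>y = 1 - exp (-h)\<close>.\<close>
definition symbol_fps :: "real \<Rightarrow> complex fps" where
  "symbol_fps \<theta> = fps_expansion (pow_kernel (- \<alpha>) \<theta>) 0 * reg_fps"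

section \<open>Consistency and the expansion of the symbol\<close>

text \<open>At z = exp (-h) the factor y^(-\<alpha>) of \<omega> combines with h^\<alpha> exp
  (\<theta> h) to \<open>pow_kernel (- \<alpha>) \<theta> y\<close>, analytic at y = 0. The
  consistency error is thus an analytic germ in y, and its order in h is its order of
  vanishing.\<close>

lemma consistent_iff: "scq_consistent \<omega> \<alpha> \<theta> p \<longleftrightarrow> (\<forall>r<p. fps_nth (symbol_fps \<theta> - 1) r = 0)"
proof -
  define F where "F = (\<lambda>y. pow_kernel (- \<alpha>) \<theta> y * reg y - 1)"
  have F: "F has_fps_expansion symbol_fps \<theta> - 1"
    unfolding F_def symbol_fps_def by (intro fps_expansion_intros pow_kernel_expansion reg_expansion)
  have eq: "of_real h powr \<alpha> * of_real (exp (\<theta> * h)) * \<omega> (of_real (exp (- h))) - 1 = F (of_real (1 - exp (- h)))"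
    if "h > 0" for h
  proof -
    have z: "complex_of_real (exp (- h)) \<in> ball 0 1" using that by simp
    have y: "1 - exp (- h) > 0" using that by simp
    then have "complex_of_real (1 - exp (- h)) powr (- \<alpha>) * of_real (1 - exp (- h)) powr \<alpha> = 1"
      by (simp add: powr_minus del: of_real_diff)
    then show ?thesis
      unfolding F_def pow_kernel_exp_minus[OF that] \<omega>_reg[OF z] by (simp add: mult_ac)
  qed
  have "scq_consistent \<omega> \<alpha> \<theta> p \<longleftrightarrow> (\<lambda>h. F (of_real (1 - exp (- h)))) \<in> O[at_right 0](\<lambda>h. complex_of_real (h ^ p))"
    unfolding scq_consistent_def
    by (rule landau_o.big.in_cong) (use eq in \<open>auto simp: eventually_at_right_less intro: eventually_mono[OF eventually_at_right_less]\<close>)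
  then show ?thesis using has_fps_expansion_bigo_iff[OF F] by simp
qed

section \<open>Quadrature of powers\<close>

text \<open>The powers are replaced by R terms of their expansion. The second bound on R makes the
  remainder decay fast enough for \<open>poly_growth_convolution\<close>; each main term is a
  convolution already expanded, and collecting equal exponents gives the Cauchy product of the two
  series.\<close>

lemma convolution_pow_asymptotics:
  assumes \<beta>: "\<beta> \<notin> \<int>\<^sub>\<le>\<^sub>0" and \<phi>: "0 \<le> \<phi>" and R: "R > 0" "real R \<ge> Re \<beta> + \<bar>Re \<alpha> - 1\<bar> + 1" "real R \<ge> Re \<beta>"
  shows "poly_growth (Re \<alpha> - 1) (\<lambda>m. (\<Sum>i\<le>m. w i * pow_fun \<beta> (real (m - i) + \<phi>)) -
    Gamma \<beta> * (\<Sum>i<R. fps_nth (fps_expansion (pow_kernel \<beta> \<phi>) 0 * reg_fps) i * bin_coeff (\<alpha> + \<beta> - of_nat i) m))"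
proof -
  let ?e = "kernel_coeff \<beta> \<phi>" and ?g = "fps_nth reg_fps"
  define \<rho> where "\<rho> = (\<lambda>k. pow_fun \<beta> (real k + \<phi>) - Gamma \<beta> * (\<Sum>r<R. ?e r * bin_coeff (\<beta> - of_nat r) k))"
  have G: "Gamma \<beta> * rGamma \<beta> = 1" using \<beta> by (simp add: rGamma_inverse_Gamma Gamma_eq_zero_iff)
  have "poly_growth (Re \<beta> - 1 - real R) \<rho>"
  proof (rule poly_growth_cong_eventually[OF poly_growth_cmult[OF shifted_pow_asymptotics[OF R(1)]]])
    \<comment> \<open>k = 0 is left out: for \<phi> = 0 the power is evaluated at 0 there, where
      \<open>pow_fun\<close> follows a convention.\<close>
    show "\<forall>\<^sub>F k in sequentially. Gamma \<beta> * (shifted_pow \<beta> \<phi> k - (\<Sum>r<R. ?e r * bin_coeff (\<beta> - of_nat r) k)) = \<rho> k"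
      using eventually_gt_at_top[of 0]
    proof eventually_elim
      case (elim k)
      have "Gamma \<beta> * shifted_pow \<beta> \<phi> k = pow_fun \<beta> (real k + \<phi>)"
        using elim \<phi> G by (simp add: shifted_pow_def pow_fun_def flip: mult.assoc)
      then show ?case by (simp add: \<rho>_def right_diff_distrib)
    qed
  qed
  then have 1: "poly_growth (Re \<alpha> - 1) (\<lambda>m. \<Sum>i\<le>m. w i * \<rho> (m - i))"
    by (rule poly_growth_convolution[OF weights_growth]) (use R in simp)
  \<comment> \<open>With only R - r terms for the r-th summand, all truncations contribute the same
    exponent Re (\<alpha> + \<beta>) - 1 - R, and the index pairs form the triangle r + k <
    R.\<close>
  define E where "E = (\<lambda>r m. (\<Sum>i\<le>m. w i * bin_coeff (\<beta> - of_nat r) (m - i)) -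
      (\<Sum>k<R - r. ?g k * bin_coeff (\<alpha> + (\<beta> - of_nat r) - of_nat k) m))"
  have E: "poly_growth (Re \<alpha> - 1) (E r)" if "r < R" for r
  proof (rule poly_growth_mono)
    show "poly_growth (max (Re \<alpha> - 1) (Re (\<alpha> + (\<beta> - of_nat r)) - 1 - real (R - r))) (E r)"
      unfolding E_def by (rule convolution_bin_coeff_asymptotics)
  qed (use that R in \<open>simp add: of_nat_diff\<close>)
  have 2: "poly_growth (Re \<alpha> - 1) (\<lambda>m. Gamma \<beta> * (\<Sum>r<R. ?e r * E r m))"
    by (intro poly_growth_cmult poly_growth_sum E) simp
  have sumE: "(\<Sum>r<R. ?e r * E r m) = (\<Sum>r<R. ?e r * (\<Sum>i\<le>m. w i * bin_coeff (\<beta> - of_nat r) (m - i))) -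
      (\<Sum>i<R. fps_nth (fps_expansion (pow_kernel \<beta> \<phi>) 0 * reg_fps) i * bin_coeff (\<alpha> + \<beta> - of_nat i) m)" for m
  proof -
    let ?f = "\<lambda>r k. ?e r * ?g k * bin_coeff (\<alpha> + \<beta> - of_nat (r + k)) m"
    have "(\<Sum>r<R. ?e r * (\<Sum>k<R - r. ?g k * bin_coeff (\<alpha> + (\<beta> - of_nat r) - of_nat k) m)) = (\<Sum>r<R. \<Sum>k<R - r. ?f r k)"
      by (simp add: sum_distrib_left algebra_simps)
    also have "\<dots> = (\<Sum>(r, k)\<in>Sigma {..<R} (\<lambda>r. {..<R - r}). ?f r k)"
      by (subst sum.Sigma) auto
    also have "Sigma {..<R} (\<lambda>r. {..<R - r}) = {(i, j). i + j < R}" by auto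
    also have "(\<Sum>(r, k)\<in>{(i, j). i + j < R}. ?f r k) = (\<Sum>i<R. \<Sum>r\<le>i. ?f r (i - r))"
      by (rule sum.triangle_reindex)
    also have "\<dots> = (\<Sum>i<R. fps_nth (fps_expansion (pow_kernel \<beta> \<phi>) 0 * reg_fps) i * bin_coeff (\<alpha> + \<beta> - of_nat i) m)"
      by (intro sum.cong) (simp_all add: fps_mult_nth atLeast0AtMost sum_distrib_right kernel_coeff_def)
    finally show ?thesis by (simp add: E_def right_diff_distrib sum_subtractf)
  qed
  have "(\<Sum>i\<le>m. w i * pow_fun \<beta> (real (m - i) + \<phi>)) =
      (\<Sum>i\<le>m. w i * \<rho> (m - i)) + Gamma \<beta> * (\<Sum>r<R. ?e r * (\<Sum>i\<le>m. w i * bin_coeff (\<beta> - of_nat r) (m - i)))" for m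
  proof -
    have "(\<Sum>i\<le>m. w i * pow_fun \<beta> (real (m - i) + \<phi>)) =
      (\<Sum>i\<le>m. w i * \<rho> (m - i)) + (\<Sum>i\<le>m. w i * (Gamma \<beta> * (\<Sum>r<R. ?e r * bin_coeff (\<beta> - of_nat r) (m - i))))"
      by (simp add: \<rho>_def algebra_simps flip: sum.distrib)
    also have "(\<Sum>i\<le>m. w i * (Gamma \<beta> * (\<Sum>r<R. ?e r * bin_coeff (\<beta> - of_nat r) (m - i)))) =
        (\<Sum>i\<le>m. \<Sum>r<R. Gamma \<beta> * (?e r * (w i * bin_coeff (\<beta> - of_nat r) (m - i))))"
      by (simp add: sum_distrib_left mult_ac)
    also have "\<dots> = (\<Sum>r<R. \<Sum>i\<le>m. Gamma \<beta> * (?e r * (w i * bin_coeff (\<beta> - of_nat r) (m - i))))"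
      by (rule sum.swap)
    also have "\<dots> = Gamma \<beta> * (\<Sum>r<R. ?e r * (\<Sum>i\<le>m. w i * bin_coeff (\<beta> - of_nat r) (m - i)))"
      by (simp add: sum_distrib_left)
    finally show ?thesis .
  qed
  with poly_growth_add[OF 1 2] show ?thesis
    by (simp add: sumE right_diff_distrib add_diff_eq)
qed

text \<open>
  The error at \<open>h = 1 / n\<close> multiplied by \<open>n\<^sup>\<alpha>\<^sup>+\<^sup>\<beta>\<^sup>-\<^sup>1\<close> and indexed by \<open>m = n + \<lfloor>\<theta>\<rfloor>\<close>, the largest \<open>j\<close> in the
  quadrature sum.
\<close>
definition scaled_error :: "real \<Rightarrow> complex \<Rightarrow> nat \<Rightarrow> complex" where
  "scaled_error \<theta> \<beta> m = (\<Sum>i\<le>m. w i * pow_fun \<beta> (real (m - i) + frac \<theta>)) -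
     Gamma \<beta> * shifted_pow (\<alpha> + \<beta>) (- of_int \<lfloor>\<theta>\<rfloor>) m"

text \<open>Both parts of \<open>scaled_error\<close> are expanded in the same sequences, and
  \<open>kernel_fps_mult\<close> shows that their series have a common factor. \<open>R0\<close>
  lets a caller ask for as many terms as it has to isolate.\<close>

lemma scaled_error_asymptotics:
  assumes \<beta>: "\<beta> \<notin> \<int>\<^sub>\<le>\<^sub>0"
  obtains R where "R \<ge> R0" "poly_growth (Re \<alpha> - 1) (\<lambda>m. scaled_error \<theta> \<beta> m -
    Gamma \<beta> * (\<Sum>i<R. fps_nth (fps_expansion (pow_kernel (\<alpha> + \<beta>) (- of_int \<lfloor>\<theta>\<rfloor>)) 0 * (symbol_fps \<theta> - 1)) i * bin_coeff (\<alpha> + \<beta> - of_nat i) m))"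
proof -
  define s \<delta> where "s = \<alpha> + \<beta>" and "\<delta> = - real_of_int \<lfloor>\<theta>\<rfloor>"
  obtain R1 :: nat where R1: "real R1 \<ge> \<bar>Re \<beta>\<bar> + \<bar>Re \<alpha> - 1\<bar> + 1" using real_arch_simple by blast
  define R where "R = max R0 R1"
  have "R1 > 0" using R1 by (cases R1) auto
  then have R: "R > 0" "real R \<ge> Re \<beta> + \<bar>Re \<alpha> - 1\<bar> + 1" "real R \<ge> Re \<beta>" "R \<ge> R0"
    using R1 by (auto simp: R_def)
  let ?K = "fps_expansion (pow_kernel s \<delta>) 0"
  have fps: "fps_expansion (pow_kernel \<beta> (frac \<theta>)) 0 * reg_fps = ?K * symbol_fps \<theta>"
    using kernel_fps_mult[of s "- \<alpha>" \<delta> \<theta>] by (simp add: symbol_fps_def s_def \<delta>_def frac_def mult.assoc)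
  have 1: "poly_growth (Re \<alpha> - 1) (\<lambda>m. (\<Sum>i\<le>m. w i * pow_fun \<beta> (real (m - i) + frac \<theta>)) -
     Gamma \<beta> * (\<Sum>i<R. fps_nth (?K * symbol_fps \<theta>) i * bin_coeff (s - of_nat i) m))"
    using convolution_pow_asymptotics[OF \<beta> frac_ge_0 R(1-3), of \<theta>] unfolding fps s_def .
  have "poly_growth (Re \<alpha> - 1) (\<lambda>m. shifted_pow s \<delta> m - (\<Sum>i<R. fps_nth ?K i * bin_coeff (s - of_nat i) m))"
    using shifted_pow_asymptotics[OF R(1), of s \<delta>] R(3)
    by (auto simp: kernel_coeff_def s_def intro: poly_growth_mono)
  from poly_growth_diff[OF 1 poly_growth_cmult[OF this, of "Gamma \<beta>"]]
  have "poly_growth (Re \<alpha> - 1) (\<lambda>m. scaled_error \<theta> \<beta> m -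
    Gamma \<beta> * (\<Sum>i<R. fps_nth (?K * (symbol_fps \<theta> - 1)) i * bin_coeff (s - of_nat i) m))"
    by (simp add: scaled_error_def s_def \<delta>_def algebra_simps sum_subtractf)
  then show ?thesis using that[OF R(4)] unfolding s_def \<delta>_def by blast
qed

text \<open>The product with the kernel series inherits the vanishing coefficients, so the main sum
  starts at index p at the earliest. The remainder n^(Re \<alpha> - 1) is the alternative Re \<beta>
  in the minimum.\<close>

lemma scaled_error_growth_if:
  assumes \<beta>: "\<beta> \<notin> \<int>\<^sub>\<le>\<^sub>0" and 0: "\<And>r. r < p \<Longrightarrow> fps_nth (symbol_fps \<theta> - 1) r = 0"
  shows "poly_growth (Re (\<alpha> + \<beta>) - 1 - min (Re \<beta>) (real p)) (scaled_error \<theta> \<beta>)"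
proof -
  define \<sigma> where "\<sigma> = Re (\<alpha> + \<beta>) - 1 - min (Re \<beta>) (real p)"
  let ?c = "\<lambda>i. fps_nth (fps_expansion (pow_kernel (\<alpha> + \<beta>) (- of_int \<lfloor>\<theta>\<rfloor>)) 0 * (symbol_fps \<theta> - 1)) i"
  obtain R where R: "poly_growth (Re \<alpha> - 1) (\<lambda>m. scaled_error \<theta> \<beta> m - Gamma \<beta> * (\<Sum>i<R. ?c i * bin_coeff (\<alpha> + \<beta> - of_nat i) m))"
    using scaled_error_asymptotics[OF \<beta>, of 0 \<theta>] by blast
  have "?c i = 0" if "i < p" for i
    unfolding fps_mult_nth by (intro sum.neutral ballI) (use that 0 in simp)
  then have "poly_growth \<sigma> (\<lambda>m. ?c i * bin_coeff (\<alpha> + \<beta> - of_nat i) m)" for i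
    using poly_growth_cmult[OF poly_growth_mono[OF poly_growth_bin_coeff[of "\<alpha> + \<beta> - of_nat i"], of \<sigma>], of "?c i"]
    by (cases "i < p") (auto simp: \<sigma>_def)
  then have 2: "poly_growth \<sigma> (\<lambda>m. Gamma \<beta> * (\<Sum>i<R. ?c i * bin_coeff (\<alpha> + \<beta> - of_nat i) m))"
    by (rule poly_growth_cmult[OF poly_growth_sum])
  have "Re \<alpha> - 1 \<le> \<sigma>" by (simp add: \<sigma>_def)
  from poly_growth_add[OF poly_growth_mono[OF R this] 2] show ?thesis by (simp add: \<sigma>_def)
qed

section \<open>From convergence back to consistency\<close>

text \<open>Once the lower coefficients vanish, the error starts with the r-th coefficient times
  \<open>bin_coeff (s - of_nat r)\<close>, which outgrows the assumed bound unless the coefficient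
  is 0. One \<beta> serves all r < p.\<close>

lemma symbol_coeffs_zero_if:
  assumes growth: "\<And>\<beta>. \<beta> \<notin> \<int>\<^sub>\<le>\<^sub>0 \<Longrightarrow> poly_growth (Re (\<alpha> + \<beta>) - 1 - min (Re \<beta>) (real p)) (scaled_error \<theta> \<beta>)"
    and "r < p"
  shows "fps_nth (symbol_fps \<theta> - 1) r = 0"
  using assms(2)
proof (induction r rule: less_induct)
  case (less r)
  \<comment> \<open>|Re \<alpha>| + 1 makes Re (s - r) > 0 for r < p, so that 1/\<Gamma>(s - r) is
    nonzero; Re \<beta> > p makes the dropped part n^(Re \<alpha> - 1) smaller than the term of
    index r.\<close>
  define \<beta> where "\<beta> = complex_of_real (real p + \<bar>Re \<alpha>\<bar> + 1)"
  define s where "s = \<alpha> + \<beta>"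
  have Re_\<beta>: "Re \<beta> > real p" by (simp add: \<beta>_def)
  then have \<beta>: "\<beta> \<notin> \<int>\<^sub>\<le>\<^sub>0" by (intro complex_Re_pos_nonpos_Ints) linarith
  have "Re (s - of_nat r) > 0" using less.prems by (simp add: s_def \<beta>_def)
  then have sr: "rGamma (s - of_nat r) \<noteq> 0"
    using complex_Re_pos_nonpos_Ints by (simp add: rGamma_eq_zero_iff)
  have G: "Gamma \<beta> \<noteq> 0" using \<beta> by (simp add: Gamma_eq_zero_iff)
  let ?D = "symbol_fps \<theta> - 1"
  let ?c = "\<lambda>i. fps_nth (fps_expansion (pow_kernel s (- of_int \<lfloor>\<theta>\<rfloor>)) 0 * ?D) i"
  let ?B = "\<lambda>i m. ?c i * bin_coeff (s - of_nat i) m"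
  obtain R where "R \<ge> Suc r" and R: "poly_growth (Re \<alpha> - 1) (\<lambda>m. scaled_error \<theta> \<beta> m - Gamma \<beta> * (\<Sum>i<R. ?B i m))"
    using scaled_error_asymptotics[OF \<beta>, of "Suc r" \<theta>] unfolding s_def by blast
  \<comment> \<open>The three competitors of the term of index r: the dropped part, the assumed
    error and the later terms. All exponents are below Re s - r - 1.\<close>
  define \<sigma> where "\<sigma> = max (Re \<alpha> - 1) (max (Re s - 1 - real p) (Re s - 1 - real (Suc r)))"
  have c_less: "?c i = 0" if "i < r" for i
    unfolding fps_mult_nth by (intro sum.neutral ballI) (use that less in simp)
  have c_r: "?c r = fps_nth ?D r"
  proof -
    have "?c r = (\<Sum>i\<in>{0..r}. kernel_coeff s (- of_int \<lfloor>\<theta>\<rfloor>) i * fps_nth ?D (r - i))"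
      by (simp add: fps_mult_nth kernel_coeff_def)
    also have "\<dots> = kernel_coeff s (- of_int \<lfloor>\<theta>\<rfloor>) 0 * fps_nth ?D (r - 0) +
        (\<Sum>i\<in>{0..r} - {0}. kernel_coeff s (- of_int \<lfloor>\<theta>\<rfloor>) i * fps_nth ?D (r - i))"
      by (rule sum.remove) auto
    also have "(\<Sum>i\<in>{0..r} - {0}. kernel_coeff s (- of_int \<lfloor>\<theta>\<rfloor>) i * fps_nth ?D (r - i)) = 0"
      by (intro sum.neutral ballI) (use less in auto)
    finally show ?thesis by simp
  qed
  have "(\<Sum>i<R. ?B i m) = ?B r m + (\<Sum>i\<in>{Suc r..<R}. ?B i m)" for m
  proof -
    have "(\<Sum>i<R. ?B i m) = (\<Sum>i<r. ?B i m) + (\<Sum>i\<in>{r..<R}. ?B i m)"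
      using sum.atLeastLessThan_concat[of 0 r R "\<lambda>i. ?B i m"] \<open>R \<ge> Suc r\<close> by (simp add: lessThan_atLeast0)
    also have "(\<Sum>i<r. ?B i m) = 0" by (intro sum.neutral) (simp add: c_less)
    also have "(\<Sum>i\<in>{r..<R}. ?B i m) = ?B r m + (\<Sum>i\<in>{Suc r..<R}. ?B i m)"
      using \<open>R \<ge> Suc r\<close> by (intro sum.atLeast_Suc_lessThan) simp
    finally show ?thesis by simp
  qed
  note split = this
  have err: "poly_growth \<sigma> (scaled_error \<theta> \<beta>)"
    using growth[OF \<beta>] Re_\<beta> by (auto simp: \<sigma>_def s_def intro: poly_growth_mono)
  have tail: "poly_growth \<sigma> (\<lambda>m. \<Sum>i\<in>{Suc r..<R}. ?B i m)"
    by (intro poly_growth_sum poly_growth_cmult poly_growth_mono[OF poly_growth_bin_coeff]) (auto simp: \<sigma>_def)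
  have "poly_growth \<sigma> (\<lambda>m. scaled_error \<theta> \<beta> m - Gamma \<beta> * (\<Sum>i<R. ?B i m))"
    by (rule poly_growth_mono[OF R]) (simp add: \<sigma>_def)
  from poly_growth_diff[OF err this] have "poly_growth \<sigma> (\<lambda>m. Gamma \<beta> * (\<Sum>i<R. ?B i m))" by simp
  from poly_growth_cmult[OF this, of "inverse (Gamma \<beta>)"] have "poly_growth \<sigma> (\<lambda>m. \<Sum>i<R. ?B i m)"
    using G by (simp flip: mult.assoc)
  from poly_growth_diff[OF this tail] have B: "poly_growth \<sigma> (\<lambda>m. fps_nth ?D r * bin_coeff (s - of_nat r) m)"
    unfolding split c_r by simp
  show ?case
  proof (rule ccontr)
    assume "fps_nth ?D r \<noteq> 0"
    then have "poly_growth \<sigma> (bin_coeff (s - of_nat r))"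
      using poly_growth_cmult[OF B, of "inverse (fps_nth ?D r)"] by (simp flip: mult.assoc)
    moreover have "\<sigma> < Re (s - of_nat r) - 1"
      using less.prems Re_\<beta> by (simp add: \<sigma>_def s_def)
    ultimately show False using poly_growth_bin_coeff_imp_rGamma_eq_0 sr by blast
  qed
qed

text \<open>Since n + \<theta> = m + frac \<theta>, the nodes are (m - j + frac \<theta>) / n.
  Homogeneity takes out n^(1 - \<beta>), which with h^\<alpha> makes n^(1 - \<alpha> -
  \<beta>).\<close>

lemma scq_error_pow_eq:
  assumes n: "n > 0" "real n + \<theta> \<ge> 0" "int n + \<lfloor>\<theta>\<rfloor> \<ge> 0"
  shows "scq_error_pow w \<alpha> \<theta> (1 / real n) \<beta> 1 = of_real (real n) powr (1 - (\<alpha> + \<beta>)) * scaled_error \<theta> \<beta> (nat (int n + \<lfloor>\<theta>\<rfloor>))"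
proof -
  define m where "m = nat (int n + \<lfloor>\<theta>\<rfloor>)"
  have m: "int m = int n + \<lfloor>\<theta>\<rfloor>" using n by (simp add: m_def)
  then have mr: "real m = real n + of_int \<lfloor>\<theta>\<rfloor>" by (metis of_int_add of_int_of_nat_eq)
  have set: "{j. real j * (1 / real n) \<le> 1 + \<theta> * (1 / real n)} = {..m}"
  proof -
    have "real j * (1 / real n) \<le> 1 + \<theta> * (1 / real n) \<longleftrightarrow> j \<le> m" for j
    proof -
      have "real j * (1 / real n) \<le> 1 + \<theta> * (1 / real n) \<longleftrightarrow> real j \<le> real n + \<theta>"
        using n(1) by (simp add: field_simps)
      also have "\<dots> \<longleftrightarrow> int j \<le> \<lfloor>real n + \<theta>\<rfloor>" using le_floor_iff[of "int j" "real n + \<theta>"] by simp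
      also have "\<lfloor>real n + \<theta>\<rfloor> = int m" using m by (simp add: floor_add_int[symmetric] add.commute)
      finally show ?thesis by simp
    qed
    then show ?thesis by auto
  qed
  have node: "pow_fun \<beta> (1 + (\<theta> - real j) * (1 / real n)) = of_real (real n) powr (1 - \<beta>) * pow_fun \<beta> (real (m - j) + frac \<theta>)"
    if "j \<le> m" for j
  proof -
    have "1 + (\<theta> - real j) * (1 / real n) = (real (m - j) + frac \<theta>) / real n"
      using n(1) that by (simp add: of_nat_diff mr frac_def field_simps)
    then show ?thesis using n(1) by (simp only:) (intro pow_fun_divide, auto)
  qed
  have n0: "complex_of_real (real n) \<noteq> 0" using n(1) by simp
  have inv: "complex_of_real (1 / real n) powr \<alpha> = of_real (real n) powr (- \<alpha>)"
    using n(1) by (simp add: powr_def Ln_of_real ln_div del: of_real_divide of_real_of_nat_eq)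
  have "(\<Sum>j\<le>m. w j * pow_fun \<beta> (1 + (\<theta> - real j) * (1 / real n))) =
      (\<Sum>j\<le>m. w j * (of_real (real n) powr (1 - \<beta>) * pow_fun \<beta> (real (m - j) + frac \<theta>)))"
    by (intro sum.cong refl) (simp only: node atMost_iff)
  then have "scq w \<alpha> \<theta> (1 / real n) (pow_fun \<beta>) 1 = of_real (real n) powr (- \<alpha>) * of_real (real n) powr (1 - \<beta>) *
      (\<Sum>j\<le>m. w j * pow_fun \<beta> (real (m - j) + frac \<theta>))"
    unfolding scq_def set inv by (simp only: sum_distrib_left mult_ac)
  also have "of_real (real n) powr (- \<alpha>) * of_real (real n) powr (1 - \<beta>) = of_real (real n) powr (1 - (\<alpha> + \<beta>))"
    using n0 by (simp only: powr_add[symmetric]) (simp add: algebra_simps)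
  finally have scq: "scq w \<alpha> \<theta> (1 / real n) (pow_fun \<beta>) 1 = of_real (real n) powr (1 - (\<alpha> + \<beta>)) *
      (\<Sum>j\<le>m. w j * pow_fun \<beta> (real (m - j) + frac \<theta>))" .
  have "of_real (real n) powr (1 - (\<alpha> + \<beta>)) * of_real (real n) powr (\<alpha> + \<beta> - 1) = of_real (real n) powr 0"
    by (simp only: powr_add[symmetric]) simp
  then have "of_real (real n) powr (1 - (\<alpha> + \<beta>)) * of_real (real n) powr (\<alpha> + \<beta> - 1) = (1 :: complex)"
    using n0 by simp
  \<comment> \<open>The base m - \<lfloor>\<theta>\<rfloor> is n, so the exact value enters at the
    same index m as the sum.\<close>
  moreover have "shifted_pow (\<alpha> + \<beta>) (- of_int \<lfloor>\<theta>\<rfloor>) m = rGamma (\<alpha> + \<beta>) * of_real (real n) powr (\<alpha> + \<beta> - 1)"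
    by (simp add: shifted_pow_def mr)
  ultimately have "RL_pow \<alpha> \<beta> 1 = of_real (real n) powr (1 - (\<alpha> + \<beta>)) * (Gamma \<beta> * shifted_pow (\<alpha> + \<beta>) (- of_int \<lfloor>\<theta>\<rfloor>) m)"
    by (simp add: RL_pow_eq mult_ac)
  then show ?thesis
    unfolding scq_error_pow_def scq scaled_error_def m_def [symmetric] by (simp only: right_diff_distrib)
qed

text \<open>The factor in \<open>scq_error_pow_eq\<close> has modulus n^(1 - Re (\<alpha> +
  \<beta>)), so bounds on both sides correspond with the same constant; then the index is shifted
  from n to m.\<close>

lemma convergent_iff_growth:
  "scq_convergent w \<alpha> \<theta> p \<longleftrightarrow>
     (\<forall>\<beta>. \<beta> \<notin> \<int>\<^sub>\<le>\<^sub>0 \<longrightarrow> poly_growth (Re (\<alpha> + \<beta>) - 1 - min (Re \<beta>) (real p)) (scaled_error \<theta> \<beta>))"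
proof -
  have "(\<exists>C. \<forall>\<^sub>F n in sequentially. norm (scq_error_pow w \<alpha> \<theta> (1 / real n) \<beta> 1) \<le> C * real n powr (- \<mu>)) \<longleftrightarrow>
      poly_growth (Re (\<alpha> + \<beta>) - 1 - \<mu>) (scaled_error \<theta> \<beta>)" for \<beta> \<mu>
  proof -
    have "\<forall>\<^sub>F n in sequentially. real n + \<theta> \<ge> 0" by real_asymp
    moreover have "\<forall>\<^sub>F n in sequentially. real n + of_int \<lfloor>\<theta>\<rfloor> \<ge> 0" by real_asymp
    ultimately have "\<forall>\<^sub>F n in sequentially. \<forall>C.
       norm (scq_error_pow w \<alpha> \<theta> (1 / real n) \<beta> 1) \<le> C * real n powr (- \<mu>) \<longleftrightarrow>
       norm (scaled_error \<theta> \<beta> (nat (int n + \<lfloor>\<theta>\<rfloor>))) \<le> C * real n powr (Re (\<alpha> + \<beta>) - 1 - \<mu>)"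
      using eventually_gt_at_top[of 0]
    proof eventually_elim
      case (elim n)
      have "int n + \<lfloor>\<theta>\<rfloor> \<ge> 0" using elim(2) by linarith
      then have "norm (scq_error_pow w \<alpha> \<theta> (1 / real n) \<beta> 1) =
          real n powr (1 - Re (\<alpha> + \<beta>)) * norm (scaled_error \<theta> \<beta> (nat (int n + \<lfloor>\<theta>\<rfloor>)))"
        using elim scq_error_pow_eq[of n \<theta> \<beta>]
        by (simp add: norm_mult norm_powr_real_powr del: of_real_of_nat_eq)
      moreover have "real n powr (- \<mu>) = real n powr (1 - Re (\<alpha> + \<beta>)) * real n powr (Re (\<alpha> + \<beta>) - 1 - \<mu>)"
        by (simp flip: powr_add)
      moreover have "real n powr (1 - Re (\<alpha> + \<beta>)) > 0" using elim(3) by simp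
      ultimately show ?case by (simp add: mult.left_commute)
    qed
    then have "(\<forall>\<^sub>F n in sequentially. norm (scq_error_pow w \<alpha> \<theta> (1 / real n) \<beta> 1) \<le> C * real n powr (- \<mu>)) \<longleftrightarrow>
       (\<forall>\<^sub>F n in sequentially. norm (scaled_error \<theta> \<beta> (nat (int n + \<lfloor>\<theta>\<rfloor>))) \<le> C * real n powr (Re (\<alpha> + \<beta>) - 1 - \<mu>))" for C
      by (intro eventually_subst) (auto elim: eventually_mono)
    then show ?thesis by (subst poly_growth_shift_iff[of _ _ "\<lfloor>\<theta>\<rfloor>"]) simp
  qed
  then show ?thesis unfolding scq_convergent_iff by simp
qed

lemma convergent_iff_consistent: "scq_convergent w \<alpha> \<theta> p \<longleftrightarrow> scq_consistent \<omega> \<alpha> \<theta> p"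
  unfolding convergent_iff_growth consistent_iff
  using scaled_error_growth_if symbol_coeffs_zero_if by blast

end

theorem theorem2p8:
  fixes \<alpha> :: complex and \<theta> :: real and p :: nat
    and w :: "nat \<Rightarrow> complex" and \<omega> \<nu> :: "complex \<Rightarrow> complex"
    and p1 p2 p3 p4 :: "complex poly"
    and l :: nat and \<xi> a :: "nat \<Rightarrow> complex"
  assumes "p > 0"
    and "generating_function w \<omega>"
    and "quotient_power_form \<omega> \<alpha> p1 p2 p3 p4"
    and "singular_factorization \<omega> \<alpha> l \<xi> a \<nu>"
    and "condition_omega \<omega> \<alpha> l a"
  shows "scq_convergent w \<alpha> \<theta> p \<longleftrightarrow> scq_stable w \<alpha> \<and> scq_consistent \<omega> \<alpha> \<theta> p"
proof -
  obtain \<mu> where \<mu>: "\<mu> analytic_on cball 0 1" "\<And>z. z \<in> ball 0 1 \<Longrightarrow> \<omega> z = singular_product \<mu> \<xi> a {..l} z"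
    using singular_factorization_product[OF assms(4)] by blast
  interpret singular_generating_function w \<omega> \<mu> \<alpha> l \<xi> a
    using assms(2,4,5) \<mu> by unfold_locales (auto simp: singular_factorization_def condition_omega_def)
  show ?thesis using stable convergent_iff_consistent by blast
qed

end
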